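(* Let $\mathcal{A}$ be an AB4*-category, let $\mathscr{C}$ be a small category, and let $G:\mathfrak{F}\mathscr{C}\to\mathcal{A}$ be a natural system on $\mathscr{C}$. Then $H^n_{BW}(\mathscr{C},G)\cong H^n(B^{\Box}\mathscr{C},G\circ\mathfrak{d})$ for all $n\ge0$.
   Context: **AB4*-category.** An Abelian category with all small products in which products are exact (axioms AB3*, AB4* ). **Natural systems and Baues–Wirsching cohomology.** The factorization category $\mathfrak{F}\mathscr{C}$ has as objects the morphisms of $\mathscr{C}$; a morphism $\alpha\to\beta$ is a pair $(u_0,u_1)$ with $u_0:\mathrm{dom}\,\beta\to\mathrm{dom}\,\alpha$, $u_1:\mathrm{cod}\,\alpha\to\mathrm{cod}\,\beta$ and $u_1\alpha u_0=\beta$. A natural system in $\mathcal{A}$ is a functor $G:\mathfrak{F}\mathscr{C}\to\mathcal{A}$. $H^n_{BW}(\mathscr{C},G)$ is the $n$-th cohomology of the cochain complex $\prod_{c_0\xrightarrow{\alpha_1}\cdots\xrightarrow{\alpha_n}c_n}G(\alpha_n\cdots\alpha_1)$ (for $n=0$: $\prod_{c}G(1_c)$) with differential, in element notation, $(d\varphi)(\alpha_1,\dots,\alpha_{n+1})=G(\alpha_1,1)\varphi(\alpha_2,\dots,\alpha_{n+1})+\sum_{i=1}^n(-1)^i\varphi(\dots,\alpha_{i+1}\alpha_i,\dots)+(-1)^{n+1}G(1,\alpha_{n+1})\varphi(\alpha_1,\dots,\alpha_n)$. **Cube category.** $\Box$ has objects $\mathbb{I}^n=\{0,1\}^n$, $n\ge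 0$ (with the product order); its morphisms are all compositions of the maps $\delta_i^{k,\varepsilon}:\mathbb{I}^{k-1}\to\mathbb{I}^k$, $\delta_i^{k,\varepsilon}(x_1,\dots,x_{k-1})=(x_1,\dots,x_{i-1},\varepsilon,x_i,\dots,x_{k-1})$ and $\sigma_i^k:\mathbb{I}^k\to\mathbb{I}^{k-1}$, $\sigma^k_i(x_1,\dots,x_k)=(x_1,\dots,x_{i-1},x_{i+1},\dots,x_k)$ ($k\ge1$, $1\le i\le k$, $\varepsilon\in\{0,1\}$) (and identities). A cubical set is a functor $X:\Box^{op}\to\mathrm{Set}$, $X_n=X(\mathbb{I}^n)$. **Cohomology of a cubical set.** $\Box/X$ has as objects the elements $x\in\coprod_nX_n$; for $y\in X_m$, $x\in X_n$, morphisms $y\to x$ are $\alpha\in\Box(\mathbb{I}^m,\mathbb{I}^n)$ with $X(\alpha)(x)=y$. For $F:\Box/X\to\mathcal{A}$ put $C^n(X,F)=\prod_{x\in X_n}F(x)$. Define $d^i_{n,\varepsilon}:C^{n-1}(X,F)\to C^n(X,F)$ by $pr_x\circ d^i_{n,\varepsilon}=F(\delta_i^{n,\varepsilon}:X(\delta_i^{n,\varepsilon})x\to x)\circ pr_{X(\delta_i^{n,\varepsilon})x}$ for $x\in X_n$, and $s^i_n:C^n(X,F)\to C^{n-1}(X,F)$ by $pr_x\circ s^i_n=F(\sigma^n_i:X(\sigma_i^n)x\to x)\circ pr_{X(\sigma^n_i)x}$ for $x\in X_{n-1}$. $C^n_N(X,F)$ is the kernel of the morphism $C^n(X,F)\to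 C^{n-1}(X,F)^n$ with components $s^1_n,\dots,s^n_n$, with differential $C_N^{n-1}\to C_N^n$ the restriction of $\sum_{i=1}^n(-1)^i(d^i_{n,0}-d^i_{n,1})$. $H^n(X,F)$ is the $n$-th cohomology of $C^*_N(X,F)$. **Cubical nerve and $\mathfrak{d}$.** $B^{\Box}\mathscr{C}$ is the cubical set with $B^\Box_n\mathscr{C}=\mathrm{Cat}(\mathbb{I}^n,\mathscr{C})$, $\Box$ acting by precomposition. $\Box/B^\Box\mathscr{C}$ is identified with the category $\Box/\mathscr{C}$ whose objects are functors $g:\mathbb{I}^n\to\mathscr{C}$ and whose morphisms from $f:\mathbb{I}^m\to\mathscr{C}$ to $g:\mathbb{I}^n\to\mathscr{C}$ are $\theta\in\Box(\mathbb{I}^m,\mathbb{I}^n)$ with $g\theta=f$. Let $0^n,1^n\in\mathbb{I}^n$ be the points with all coordinates $0$, resp. $1$. The functor $\mathfrak{d}:\Box/\mathscr{C}\to\mathfrak{F}\mathscr{C}$ sends $g:\mathbb{I}^n\to\mathscr{C}$ to the morphism $g(0^n\le1^n):g(0^n)\to g(1^n)$, and $\theta:f\to g$ to the pair $\big(g(0^n\le\theta(0^m)),\,g(\theta(1^m)\le1^n)\big)$. *)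

theory Defs
  imports "HOL-Library.FuncSet" "HOL-Algebra.FiniteProduct"
begin

section \<open>Categories and functors\<close>

record ('o, 'm) precat =
  Obj :: "'o set"
  Arr :: "'m set"
  Dom :: "'m \<Rightarrow> 'o"
  Cod :: "'m \<Rightarrow> 'o"
  Id :: "'o \<Rightarrow> 'm"
  Comp :: "'m \<Rightarrow> 'm \<Rightarrow> 'm"  (infixl "\<cdot>\<index>" 70)

definition Hom :: "('o, 'm, 'z) precat_scheme \<Rightarrow> 'o \<Rightarrow> 'o \<Rightarrow> 'm set" where
  "Hom C x y = {f \<in> Arr C. Dom C f = x \<and> Cod C f = y}"

locale category =
  fixes C :: "('o, 'm, 'z) precat_scheme" (structure)
  assumes Dom_in: "f \<in> Arr C \<Longrightarrow> Dom C f \<in> Obj C"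
    and Cod_in: "f \<in> Arr C \<Longrightarrow> Cod C f \<in> Obj C"
    and Id_in: "x \<in> Obj C \<Longrightarrow> Id C x \<in> Hom C x x"
    and Comp_in: "f \<in> Hom C x y \<Longrightarrow> g \<in> Hom C y z \<Longrightarrow> g \<cdot> f \<in> Hom C x z"
    and Comp_Id: "f \<in> Hom C x y \<Longrightarrow> f \<cdot> Id C x = f"
    and Id_Comp: "f \<in> Hom C x y \<Longrightarrow> Id C y \<cdot> f = f"
    and Comp_assoc: "f \<in> Hom C w x \<Longrightarrow> g \<in> Hom C x y \<Longrightarrow> h \<in> Hom C y z
                     \<Longrightarrow> h \<cdot> (g \<cdot> f) = (h \<cdot> g) \<cdot> f"

definition op_cat :: "('o, 'm) precat \<Rightarrow> ('o, 'm) precat" where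
  "op_cat C = \<lparr>Obj = Obj C, Arr = Arr C, Dom = Cod C, Cod = Dom C, Id = Id C,
               Comp = (\<lambda>g f. f \<cdot>\<^bsub>C\<^esub> g)\<rparr>"

record ('o, 'm, 'p, 'q) ftor =
  Fo :: "'o \<Rightarrow> 'p"
  Fa :: "'m \<Rightarrow> 'q"

locale cat_functor = C: category C + D: category D
  for C :: "('o, 'm, 'y) precat_scheme" and D :: "('p, 'q, 'z) precat_scheme" +
  fixes F :: "('o, 'm, 'p, 'q) ftor"
  assumes Fo_in: "x \<in> Obj C \<Longrightarrow> Fo F x \<in> Obj D"
    and Fa_in: "f \<in> Hom C x y \<Longrightarrow> Fa F f \<in> Hom D (Fo F x) (Fo F y)"
    and Fa_Id: "x \<in> Obj C \<Longrightarrow> Fa F (Id C x) = Id D (Fo F x)"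
    and Fa_Comp: "f \<in> Hom C x y \<Longrightarrow> g \<in> Hom C y z
                  \<Longrightarrow> Fa F (g \<cdot>\<^bsub>C\<^esub> f) = Fa F g \<cdot>\<^bsub>D\<^esub> Fa F f"

text \<open>Functors are made extensional (\<open>undefined\<close> outside objects and arrows of the source)
  so that equality of elements of the set of functors is equality of functors.\<close>

definition functors ::
    "('o, 'm, 'y) precat_scheme \<Rightarrow> ('p, 'q, 'z) precat_scheme \<Rightarrow> ('o, 'm, 'p, 'q) ftor set" where
  "functors C D = {F. cat_functor C D F \<and> Fo F \<in> extensional (Obj C) \<and> Fa F \<in> extensional (Arr C)}"

definition ftor_comp :: "('o, 'm, 'y) precat_scheme \<Rightarrow> ('p, 'q, 'r, 's) ftor
    \<Rightarrow> ('o, 'm, 'p, 'q) ftor \<Rightarrow> ('o, 'm, 'r, 's) ftor" where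
  "ftor_comp C G F = \<lparr>Fo = compose (Obj C) (Fo G) (Fo F), Fa = compose (Arr C) (Fa G) (Fa F)\<rparr>"

text \<open>The category of those sets whose elements have type \<open>'x\<close>.\<close>

definition set_cat :: "('x set, 'x set \<times> 'x set \<times> ('x \<Rightarrow> 'x)) precat" where
  "set_cat = \<lparr>Obj = UNIV,
              Arr = {(S, T, f). f \<in> S \<rightarrow>\<^sub>E T},
              Dom = (\<lambda>(S, T, f). S),
              Cod = (\<lambda>(S, T, f). T),
              Id = (\<lambda>S. (S, S, \<lambda>x\<in>S. x)),
              Comp = (\<lambda>(T, U, g) (S, T', f). (S, U, compose S g f))\<rparr>"

definition isomorphic :: "('o, 'm, 'z) precat_scheme \<Rightarrow> 'o \<Rightarrow> 'o \<Rightarrow> bool" where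
  "isomorphic C x y \<longleftrightarrow> (\<exists>f \<in> Hom C x y. \<exists>g \<in> Hom C y x.
     g \<cdot>\<^bsub>C\<^esub> f = Id C x \<and> f \<cdot>\<^bsub>C\<^esub> g = Id C y)"

definition monic :: "('o, 'm, 'z) precat_scheme \<Rightarrow> 'm \<Rightarrow> bool" where
  "monic C f \<longleftrightarrow> f \<in> Arr C \<and> (\<forall>w. \<forall>g \<in> Hom C w (Dom C f). \<forall>h \<in> Hom C w (Dom C f).
     f \<cdot>\<^bsub>C\<^esub> g = f \<cdot>\<^bsub>C\<^esub> h \<longrightarrow> g = h)"

definition epic :: "('o, 'm, 'z) precat_scheme \<Rightarrow> 'm \<Rightarrow> bool" where
  "epic C f \<longleftrightarrow> f \<in> Arr C \<and> (\<forall>w. \<forall>g \<in> Hom C (Cod C f) w. \<forall>h \<in> Hom C (Cod C f) w.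
     g \<cdot>\<^bsub>C\<^esub> f = h \<cdot>\<^bsub>C\<^esub> f \<longrightarrow> g = h)"


section \<open>Smallness\<close>

text \<open>The type \<open>'u\<close> bounds the size of small sets; it is required to be infinite where it is used.
  If \<open>C\<close> is small and \<open>A\<close> has exact small products with respect to some universe, then this
  holds in particular for the products indexed by sets of size at most \<open>'u\<close>, for any infinite
  \<open>'u\<close> that is itself small and at least as large as \<open>C\<close>.\<close>

definition small :: "'u itself \<Rightarrow> 'a set \<Rightarrow> bool" where
  "small U S \<longleftrightarrow> (\<exists>e :: 'a \<Rightarrow> 'u. inj_on e S)"

definition small_category :: "'u itself \<Rightarrow> ('o, 'm, 'z) precat_scheme \<Rightarrow> bool" where
  "small_category U C \<longleftrightarrow> category C \<and> small U (Obj C) \<and> small U (Arr C)"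


section \<open>Products\<close>

definition is_product ::
    "('o, 'm, 'z) precat_scheme \<Rightarrow> 'i set \<Rightarrow> ('i \<Rightarrow> 'o) \<Rightarrow> 'o \<Rightarrow> ('i \<Rightarrow> 'm) \<Rightarrow> bool" where
  "is_product C I X P p \<longleftrightarrow> P \<in> Obj C \<and> (\<forall>i\<in>I. p i \<in> Hom C P (X i)) \<and>
     (\<forall>W \<in> Obj C. \<forall>h. (\<forall>i\<in>I. h i \<in> Hom C W (X i)) \<longrightarrow>
       (\<exists>!u. u \<in> Hom C W P \<and> (\<forall>i\<in>I. p i \<cdot>\<^bsub>C\<^esub> u = h i)))"

definition chosen_product ::
    "('o, 'm, 'z) precat_scheme \<Rightarrow> 'i set \<Rightarrow> ('i \<Rightarrow> 'o) \<Rightarrow> 'o \<times> ('i \<Rightarrow> 'm)" where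
  "chosen_product C I X = (SOME (P, p). is_product C I X P p)"

definition prod_ob :: "('o, 'm, 'z) precat_scheme \<Rightarrow> 'i set \<Rightarrow> ('i \<Rightarrow> 'o) \<Rightarrow> 'o" where
  "prod_ob C I X = fst (chosen_product C I X)"

definition prod_pr :: "('o, 'm, 'z) precat_scheme \<Rightarrow> 'i set \<Rightarrow> ('i \<Rightarrow> 'o) \<Rightarrow> 'i \<Rightarrow> 'm" where
  "prod_pr C I X = snd (chosen_product C I X)"

text \<open>The morphism from \<open>W\<close> to the product of the \<open>X i\<close> with components \<open>h i\<close>.\<close>

definition prod_lift ::
    "('o, 'm, 'z) precat_scheme \<Rightarrow> 'i set \<Rightarrow> ('i \<Rightarrow> 'o) \<Rightarrow> 'o \<Rightarrow> ('i \<Rightarrow> 'm) \<Rightarrow> 'm" where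
  "prod_lift C I X W h =
     (THE u. u \<in> Hom C W (prod_ob C I X) \<and> (\<forall>i\<in>I. prod_pr C I X i \<cdot>\<^bsub>C\<^esub> u = h i))"


section \<open>Abelian categories and the axioms AB3* and AB4*\<close>

record ('o, 'm) addcat = "('o, 'm) precat" +
  Add :: "'m \<Rightarrow> 'm \<Rightarrow> 'm"  (infixl "\<^bold>+\<index>" 65)
  Zero :: "'o \<Rightarrow> 'o \<Rightarrow> 'm"

text \<open>The (additively meant) group structure on a hom-set, written as a multiplicative
  group to make finite sums available as \<^const>\<open>finprod\<close>.\<close>

definition hom_group :: "('o, 'm, 'z) addcat_scheme \<Rightarrow> 'o \<Rightarrow> 'o \<Rightarrow> 'm monoid" where
  "hom_group A x y = \<lparr>carrier = Hom A x y, mult = Add A, one = Zero A x y\<rparr>"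

locale preadditive_category = category A
  for A :: "('o, 'm, 'z) addcat_scheme" (structure) +
  assumes hom_group: "x \<in> Obj A \<Longrightarrow> y \<in> Obj A \<Longrightarrow> comm_group (hom_group A x y)"
    and Comp_Add: "f \<in> Hom A x y \<Longrightarrow> f' \<in> Hom A x y \<Longrightarrow> g \<in> Hom A y z
                   \<Longrightarrow> g \<cdot> (f \<^bold>+ f') = g \<cdot> f \<^bold>+ g \<cdot> f'"
    and Add_Comp: "f \<in> Hom A x y \<Longrightarrow> g \<in> Hom A y z \<Longrightarrow> g' \<in> Hom A y z
                   \<Longrightarrow> (g \<^bold>+ g') \<cdot> f = g \<cdot> f \<^bold>+ g' \<cdot> f"

definition zero_object :: "('o, 'm, 'z) precat_scheme \<Rightarrow> 'o \<Rightarrow> bool" where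
  "zero_object C z \<longleftrightarrow> z \<in> Obj C \<and> (\<forall>x \<in> Obj C. (\<exists>!f. f \<in> Hom C x z) \<and> (\<exists>!f. f \<in> Hom C z x))"

definition is_biproduct ::
    "('o, 'm, 'z) addcat_scheme \<Rightarrow> 'o \<Rightarrow> 'o \<Rightarrow> 'o \<Rightarrow> 'm \<Rightarrow> 'm \<Rightarrow> 'm \<Rightarrow> 'm \<Rightarrow> bool" where
  "is_biproduct A x y b p q i j \<longleftrightarrow>
     p \<in> Hom A b x \<and> q \<in> Hom A b y \<and> i \<in> Hom A x b \<and> j \<in> Hom A y b \<and>
     p \<cdot>\<^bsub>A\<^esub> i = Id A x \<and> q \<cdot>\<^bsub>A\<^esub> j = Id A y \<and>
     p \<cdot>\<^bsub>A\<^esub> j = Zero A y x \<and> q \<cdot>\<^bsub>A\<^esub> i = Zero A x y \<and>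
     (i \<cdot>\<^bsub>A\<^esub> p) \<^bold>+\<^bsub>A\<^esub> (j \<cdot>\<^bsub>A\<^esub> q) = Id A b"

locale additive_category = preadditive_category +
  assumes has_zero_object: "\<exists>z. zero_object A z"
    and has_biproducts: "x \<in> Obj A \<Longrightarrow> y \<in> Obj A \<Longrightarrow> \<exists>b p q i j. is_biproduct A x y b p q i j"

definition is_kernel :: "('o, 'm, 'z) addcat_scheme \<Rightarrow> 'm \<Rightarrow> 'm \<Rightarrow> bool" where
  "is_kernel A f k \<longleftrightarrow> f \<in> Arr A \<and> k \<in> Arr A \<and> Cod A k = Dom A f \<and>
     f \<cdot>\<^bsub>A\<^esub> k = Zero A (Dom A k) (Cod A f) \<and>
     (\<forall>w. \<forall>h \<in> Hom A w (Dom A f). f \<cdot>\<^bsub>A\<^esub> h = Zero A w (Cod A f) \<longrightarrow>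
        (\<exists>!u. u \<in> Hom A w (Dom A k) \<and> k \<cdot>\<^bsub>A\<^esub> u = h))"

definition is_cokernel :: "('o, 'm, 'z) addcat_scheme \<Rightarrow> 'm \<Rightarrow> 'm \<Rightarrow> bool" where
  "is_cokernel A f q \<longleftrightarrow> f \<in> Arr A \<and> q \<in> Arr A \<and> Dom A q = Cod A f \<and>
     q \<cdot>\<^bsub>A\<^esub> f = Zero A (Dom A f) (Cod A q) \<and>
     (\<forall>w. \<forall>h \<in> Hom A (Cod A f) w. h \<cdot>\<^bsub>A\<^esub> f = Zero A (Dom A f) w \<longrightarrow>
        (\<exists>!u. u \<in> Hom A (Cod A q) w \<and> u \<cdot>\<^bsub>A\<^esub> q = h))"

locale abelian_category = additive_category +
  assumes has_kernels: "f \<in> Arr A \<Longrightarrow> \<exists>k. is_kernel A f k"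
    and has_cokernels: "f \<in> Arr A \<Longrightarrow> \<exists>q. is_cokernel A f q"
    and monic_is_kernel: "monic A f \<Longrightarrow> \<exists>g. is_kernel A g f"
    and epic_is_cokernel: "epic A f \<Longrightarrow> \<exists>g. is_cokernel A g f"

definition short_exact :: "('o, 'm, 'z) addcat_scheme \<Rightarrow> 'm \<Rightarrow> 'm \<Rightarrow> bool" where
  "short_exact A f g \<longleftrightarrow> is_kernel A g f \<and> is_cokernel A f g"

definition AB3_star :: "'u itself \<Rightarrow> ('o, 'm, 'z) addcat_scheme \<Rightarrow> bool" where
  "AB3_star U A \<longleftrightarrow> (\<forall>(I :: 'u set) X. (\<forall>i\<in>I. X i \<in> Obj A) \<longrightarrow> (\<exists>P p. is_product A I X P p))"

definition products_exact :: "'u itself \<Rightarrow> ('o, 'm, 'z) addcat_scheme \<Rightarrow> bool" where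
  "products_exact U A \<longleftrightarrow> (\<forall>(I :: 'u set) f g P p Q q R r \<phi> \<gamma>.
     (\<forall>i\<in>I. short_exact A (f i) (g i)) \<longrightarrow>
     is_product A I (\<lambda>i. Dom A (f i)) P p \<longrightarrow>
     is_product A I (\<lambda>i. Cod A (f i)) Q q \<longrightarrow>
     is_product A I (\<lambda>i. Cod A (g i)) R r \<longrightarrow>
     \<phi> \<in> Hom A P Q \<longrightarrow> (\<forall>i\<in>I. q i \<cdot>\<^bsub>A\<^esub> \<phi> = f i \<cdot>\<^bsub>A\<^esub> p i) \<longrightarrow>
     \<gamma> \<in> Hom A Q R \<longrightarrow> (\<forall>i\<in>I. r i \<cdot>\<^bsub>A\<^esub> \<gamma> = g i \<cdot>\<^bsub>A\<^esub> q i) \<longrightarrow>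
     short_exact A \<phi> \<gamma>)"

definition AB4_star_category :: "'u itself \<Rightarrow> ('o, 'm, 'z) addcat_scheme \<Rightarrow> bool" where
  "AB4_star_category U A \<longleftrightarrow> abelian_category A \<and> AB3_star U A \<and> products_exact U A"


section \<open>Cohomology of cochain complexes\<close>

definition kernel :: "('o, 'm, 'z) addcat_scheme \<Rightarrow> 'm \<Rightarrow> 'm" where
  "kernel A f = (SOME k. is_kernel A f k)"

definition cokernel :: "('o, 'm, 'z) addcat_scheme \<Rightarrow> 'm \<Rightarrow> 'm" where
  "cokernel A f = (SOME q. is_cokernel A f q)"

text \<open>The factorization of \<open>f\<close> through the monomorphism \<open>k\<close>.\<close>

definition factor_through :: "('o, 'm, 'z) addcat_scheme \<Rightarrow> 'm \<Rightarrow> 'm \<Rightarrow> 'm" where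
  "factor_through A k f = (THE u. u \<in> Hom A (Dom A f) (Dom A k) \<and> k \<cdot>\<^bsub>A\<^esub> u = f)"

text \<open>A cochain complex is given by its differentials \<open>d n\<close> from degree \<open>n\<close> to degree \<open>n + 1\<close>,
  for \<open>n \<ge> 0\<close>; it is zero in negative degrees.\<close>

definition cohomology :: "('o, 'm, 'z) addcat_scheme \<Rightarrow> (nat \<Rightarrow> 'm) \<Rightarrow> nat \<Rightarrow> 'o" where
  "cohomology A d n = (case n of
       0 \<Rightarrow> Dom A (kernel A (d 0))
     | Suc m \<Rightarrow> Cod A (cokernel A (factor_through A (kernel A (d (Suc m))) (d m))))"

text \<open>The alternating sum of the \<open>f i\<close> with signs \<open>(-1) ^ i\<close>, and the difference, in \<open>Hom A x y\<close>.\<close>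

definition alternating_sum ::
    "('o, 'm, 'z) addcat_scheme \<Rightarrow> 'o \<Rightarrow> 'o \<Rightarrow> nat set \<Rightarrow> (nat \<Rightarrow> 'm) \<Rightarrow> 'm" where
  "alternating_sum A x y I f =
     finprod (hom_group A x y) (\<lambda>i. f i [^]\<^bsub>hom_group A x y\<^esub> ((-1 :: int) ^ i)) I"

definition hom_diff :: "('o, 'm, 'z) addcat_scheme \<Rightarrow> 'o \<Rightarrow> 'o \<Rightarrow> 'm \<Rightarrow> 'm \<Rightarrow> 'm" where
  "hom_diff A x y f g = f \<^bold>+\<^bsub>A\<^esub> inv\<^bsub>hom_group A x y\<^esub> g"


section \<open>Natural systems and Baues--Wirsching cohomology\<close>

text \<open>An arrow of the factorization category is written \<open>(\<alpha>, \<beta>, (u0, u1))\<close>, recording its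
  source \<open>\<alpha>\<close> and target \<open>\<beta>\<close>.\<close>

definition fact_cat ::
    "('o, 'm, 'z) precat_scheme \<Rightarrow> ('m, 'm \<times> 'm \<times> 'm \<times> 'm) precat" where
  "fact_cat C = \<lparr>Obj = Arr C,
     Arr = {(\<alpha>, \<beta>, (u0, u1)). \<alpha> \<in> Arr C \<and> \<beta> \<in> Arr C \<and>
              u0 \<in> Hom C (Dom C \<beta>) (Dom C \<alpha>) \<and> u1 \<in> Hom C (Cod C \<alpha>) (Cod C \<beta>) \<and>
              u1 \<cdot>\<^bsub>C\<^esub> \<alpha> \<cdot>\<^bsub>C\<^esub> u0 = \<beta>},
     Dom = (\<lambda>(\<alpha>, \<beta>, u). \<alpha>),
     Cod = (\<lambda>(\<alpha>, \<beta>, u). \<beta>),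
     Id = (\<lambda>\<alpha>. (\<alpha>, \<alpha>, (Id C (Dom C \<alpha>), Id C (Cod C \<alpha>)))),
     Comp = (\<lambda>(\<beta>', \<gamma>, (v0, v1)) (\<alpha>, \<beta>, (u0, u1)). (\<alpha>, \<gamma>, (u0 \<cdot>\<^bsub>C\<^esub> v0, v1 \<cdot>\<^bsub>C\<^esub> u1)))\<rparr>"

abbreviation natural_system ::
    "('o, 'm, 'y) precat_scheme \<Rightarrow> ('p, 'q, 'z) addcat_scheme
     \<Rightarrow> ('m, 'm \<times> 'm \<times> 'm \<times> 'm, 'p, 'q) ftor \<Rightarrow> bool" where
  "natural_system C A G \<equiv> cat_functor (fact_cat C) A G"

text \<open>A chain \<open>c\<^sub>0 \<rightarrow> c\<^sub>1 \<rightarrow> \<dots> \<rightarrow> c\<^sub>n\<close> is encoded as \<open>(c\<^sub>0, [\<alpha>\<^sub>1, \<dots>, \<alpha>\<^sub>n])\<close>. For \<open>n = 0\<close> it is just an object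
  (with composite the identity); for \<open>n > 0\<close> the first component is redundant.\<close>

fun is_path :: "('o, 'm, 'z) precat_scheme \<Rightarrow> 'o \<Rightarrow> 'm list \<Rightarrow> bool" where
  "is_path C c [] \<longleftrightarrow> c \<in> Obj C"
| "is_path C c (\<alpha> # \<alpha>s) \<longleftrightarrow> \<alpha> \<in> Arr C \<and> Dom C \<alpha> = c \<and> is_path C (Cod C \<alpha>) \<alpha>s"

fun path_comp :: "('o, 'm, 'z) precat_scheme \<Rightarrow> 'o \<Rightarrow> 'm list \<Rightarrow> 'm" where
  "path_comp C c [] = Id C c"
| "path_comp C c (\<alpha> # \<alpha>s) = path_comp C (Cod C \<alpha>) \<alpha>s \<cdot>\<^bsub>C\<^esub> \<alpha>"

definition chains :: "('o, 'm, 'z) precat_scheme \<Rightarrow> nat \<Rightarrow> ('o \<times> 'm list) set" where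
  "chains C n = {(c, \<alpha>s). length \<alpha>s = n \<and> is_path C c \<alpha>s}"

definition BW_ob :: "('p, 'q, 'z) addcat_scheme \<Rightarrow> ('o, 'm, 'y) precat_scheme
    \<Rightarrow> ('m, 'm \<times> 'm \<times> 'm \<times> 'm, 'p, 'q) ftor \<Rightarrow> nat \<Rightarrow> 'p" where
  "BW_ob A C G n = prod_ob A (chains C n) (\<lambda>(c, \<alpha>s). Fo G (path_comp C c \<alpha>s))"

definition BW_pr :: "('p, 'q, 'z) addcat_scheme \<Rightarrow> ('o, 'm, 'y) precat_scheme
    \<Rightarrow> ('m, 'm \<times> 'm \<times> 'm \<times> 'm, 'p, 'q) ftor \<Rightarrow> nat \<Rightarrow> 'o \<times> 'm list \<Rightarrow> 'q" where
  "BW_pr A C G n = prod_pr A (chains C n) (\<lambda>(c, \<alpha>s). Fo G (path_comp C c \<alpha>s))"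

text \<open>The \<open>i\<close>-th summand, without sign, of the component at the \<open>(n+1)\<close>-chain \<open>(c, \<alpha>s)\<close> of the
  differential from degree \<open>n\<close> to degree \<open>n + 1\<close>. Lists are indexed from \<open>0\<close>, so
  \<open>\<alpha>\<^sub>i\<close> is \<open>\<alpha>s ! (i - 1)\<close>.\<close>

definition BW_face :: "('p, 'q, 'z) addcat_scheme \<Rightarrow> ('o, 'm, 'y) precat_scheme
    \<Rightarrow> ('m, 'm \<times> 'm \<times> 'm \<times> 'm, 'p, 'q) ftor \<Rightarrow> nat \<Rightarrow> 'o \<times> 'm list \<Rightarrow> nat \<Rightarrow> 'q" where
  "BW_face A C G n = (\<lambda>(c, \<alpha>s) i.
     if i = 0 then
       Fa G (path_comp C (Cod C (hd \<alpha>s)) (tl \<alpha>s), path_comp C c \<alpha>s,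
             (hd \<alpha>s, Id C (Cod C (path_comp C c \<alpha>s))))
       \<cdot>\<^bsub>A\<^esub> BW_pr A C G n (Cod C (hd \<alpha>s), tl \<alpha>s)
     else if i = n + 1 then
       Fa G (path_comp C c (butlast \<alpha>s), path_comp C c \<alpha>s, (Id C c, last \<alpha>s))
       \<cdot>\<^bsub>A\<^esub> BW_pr A C G n (c, butlast \<alpha>s)
     else
       BW_pr A C G n (c, take (i - 1) \<alpha>s @ [\<alpha>s ! i \<cdot>\<^bsub>C\<^esub> \<alpha>s ! (i - 1)] @ drop (i + 1) \<alpha>s))"

definition BW_diff :: "('p, 'q, 'z) addcat_scheme \<Rightarrow> ('o, 'm, 'y) precat_scheme
    \<Rightarrow> ('m, 'm \<times> 'm \<times> 'm \<times> 'm, 'p, 'q) ftor \<Rightarrow> nat \<Rightarrow> 'q" where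
  "BW_diff A C G n =
     prod_lift A (chains C (n + 1)) (\<lambda>(c, \<alpha>s). Fo G (path_comp C c \<alpha>s)) (BW_ob A C G n)
       (\<lambda>(c, \<alpha>s). alternating_sum A (BW_ob A C G n) (Fo G (path_comp C c \<alpha>s)) {0..n+1}
                    (BW_face A C G n (c, \<alpha>s)))"

definition BW_cohomology :: "('p, 'q, 'z) addcat_scheme \<Rightarrow> ('o, 'm, 'y) precat_scheme
    \<Rightarrow> ('m, 'm \<times> 'm \<times> 'm \<times> 'm, 'p, 'q) ftor \<Rightarrow> nat \<Rightarrow> 'p" where
  "BW_cohomology A C G n = cohomology A (BW_diff A C G) n"


section \<open>The cube category and cubical sets\<close>

definition vertices :: "nat \<Rightarrow> bool list set" where
  "vertices n = {x. length x = n}"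

text \<open>The partially ordered set \<open>{0,1}^n\<close> (product order) as a category.\<close>

definition cube_poset :: "nat \<Rightarrow> (bool list, bool list \<times> bool list) precat" where
  "cube_poset n = \<lparr>Obj = vertices n,
     Arr = {(x, y). x \<in> vertices n \<and> y \<in> vertices n \<and> list_all2 (\<le>) x y},
     Dom = fst, Cod = snd, Id = (\<lambda>x. (x, x)),
     Comp = (\<lambda>(y', z) (x, y). (x, z))\<rparr>"

text \<open>A morphism of the cube category is a triple \<open>(m, n, \<theta>)\<close>, where \<open>\<theta>\<close> is a map from
  \<open>vertices m\<close> to \<open>vertices n\<close>, extended by \<open>undefined\<close>.\<close>

type_synonym cube_map = "nat \<times> nat \<times> (bool list \<Rightarrow> bool list)"

definition cube_face :: "nat \<Rightarrow> nat \<Rightarrow> bool \<Rightarrow> cube_map" where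
  "cube_face k i \<epsilon> = (k - 1, k, \<lambda>x \<in> vertices (k - 1). take (i - 1) x @ \<epsilon> # drop (i - 1) x)"

definition cube_degen :: "nat \<Rightarrow> nat \<Rightarrow> cube_map" where
  "cube_degen k i = (k, k - 1, \<lambda>x \<in> vertices k. take (i - 1) x @ drop i x)"

inductive_set cube_maps :: "cube_map set" where
  ident: "(n, n, \<lambda>x \<in> vertices n. x) \<in> cube_maps"
| face: "1 \<le> i \<Longrightarrow> i \<le> k \<Longrightarrow> cube_face k i \<epsilon> \<in> cube_maps"
| degen: "1 \<le> i \<Longrightarrow> i \<le> k \<Longrightarrow> cube_degen k i \<in> cube_maps"
| comp: "(l, m, \<theta>) \<in> cube_maps \<Longrightarrow> (m, n, \<eta>) \<in> cube_maps
         \<Longrightarrow> (l, n, compose (vertices l) \<eta> \<theta>) \<in> cube_maps"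

definition cube_cat :: "(nat, cube_map) precat" where
  "cube_cat = \<lparr>Obj = UNIV, Arr = cube_maps,
     Dom = (\<lambda>(m, n, \<theta>). m), Cod = (\<lambda>(m, n, \<theta>). n),
     Id = (\<lambda>n. (n, n, \<lambda>x \<in> vertices n. x)),
     Comp = (\<lambda>(m', n, \<eta>) (l, m, \<theta>). (l, n, compose (vertices l) \<eta> \<theta>))\<rparr>"

type_synonym 'x cubical = "(nat, cube_map, 'x set, 'x set \<times> 'x set \<times> ('x \<Rightarrow> 'x)) ftor"

abbreviation cubical_set :: "'x cubical \<Rightarrow> bool" where
  "cubical_set X \<equiv> cat_functor (op_cat cube_cat) set_cat X"

definition act :: "'x cubical \<Rightarrow> cube_map \<Rightarrow> 'x \<Rightarrow> 'x" where
  "act X \<alpha> = snd (snd (Fa X \<alpha>))"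


section \<open>Cohomology of a cubical set\<close>

text \<open>The category of elements \<open>\<box>/X\<close>; arrows are written \<open>((m, y), (n, x), \<theta>)\<close>, recording source
  and target.\<close>

type_synonym 'x elem_arr = "(nat \<times> 'x) \<times> (nat \<times> 'x) \<times> (bool list \<Rightarrow> bool list)"

definition elements :: "'x cubical \<Rightarrow> (nat \<times> 'x, 'x elem_arr) precat" where
  "elements X = \<lparr>Obj = {(n, x). x \<in> Fo X n},
     Arr = {((m, y), (n, x), \<theta>). y \<in> Fo X m \<and> x \<in> Fo X n \<and>
              (m, n, \<theta>) \<in> cube_maps \<and> act X (m, n, \<theta>) x = y},
     Dom = (\<lambda>(y, x, \<theta>). y), Cod = (\<lambda>(y, x, \<theta>). x),
     Id = (\<lambda>(n, x). ((n, x), (n, x), \<lambda>v \<in> vertices n. v)),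
     Comp = (\<lambda>(y', x, \<eta>) (z, y, \<theta>). (z, x, compose (vertices (fst z)) \<eta> \<theta>))\<rparr>"

text \<open>The arrow from \<open>X(\<alpha>) x\<close> to \<open>x\<close> of \<open>\<box>/X\<close> given by \<open>\<alpha>\<close>.\<close>

definition elem_arr :: "'x cubical \<Rightarrow> cube_map \<Rightarrow> 'x \<Rightarrow> 'x elem_arr" where
  "elem_arr X \<alpha> x = (case \<alpha> of (m, n, \<theta>) \<Rightarrow> ((m, act X \<alpha> x), (n, x), \<theta>))"

definition cub_ob :: "('p, 'q, 'z) addcat_scheme \<Rightarrow> 'x cubical
    \<Rightarrow> (nat \<times> 'x, 'x elem_arr, 'p, 'q) ftor \<Rightarrow> nat \<Rightarrow> 'p" where
  "cub_ob A X F n = prod_ob A (Fo X n) (\<lambda>x. Fo F (n, x))"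

definition cub_pr :: "('p, 'q, 'z) addcat_scheme \<Rightarrow> 'x cubical
    \<Rightarrow> (nat \<times> 'x, 'x elem_arr, 'p, 'q) ftor \<Rightarrow> nat \<Rightarrow> 'x \<Rightarrow> 'q" where
  "cub_pr A X F n = prod_pr A (Fo X n) (\<lambda>x. Fo F (n, x))"

definition cub_d :: "('p, 'q, 'z) addcat_scheme \<Rightarrow> 'x cubical
    \<Rightarrow> (nat \<times> 'x, 'x elem_arr, 'p, 'q) ftor \<Rightarrow> nat \<Rightarrow> nat \<Rightarrow> bool \<Rightarrow> 'q" where
  "cub_d A X F n i \<epsilon> =
     prod_lift A (Fo X n) (\<lambda>x. Fo F (n, x)) (cub_ob A X F (n - 1))
       (\<lambda>x. Fa F (elem_arr X (cube_face n i \<epsilon>) x)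
            \<cdot>\<^bsub>A\<^esub> cub_pr A X F (n - 1) (act X (cube_face n i \<epsilon>) x))"

definition cub_s :: "('p, 'q, 'z) addcat_scheme \<Rightarrow> 'x cubical
    \<Rightarrow> (nat \<times> 'x, 'x elem_arr, 'p, 'q) ftor \<Rightarrow> nat \<Rightarrow> nat \<Rightarrow> 'q" where
  "cub_s A X F n i =
     prod_lift A (Fo X (n - 1)) (\<lambda>x. Fo F (n - 1, x)) (cub_ob A X F n)
       (\<lambda>x. Fa F (elem_arr X (cube_degen n i) x)
            \<cdot>\<^bsub>A\<^esub> cub_pr A X F n (act X (cube_degen n i) x))"

text \<open>The inclusion into \<open>C\<^sup>n\<close> of the normalized cochains. For \<open>n = 0\<close> the target of the map with
  components \<open>s\<^sup>1, \<dots>, s\<^sup>n\<close> is the empty product, so that all of \<open>C\<^sup>0\<close> is normalized.\<close>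

definition cub_incl :: "('p, 'q, 'z) addcat_scheme \<Rightarrow> 'x cubical
    \<Rightarrow> (nat \<times> 'x, 'x elem_arr, 'p, 'q) ftor \<Rightarrow> nat \<Rightarrow> 'q" where
  "cub_incl A X F n =
     kernel A (prod_lift A {1..n} (\<lambda>_. cub_ob A X F (n - 1)) (cub_ob A X F n) (cub_s A X F n))"

definition cub_diff :: "('p, 'q, 'z) addcat_scheme \<Rightarrow> 'x cubical
    \<Rightarrow> (nat \<times> 'x, 'x elem_arr, 'p, 'q) ftor \<Rightarrow> nat \<Rightarrow> 'q" where
  "cub_diff A X F n =
     alternating_sum A (cub_ob A X F n) (cub_ob A X F (n + 1)) {1..n+1}
       (\<lambda>i. hom_diff A (cub_ob A X F n) (cub_ob A X F (n + 1))
              (cub_d A X F (n + 1) i False) (cub_d A X F (n + 1) i True))"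

definition cub_norm_diff :: "('p, 'q, 'z) addcat_scheme \<Rightarrow> 'x cubical
    \<Rightarrow> (nat \<times> 'x, 'x elem_arr, 'p, 'q) ftor \<Rightarrow> nat \<Rightarrow> 'q" where
  "cub_norm_diff A X F n =
     factor_through A (cub_incl A X F (n + 1)) (cub_diff A X F n \<cdot>\<^bsub>A\<^esub> cub_incl A X F n)"

definition cub_cohomology :: "('p, 'q, 'z) addcat_scheme \<Rightarrow> 'x cubical
    \<Rightarrow> (nat \<times> 'x, 'x elem_arr, 'p, 'q) ftor \<Rightarrow> nat \<Rightarrow> 'p" where
  "cub_cohomology A X F n = cohomology A (cub_norm_diff A X F) n"


section \<open>The cubical nerve and the functor to the factorization category\<close>

type_synonym ('o, 'm) cube_ftor = "(bool list, bool list \<times> bool list, 'o, 'm) ftor"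

text \<open>A monotone map between cubes as a functor.\<close>

definition cube_ftor_of :: "(bool list \<Rightarrow> bool list)
    \<Rightarrow> (bool list, bool list \<times> bool list, bool list, bool list \<times> bool list) ftor" where
  "cube_ftor_of \<theta> = \<lparr>Fo = \<theta>, Fa = map_prod \<theta> \<theta>\<rparr>"

definition cubical_nerve :: "('o, 'm, 'z) precat_scheme \<Rightarrow> ('o, 'm) cube_ftor cubical" where
  "cubical_nerve C = \<lparr>
     Fo = (\<lambda>n. functors (cube_poset n) C),
     Fa = (\<lambda>(m, n, \<theta>). (functors (cube_poset n) C, functors (cube_poset m) C,
              \<lambda>g \<in> functors (cube_poset n) C. ftor_comp (cube_poset m) g (cube_ftor_of \<theta>)))\<rparr>"

definition bot_vertex :: "nat \<Rightarrow> bool list" where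
  "bot_vertex n = replicate n False"

definition top_vertex :: "nat \<Rightarrow> bool list" where
  "top_vertex n = replicate n True"

definition diag :: "nat \<Rightarrow> ('o, 'm) cube_ftor \<Rightarrow> 'm" where
  "diag n g = Fa g (bot_vertex n, top_vertex n)"

definition diag_ftor ::
    "(nat \<times> ('o, 'm) cube_ftor, ('o, 'm) cube_ftor elem_arr, 'm, 'm \<times> 'm \<times> 'm \<times> 'm) ftor" where
  "diag_ftor = \<lparr>
     Fo = (\<lambda>(n, g). diag n g),
     Fa = (\<lambda>((m, f), (n, g), \<theta>). (diag m f, diag n g,
            (Fa g (bot_vertex n, \<theta> (bot_vertex m)), Fa g (\<theta> (top_vertex m), top_vertex n))))\<rparr>"


section \<open>The constructions are well-defined\<close>

lemma HomI:
  "f \<in> Arr C \<Longrightarrow> Dom C f = x \<Longrightarrow> Cod C f = y \<Longrightarrow> f \<in> Hom C x y"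
  by (simp add: Hom_def)

lemma category_fact_cat:
  assumes "category C"
  shows "category (fact_cat C)"
proof -
  interpret category C by fact
  have CI: "f \<in> Hom C x y \<Longrightarrow> g \<in> Hom C y z \<Longrightarrow> g \<cdot>\<^bsub>C\<^esub> f \<in> Arr C \<and> Dom C (g \<cdot>\<^bsub>C\<^esub> f) = x \<and> Cod C (g \<cdot>\<^bsub>C\<^esub> f) = z" for f g x y z
    using Comp_in by (auto simp: Hom_def)
  have assoc: "h \<cdot>\<^bsub>C\<^esub> (g \<cdot>\<^bsub>C\<^esub> f) = h \<cdot>\<^bsub>C\<^esub> g \<cdot>\<^bsub>C\<^esub> f"
    if "f \<in> Arr C" "g \<in> Arr C" "h \<in> Arr C" "Dom C g = Cod C f" "Dom C h = Cod C g" for f g h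
    using that by (intro Comp_assoc HomI) auto
  have key: "(v1 \<cdot>\<^bsub>C\<^esub> u1) \<cdot>\<^bsub>C\<^esub> \<alpha> \<cdot>\<^bsub>C\<^esub> (u0 \<cdot>\<^bsub>C\<^esub> v0) = v1 \<cdot>\<^bsub>C\<^esub> (u1 \<cdot>\<^bsub>C\<^esub> \<alpha> \<cdot>\<^bsub>C\<^esub> u0) \<cdot>\<^bsub>C\<^esub> v0"
    if "\<alpha> \<in> Hom C a b" "u0 \<in> Hom C c a" "u1 \<in> Hom C b d" "v0 \<in> Hom C e c" "v1 \<in> Hom C d f" for \<alpha> u0 u1 v0 v1 a b c d e f
  proof -
    note * = Comp_in[OF that(1,3)] Comp_in[OF that(3,5)]
    show ?thesis
      by (simp only: Comp_assoc[OF that(4,2) Comp_in[OF that(1) *(2)]]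
          Comp_assoc[OF that(1,3,5)] Comp_assoc[OF that(2) *(1) that(5)])
  qed
  show ?thesis
  proof
    show "x \<in> Obj (fact_cat C) \<Longrightarrow> Id (fact_cat C) x \<in> Hom (fact_cat C) x x" for x
      using Id_in[OF Dom_in, of x] Id_in[OF Cod_in, of x] Comp_Id[of x] Id_Comp[of x]
      by (auto simp: fact_cat_def Hom_def)
    show "f \<in> Hom (fact_cat C) x y \<Longrightarrow> g \<in> Hom (fact_cat C) y z \<Longrightarrow> g \<cdot>\<^bsub>fact_cat C\<^esub> f \<in> Hom (fact_cat C) x z" for f g x y z
      apply (clarsimp simp: fact_cat_def Hom_def)
      subgoal for u0 u1 v0 v1
        using key[of x "Dom C x" "Cod C x" u0 _ u1 _ v0 _ v1]
         CI[of v0 _ _ u0] CI[of u1 _ _ v1] by (auto simp: Hom_def)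
      done
    show "f \<in> Hom (fact_cat C) x y \<Longrightarrow> f \<cdot>\<^bsub>fact_cat C\<^esub> Id (fact_cat C) x = f" for f x y
      by (auto simp: fact_cat_def Hom_def intro!: Id_Comp Comp_Id)
    show "f \<in> Hom (fact_cat C) x y \<Longrightarrow> Id (fact_cat C) y \<cdot>\<^bsub>fact_cat C\<^esub> f = f" for f x y
      by (auto simp: fact_cat_def Hom_def intro!: Id_Comp Comp_Id)
    show "f \<in> Hom (fact_cat C) w x \<Longrightarrow> g \<in> Hom (fact_cat C) x y \<Longrightarrow> h \<in> Hom (fact_cat C) y z
                     \<Longrightarrow> h \<cdot>\<^bsub>fact_cat C\<^esub> (g \<cdot>\<^bsub>fact_cat C\<^esub> f) = (h \<cdot>\<^bsub>fact_cat C\<^esub> g) \<cdot>\<^bsub>fact_cat C\<^esub> f" for f g h w x y z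
      by (auto simp: fact_cat_def Hom_def assoc)
  qed (auto simp: fact_cat_def)
qed

lemma cube_maps_monotone:
  "\<alpha> \<in> cube_maps \<Longrightarrow> case \<alpha> of (m,n,\<theta>) \<Rightarrow> \<theta> \<in> vertices m \<rightarrow>\<^sub>E vertices n \<and>
      (\<forall>x\<in>vertices m. \<forall>y\<in>vertices m. list_all2 (\<le>) x y \<longrightarrow> list_all2 (\<le>) (\<theta> x) (\<theta> y))"
proof (induction rule: cube_maps.induct)
  case (comp l m \<theta> n \<eta>)
  then show ?case by (auto simp: PiE_iff compose_def)
next
  case (face i k \<epsilon>)
  then show ?case by (auto simp: cube_face_def vertices_def PiE_iff
     intro!: list_all2_appendI list_all2_takeI list_all2_dropI)
next
  case (degen i k)
  then show ?case by (auto simp: cube_degen_def vertices_def PiE_iff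
     intro!: list_all2_appendI list_all2_takeI list_all2_dropI)
qed auto

lemma category_cube_poset: "category (cube_poset n)"
  by unfold_locales (auto simp: cube_poset_def Hom_def list_all2_conv_all_nth)

lemma cube_maps_E: "(m,n,\<theta>) \<in> cube_maps \<Longrightarrow> \<theta> \<in> vertices m \<rightarrow>\<^sub>E vertices n"
  using cube_maps_monotone[of "(m,n,\<theta>)"] by auto

lemma category_cube_cat: "category cube_cat"
proof
  fix w x y z f g h assume "f \<in> Hom cube_cat w x" "g \<in> Hom cube_cat x y" "h \<in> Hom cube_cat y z"
  then show "h \<cdot>\<^bsub>cube_cat\<^esub> (g \<cdot>\<^bsub>cube_cat\<^esub> f) = h \<cdot>\<^bsub>cube_cat\<^esub> g \<cdot>\<^bsub>cube_cat\<^esub> f"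
   by (cases f; cases g; cases h) (auto simp: cube_cat_def Hom_def compose_def fun_eq_iff PiE_iff dest!: cube_maps_E)
next
  fix x y z f g assume "f \<in> Hom cube_cat x y" "g \<in> Hom cube_cat y z"
  then show "g \<cdot>\<^bsub>cube_cat\<^esub> f \<in> Hom cube_cat x z"
    by (cases f; cases g) (auto simp: cube_cat_def Hom_def intro: cube_maps.comp)
qed (auto simp: cube_cat_def Hom_def cube_maps.ident
   dest!: cube_maps_E simp: PiE_iff compose_def fun_eq_iff extensional_def)

lemma category_op_cat: "category C \<Longrightarrow> category (op_cat C)"
  by (simp add: category_def op_cat_def Hom_def)

lemma category_set_cat: "category set_cat"
proof
  fix w x y z :: "'x set" and f g h :: "'x set \<times> 'x set \<times> ('x \<Rightarrow> 'x)"
  show "Id set_cat x \<in> Hom set_cat x x"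
    by (auto simp: set_cat_def Hom_def)
  { assume "f \<in> Hom set_cat x y" "g \<in> Hom set_cat y z"
    then show "g \<cdot>\<^bsub>set_cat\<^esub> f \<in> Hom set_cat x z"
      by (auto simp: set_cat_def Hom_def compose_def) }
  { assume "f \<in> Hom set_cat w x" "g \<in> Hom set_cat x y" "h \<in> Hom set_cat y z"
    then show "h \<cdot>\<^bsub>set_cat\<^esub> (g \<cdot>\<^bsub>set_cat\<^esub> f) = h \<cdot>\<^bsub>set_cat\<^esub> g \<cdot>\<^bsub>set_cat\<^esub> f"
      by (auto simp: set_cat_def Hom_def compose_def fun_eq_iff) }
  { assume "f \<in> Hom set_cat x y"
    then show "f \<cdot>\<^bsub>set_cat\<^esub> Id set_cat x = f" "Id set_cat y \<cdot>\<^bsub>set_cat\<^esub> f = f"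
      by (auto simp: set_cat_def Hom_def Id_compose compose_Id PiE_def) }
qed (auto simp: set_cat_def)

lemma cat_functor_cube_ftor_of:
  assumes "(m,n,\<theta>) \<in> cube_maps"
  shows "cat_functor (cube_poset m) (cube_poset n) (cube_ftor_of \<theta>)"
  using cube_maps_monotone[OF assms]
  apply (intro cat_functor.intro cat_functor_axioms.intro category_cube_poset)
  by (auto simp: cube_poset_def Hom_def cube_ftor_of_def PiE_iff)

lemma cat_functor_ftor_comp:
  assumes "cat_functor C D F" "cat_functor D E G" shows "cat_functor C E (ftor_comp C G F)"
proof -
  interpret F: cat_functor C D F by fact
  interpret G: cat_functor D E G by fact
  have "Fa F f \<in> Hom D (Fo F (Dom C f)) (Fo F (Cod C f))" if "f \<in> Arr C" for f
    using F.Fa_in that by (auto simp: Hom_def)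
  show ?thesis
  proof
    show "x \<in> Obj C \<Longrightarrow> Fo (ftor_comp C G F) x \<in> Obj E" for x by (simp add: ftor_comp_def compose_def F.Fo_in G.Fo_in)
    show "f \<in> Hom C x y \<Longrightarrow> Fa (ftor_comp C G F) f \<in> Hom E (Fo (ftor_comp C G F) x) (Fo (ftor_comp C G F) y)" for f x y
      using G.Fa_in[OF F.Fa_in, of f x y] F.C.Dom_in[of f] F.C.Cod_in[of f] by (auto simp: ftor_comp_def compose_def Hom_def)
    show "x \<in> Obj C \<Longrightarrow> Fa (ftor_comp C G F) (Id C x) = Id E (Fo (ftor_comp C G F) x)" for x
      using F.C.Id_in[of x] by (simp add: ftor_comp_def compose_def F.Fo_in G.Fo_in F.Fa_Id G.Fa_Id Hom_def)
    show "f \<in> Hom C x y \<Longrightarrow> g \<in> Hom C y z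
                  \<Longrightarrow> Fa (ftor_comp C G F) (g \<cdot>\<^bsub>C\<^esub> f) = Fa (ftor_comp C G F) g \<cdot>\<^bsub>E\<^esub> Fa (ftor_comp C G F) f" for f g x y z
      using F.C.Comp_in[of f x y g z] F.Fa_Comp[of f x y g z] G.Fa_Comp[OF F.Fa_in F.Fa_in, of f x y g z]
      by (simp add: ftor_comp_def compose_def Hom_def)
  qed
qed

lemma ftor_comp_functors:
  assumes "cat_functor C D F" "G \<in> functors D E" shows "ftor_comp C G F \<in> functors C E"
  using assms cat_functor_ftor_comp by (auto simp: functors_def) (auto simp: ftor_comp_def compose_def)

lemma ftor_comp_assoc: "cat_functor C D F \<Longrightarrow> ftor_comp C H (ftor_comp C G F) = ftor_comp C (ftor_comp D H G) F"
proof -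
  assume "cat_functor C D F"
  then interpret F: cat_functor C D F .
  have "Fa F f \<in> Arr D" if "f \<in> Arr C" for f
    using F.Fa_in that by (auto simp: Hom_def)
  then show ?thesis by (auto simp: ftor_comp_def compose_def fun_eq_iff F.Fo_in)
qed

lemma nerve_id: "g \<in> functors (cube_poset n) C \<Longrightarrow> ftor_comp (cube_poset n) g (cube_ftor_of (\<lambda>x\<in>vertices n. x)) = g"
  by (cases g) (auto simp: ftor_comp_def functors_def cube_ftor_of_def compose_def fun_eq_iff extensional_def cube_poset_def)

lemma nerve_comp: assumes "(l,m,\<theta>) \<in> cube_maps" "(m,n,\<eta>) \<in> cube_maps"
  shows "ftor_comp (cube_poset l) g (cube_ftor_of (compose (vertices l) \<eta> \<theta>)) =
     ftor_comp (cube_poset l) (ftor_comp (cube_poset m) g (cube_ftor_of \<eta>)) (cube_ftor_of \<theta>)"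
  unfolding ftor_comp_assoc[OF cat_functor_cube_ftor_of[OF assms(1)], symmetric]
  using cube_maps_E[OF assms(1)] cube_maps_E[OF assms(2)]
  by (auto simp: ftor_comp_def compose_def fun_eq_iff cube_ftor_of_def cube_poset_def)

lemma cubical_set_cubical_nerve: assumes "category C" shows "cubical_set (cubical_nerve C)"
proof (rule cat_functor.intro[OF category_op_cat[OF category_cube_cat] category_set_cat], rule cat_functor_axioms.intro)
  note [simp] = op_cat_def cube_cat_def set_cat_def Hom_def cubical_nerve_def
  show "x \<in> Obj (op_cat cube_cat) \<Longrightarrow> Fa (cubical_nerve C) (Id (op_cat cube_cat) x) = Id set_cat (Fo (cubical_nerve C) x)" for x
    using nerve_id by (auto simp: fun_eq_iff)
  show "f \<in> Hom (op_cat cube_cat) x y \<Longrightarrow> Fa (cubical_nerve C) f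
           \<in> Hom set_cat (Fo (cubical_nerve C) x) (Fo (cubical_nerve C) y)" for f x y
    by (cases f) (auto intro: ftor_comp_functors cat_functor_cube_ftor_of)
  show "f \<in> Hom (op_cat cube_cat) x y \<Longrightarrow>
       g \<in> Hom (op_cat cube_cat) y z \<Longrightarrow>
       Fa (cubical_nerve C) (g \<cdot>\<^bsub>op_cat cube_cat\<^esub> f) =
       Fa (cubical_nerve C) g \<cdot>\<^bsub>set_cat\<^esub> Fa (cubical_nerve C) f" for f g x y z
    by (cases f; cases g) (auto simp: fun_eq_iff compose_def[of "functors _ _"] nerve_comp intro: ftor_comp_functors cat_functor_cube_ftor_of)
qed (simp add: set_cat_def)

lemma act_id: "cubical_set X \<Longrightarrow> x \<in> Fo X n \<Longrightarrow> act X (n,n,\<lambda>v\<in>vertices n. v) x = x"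
  using cat_functor.Fa_Id[of "op_cat cube_cat" set_cat X n] by (simp add: op_cat_def cube_cat_def act_def set_cat_def)

lemma act_comp: "cubical_set X \<Longrightarrow> x \<in> Fo X n \<Longrightarrow> (l,m,\<theta>) \<in> cube_maps \<Longrightarrow> (m,n,\<eta>) \<in> cube_maps \<Longrightarrow>
   act X (l,n,compose (vertices l) \<eta> \<theta>) x = act X (l,m,\<theta>) (act X (m,n,\<eta>) x)"
  using cat_functor.Fa_Comp[of "op_cat cube_cat" set_cat X "(m,n,\<eta>)" n m "(l,m,\<theta>)" l]
    cat_functor.Fa_in[of "op_cat cube_cat" set_cat X "(m,n,\<eta>)" n m]
  by (auto simp: op_cat_def cube_cat_def act_def set_cat_def Hom_def compose_def split_beta)

lemma category_elements: assumes "cubical_set X" shows "category (elements X)"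
proof
  note [simp] = elements_def Hom_def
  fix w x y z f g h
  { assume "x \<in> Obj (elements X)" then show "Id (elements X) x \<in> Hom (elements X) x x"
      by (auto simp: act_id assms intro: cube_maps.ident) }
  { assume "f \<in> Hom (elements X) x y" "g \<in> Hom (elements X) y z" then show "g \<cdot>\<^bsub>elements X\<^esub> f \<in> Hom (elements X) x z"
      by (auto simp: act_comp[OF assms] intro: cube_maps.comp) }
  { assume "f \<in> Hom (elements X) w x" "g \<in> Hom (elements X) x y" "h \<in> Hom (elements X) y z"
    then show "h \<cdot>\<^bsub>elements X\<^esub> (g \<cdot>\<^bsub>elements X\<^esub> f) = h \<cdot>\<^bsub>elements X\<^esub> g \<cdot>\<^bsub>elements X\<^esub> f"
     by (auto dest!: cube_maps_E simp: PiE_iff compose_def fun_eq_iff extensional_def) }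
qed (auto simp: elements_def Hom_def dest!: cube_maps_E simp: PiE_iff compose_def fun_eq_iff extensional_def)

lemma bot_vertex_le: "x \<in> vertices n \<Longrightarrow> (bot_vertex n, x) \<in> Arr (cube_poset n)"
  by (auto simp: cube_poset_def vertices_def bot_vertex_def list_all2_conv_all_nth)

lemma le_top_vertex: "x \<in> vertices n \<Longrightarrow> (x, top_vertex n) \<in> Arr (cube_poset n)"
  by (auto simp: cube_poset_def vertices_def top_vertex_def list_all2_conv_all_nth)

lemma bot_top_vertices [simp]: "bot_vertex n \<in> vertices n" "top_vertex n \<in> vertices n"
  by (auto simp: vertices_def bot_vertex_def top_vertex_def)

lemma cube_functor_in: "g \<in> functors (cube_poset n) C \<Longrightarrow> (x,y) \<in> Arr (cube_poset n) \<Longrightarrow> Fa g (x,y) \<in> Hom C (Fo g x) (Fo g y)"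
  using cat_functor.Fa_in[of "cube_poset n" C g "(x,y)" x y] by (auto simp: functors_def cube_poset_def Hom_def)

lemma cube_functor_comp: "g \<in> functors (cube_poset n) C \<Longrightarrow> (x,y) \<in> Arr (cube_poset n) \<Longrightarrow> (y,z) \<in> Arr (cube_poset n) \<Longrightarrow>
  Fa g (y,z) \<cdot>\<^bsub>C\<^esub> Fa g (x,y) = Fa g (x,z)"
  using cat_functor.Fa_Comp[of "cube_poset n" C g "(x,y)" x y "(y,z)" z] by (auto simp: functors_def cube_poset_def Hom_def)

lemma cube_functor_id: "g \<in> functors (cube_poset n) C \<Longrightarrow> x \<in> vertices n \<Longrightarrow>
  Fa g (x,x) = Id C (Fo g x)"
  using cat_functor.Fa_Id[of "cube_poset n" C g x] by (auto simp: functors_def cube_poset_def Hom_def)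

lemma cube_maps_mono: "(m,n,\<theta>) \<in> cube_maps \<Longrightarrow> (x,y) \<in> Arr (cube_poset m) \<Longrightarrow> (\<theta> x, \<theta> y) \<in> Arr (cube_poset n)"
  using cube_maps_monotone[of "(m,n,\<theta>)"] by (auto simp: cube_poset_def)

lemma cat_functor_diag: assumes "category C"
  shows "cat_functor (elements (cubical_nerve C)) (fact_cat C) diag_ftor"
proof (rule cat_functor.intro[OF category_elements[OF cubical_set_cubical_nerve[OF assms]] category_fact_cat[OF assms]], rule cat_functor_axioms.intro)
  interpret category C by fact
  fix x y z f g
  { assume "x \<in> Obj (elements (cubical_nerve C))"
    then show "Fo diag_ftor x \<in> Obj (fact_cat C)"
      using cube_functor_in[OF _ bot_vertex_le, of _ _ C "top_vertex (fst x)"] by (auto simp: elements_def fact_cat_def diag_ftor_def diag_def cubical_nerve_def Hom_def) }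
  { assume "x \<in> Obj (elements (cubical_nerve C))"
    then obtain n h where x: "x = (n,h)" "h \<in> functors (cube_poset n) C" by (auto simp: elements_def cubical_nerve_def)
    then show "Fa diag_ftor (Id (elements (cubical_nerve C)) x) =
         Id (fact_cat C) (Fo diag_ftor x)"
      using cube_functor_in[OF x(2) bot_vertex_le, of "top_vertex n"]
      by (auto simp: elements_def fact_cat_def diag_ftor_def diag_def cube_functor_id Hom_def) }
  { assume "f \<in> Hom (elements (cubical_nerve C)) x y"
    then obtain m n h k \<theta> where f: "f = ((m,h),(n,k),\<theta>)" "x = (m,h)" "y = (n,k)" "h \<in> functors (cube_poset m) C" "k \<in> functors (cube_poset n) C"
       "(m,n,\<theta>) \<in> cube_maps" "h = ftor_comp (cube_poset m) k (cube_ftor_of \<theta>)"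
      by (auto simp: elements_def cubical_nerve_def Hom_def act_def)
    note \<theta> = PiE_mem[OF cube_maps_E[OF f(6)]]
    have h: "Fa h (u,v) = Fa k (\<theta> u, \<theta> v)" if "(u,v) \<in> Arr (cube_poset m)" for u v using that
      by (auto simp: f(7) ftor_comp_def compose_def cube_ftor_of_def)
    have le: "(\<theta> (bot_vertex m), \<theta> (top_vertex m)) \<in> Arr (cube_poset n)"
       "(bot_vertex n, \<theta> (top_vertex m)) \<in> Arr (cube_poset n)"
      using cube_maps_mono[OF f(6) bot_vertex_le[of "top_vertex m"]] bot_vertex_le[OF \<theta>] by auto
    show "Fa diag_ftor f \<in> Hom (fact_cat C) (Fo diag_ftor x) (Fo diag_ftor y)"
      unfolding f(1-3)
      using cube_functor_in[OF f(5) le(1)] cube_functor_in[OF f(5) le(2)] cube_functor_in[OF f(5) bot_vertex_le[OF \<theta>[of "bot_vertex m"]]] cube_functor_in[OF f(5) le_top_vertex[OF \<theta>[of "top_vertex m"]]]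
        cube_functor_in[OF f(5) bot_vertex_le[OF bot_top_vertices(2)]]
      apply (simp add: diag_ftor_def diag_def h bot_vertex_le fact_cat_def Hom_def)
      using cube_functor_comp[OF f(5) le(1) le_top_vertex[OF \<theta>[of "top_vertex m"]]] cube_functor_comp[OF f(5) bot_vertex_le[OF \<theta>[of "bot_vertex m"]] le_top_vertex[OF \<theta>[of "bot_vertex m"]]]
      by simp
    assume "g \<in> Hom (elements (cubical_nerve C)) y z"
    then obtain p l \<eta> where g: "g = ((n,k),(p,l),\<eta>)" "z = (p,l)" "l \<in> functors (cube_poset p) C"
       "(n,p,\<eta>) \<in> cube_maps" "k = ftor_comp (cube_poset n) l (cube_ftor_of \<eta>)"
      by (auto simp: elements_def cubical_nerve_def Hom_def act_def f)
    note \<eta> = PiE_mem[OF cube_maps_E[OF g(4)]]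
    have k: "Fa k (u,v) = Fa l (\<eta> u, \<eta> v)" if "(u,v) \<in> Arr (cube_poset n)" for u v using that
      by (auto simp: g(5) ftor_comp_def compose_def cube_ftor_of_def)
    show "Fa diag_ftor (g \<cdot>\<^bsub>elements (cubical_nerve C)\<^esub> f) =
       Fa diag_ftor g \<cdot>\<^bsub>fact_cat C\<^esub> Fa diag_ftor f"
      using cube_functor_comp[OF g(3) bot_vertex_le[OF \<eta>] cube_maps_mono[OF g(4) bot_vertex_le], OF bot_top_vertices(1) \<theta>[OF bot_top_vertices(1)]]
            cube_functor_comp[OF g(3) cube_maps_mono[OF g(4) le_top_vertex] le_top_vertex[OF \<eta>], OF \<theta>[OF bot_top_vertices(2)] bot_top_vertices(2)] \<theta>
      by (simp add: f(1) g(1) elements_def diag_ftor_def diag_def fact_cat_def compose_def k bot_vertex_le le_top_vertex) }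
qed

end

theory Submission
  imports Defs "HOL-Algebra.Free_Abelian_Groups"
begin

text \<open>
  The two complexes are homotopy equivalent, by acyclic models. A cochain can be evaluated on every
  simplex or cube of a poset with a functor to \<open>C\<close>, with all values moved into the coefficient group
  of an interval \<open>[p, q]\<close> containing the simplex or cube. So every natural identity between formal
  integral combinations of simplices and cubes in posets becomes an identity between cochains with
  values in the natural system. On the side of formal chains, \<open>q : {0,1}^n \<rightarrow> [n]\<close>, \<open>q x\<close> the number of
  leading ones of \<open>x\<close>, sends simplices to cubes; the reverse chain map and both homotopies are
  obtained recursively from cones on the least vertex, and are compatible with degeneracies because
  these preserve least vertices.

  The passage to the abelian category is by generalized elements: a chain map that is a
  quasi-isomorphism on \<open>Hom W\<close> for every object \<open>W\<close> is an isomorphism in cohomology.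
\<close>

section \<open>Formal simplices and cubes\<close>

text \<open>The two sides behave unequally, and this shapes the proof. A cone of simplices contracts
  the augmented complex exactly, but the cone of a cube has the constant cube at its apex as a
  further face, so the identities that involve chains of cubes hold only modulo degenerate cubes.
  Hence cubical cochains have to be normalized, while the Baues-Wirsching complex is not. Cones have
  to produce ordered simplices and monotone cubes; they are taken on the least vertex, and every
  recursion may raise the lower end of its interval to that vertex. One coefficient group suffices
  because \<open>p \<le> lo \<le> hi \<le> q\<close> in a diagram is a factorization of the arrow
  from \<open>p\<close> to \<open>q\<close> through the one from \<open>lo\<close> to
  \<open>hi\<close>, that is, an arrow of the factorization category. The comparison map is the
  pullback along q, from normalized cubical cochains to cochains on chains. The map in the other
  direction and the homotopies are applied only to families of morphisms out of a test object
  \<open>W\<close>, so that no morphisms between the complexes are built from them.\<close>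

abbreviation (input) supp :: "('a \<Rightarrow>\<^sub>0 int) \<Rightarrow> 'a set" where
  "supp \<equiv> Poly_Mapping.keys"

section \<open>Linear extension on free abelian groups\<close>

lemma frag_extend_extend:
  "frag_extend f (frag_extend g c) = frag_extend (\<lambda>x. frag_extend f (g x)) c"
  using subset_UNIV by (induction c rule: frag_induction) (auto simp: frag_extend_diff)

lemma frag_extend_fun_diff:
  "frag_extend (\<lambda>x. f x - g x) c = frag_extend f c - frag_extend g c"
  using subset_UNIV by (induction c rule: frag_induction) (auto simp: frag_extend_diff)

lemma frag_extend_fun_cmul: "frag_extend (\<lambda>x. frag_cmul a (f x)) c = frag_cmul a (frag_extend f c)"
  by (simp add: frag_extend_def frag_cmul_sum mult.commute)

lemma frag_extend_fun_sum:
  "frag_extend (\<lambda>x. \<Sum>i\<in>I. f i x) c = (\<Sum>i\<in>I. frag_extend (f i) c)"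
  by (simp add: frag_extend_def frag_cmul_sum sum.swap[of _ I])

lemma frag_extend_id: "frag_extend (\<lambda>x. frag_of x) c = c"
  by (rule frag_expansion[symmetric])

lemma keys_frag_extend_in:
  "(\<And>x. x \<in> supp c \<Longrightarrow> supp (f x) \<subseteq> S) \<Longrightarrow> supp (frag_extend f c) \<subseteq> S"
  using keys_frag_extend[of f c] by blast

lemma keys_diff_in:
  "supp c \<subseteq> S \<Longrightarrow> supp d \<subseteq> S \<Longrightarrow> supp (c - d) \<subseteq> S"
  using keys_diff[of c d] by blast

section \<open>Simplices: cones and the augmented boundary\<close>

definition cone_simplex :: "'v \<Rightarrow> ('v list \<Rightarrow>\<^sub>0 int) \<Rightarrow> ('v list \<Rightarrow>\<^sub>0 int)" where
  "cone_simplex p c = frag_extend (\<lambda>v. frag_of (p # v)) c"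

text \<open>The boundary of the augmented complex: the boundary of a vertex is the empty simplex.\<close>

fun simplex_boundary :: "'v list \<Rightarrow> ('v list \<Rightarrow>\<^sub>0 int)" where
  "simplex_boundary [] = 0"
| "simplex_boundary (p # v) = frag_of v - cone_simplex p (simplex_boundary v)"

lemma cone_simplex_linear [simp]:
  "cone_simplex p (c - d) = cone_simplex p c - cone_simplex p d"
  "cone_simplex p 0 = 0"
  "cone_simplex p (frag_of v) = frag_of (p # v)"
  by (simp_all add: cone_simplex_def frag_extend_diff)

text \<open>Prepending \<open>p\<close> contracts the augmented complex: since the empty simplex
  counts as a chain, there is no exceptional low degree, and every cycle bounds its cone.\<close>

lemma boundary_cone_simplex:
  "frag_extend simplex_boundary (cone_simplex p c) = c - cone_simplex p (frag_extend simplex_boundary c)"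
  using subset_UNIV by (induction c rule: frag_induction) (auto simp: frag_extend_diff)

lemma simplex_boundary_boundary: "frag_extend simplex_boundary (simplex_boundary v) = 0"
  by (induction v) (auto simp: frag_extend_diff boundary_cone_simplex)

lemma keys_cone_simplex:
  "supp (cone_simplex p c) \<subseteq> (\<lambda>v. p # v) ` supp c"
  unfolding cone_simplex_def by (rule keys_frag_extend_in) auto

text \<open>The faces of a list are subsequences of it, so they inherit any order condition;
  \<open>R\<close> is later taken to be \<le>.\<close>

lemma keys_simplex_boundary:
  "u \<in> supp (simplex_boundary v)
    \<Longrightarrow> Suc (length u) = length v \<and> set u \<subseteq> set v \<and> (sorted_wrt R v \<longrightarrow> sorted_wrt R u)"
proof (induction v arbitrary: u)
  case (Cons p v)
  then have "u = v \<or> (\<exists>w \<in> supp (simplex_boundary v). u = p # w)"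
    using keys_diff[of "frag_of v"] keys_cone_simplex[of p "simplex_boundary v"] by fastforce
  then show ?case using Cons.IH by fastforce
qed simp

definition map_simplices :: "('v \<Rightarrow> 'w) \<Rightarrow> ('v list \<Rightarrow>\<^sub>0 int) \<Rightarrow> ('w list \<Rightarrow>\<^sub>0 int)" where
  "map_simplices f c = frag_extend (\<lambda>v. frag_of (map f v)) c"

lemma map_simplices_linear [simp]:
  "map_simplices f (c - d) = map_simplices f c - map_simplices f d"
  "map_simplices f (frag_of v) = frag_of (map f v)"
  "map_simplices f 0 = 0"
  by (simp_all add: map_simplices_def frag_extend_diff)

lemma map_cone_simplex: "map_simplices f (cone_simplex p c) = cone_simplex (f p) (map_simplices f c)"
  by (simp add: map_simplices_def cone_simplex_def frag_extend_extend)

lemma map_simplex_boundary: "map_simplices f (simplex_boundary v) = simplex_boundary (map f v)"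
  by (induction v) (auto simp: map_cone_simplex)

text \<open>An \<open>m\<close>-cube is a function of infinitely many coordinates that depends on the first \<open>m\<close> only,
  so that faces and degeneracies are compositions of total functions.\<close>

type_synonym 'v cube = "(nat \<Rightarrow> bool) \<Rightarrow> 'v"

abbreviation (input) origin :: "nat \<Rightarrow> bool" where
  "origin \<equiv> \<lambda>_. False"

section \<open>Cubes: faces, boundary and the cone on a vertex\<close>

definition truncate :: "nat \<Rightarrow> (nat \<Rightarrow> bool) \<Rightarrow> (nat \<Rightarrow> bool)" where
  "truncate m x = (\<lambda>j. j < m \<and> x j)"

definition insert_coord :: "nat \<Rightarrow> bool \<Rightarrow> (nat \<Rightarrow> bool) \<Rightarrow> (nat \<Rightarrow> bool)" where
  "insert_coord i e x = (\<lambda>j. if j < i then x j else if j = i then e else x (j - 1))"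

definition face :: "nat \<Rightarrow> bool \<Rightarrow> 'v cube \<Rightarrow> 'v cube" where
  "face i e \<theta> = \<theta> \<circ> insert_coord i e"

definition indep :: "nat \<Rightarrow> 'v cube \<Rightarrow> bool" where
  "indep i \<theta> \<longleftrightarrow> (\<forall>x b. \<theta> (x(i := b)) = \<theta> x)"

definition degenerate :: "nat \<Rightarrow> 'v cube \<Rightarrow> bool" where
  "degenerate m \<theta> \<longleftrightarrow> (\<exists>i<m. indep i \<theta>)"

text \<open>The cylinder over \<open>\<theta>\<close> with one end collapsed to the point
  \<open>p\<close>. The new coordinate comes first, and \<open>p\<close> becomes the value at the
  origin.\<close>

definition cone_cube :: "'v \<Rightarrow> 'v cube \<Rightarrow> 'v cube" where
  "cone_cube p \<theta> = (\<lambda>x. if x 0 then \<theta> (\<lambda>j. x (Suc j)) else p)"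

definition face_diff :: "nat \<Rightarrow> 'v cube \<Rightarrow> ('v cube \<Rightarrow>\<^sub>0 int)" where
  "face_diff i \<theta> = frag_of (face i False \<theta>) - frag_of (face i True \<theta>)"

text \<open>Directions are counted from 0, so direction \<open>i\<close> has the sign that the usual
  formula, counting from 1, gives to \<open>i + 1\<close>.\<close>

definition cube_boundary :: "nat \<Rightarrow> 'v cube \<Rightarrow> ('v cube \<Rightarrow>\<^sub>0 int)" where
  "cube_boundary m \<theta> = (\<Sum>i<m. frag_cmul ((-1) ^ Suc i) (face_diff i \<theta>))"

lemma cube_boundary_0 [simp]: "cube_boundary 0 \<theta> = 0"
  by (simp add: cube_boundary_def)

lemma frag_extend_cube_boundary:
  "frag_extend f (cube_boundary m \<theta>) = (\<Sum>i<m. frag_cmul ((-1) ^ Suc i) (frag_extend f (face_diff i \<theta>)))"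
  by (simp only: cube_boundary_def frag_extend_sum[OF finite_lessThan] o_def frag_extend_cmul)

lemma face_face:
  "i \<le> j \<Longrightarrow> face i e (face (Suc j) e' \<theta>) = face j e' (face i e \<theta>)"
  unfolding face_def comp_assoc
  by (rule arg_cong[of _ _ "\<lambda>f. \<theta> \<circ> f"]) (auto simp: insert_coord_def fun_eq_iff)

lemma face_diff_face_diff:
  "i \<le> j \<Longrightarrow> frag_extend (face_diff i) (face_diff (Suc j) \<theta>) = frag_extend (face_diff j) (face_diff i \<theta>)"
  by (simp add: face_diff_def frag_extend_diff face_face)

lemma cube_boundary_boundary:
  "frag_extend (cube_boundary m) (cube_boundary (Suc m) \<theta>) = 0"
proof -
  define D where "D i j = frag_extend (face_diff i) (face_diff j \<theta>)" for i j
  have sm: "frag_extend (cube_boundary m) c = (\<Sum>i<m. frag_cmul ((-1) ^ Suc i) (frag_extend (face_diff i) c))"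
    for c :: "'a cube \<Rightarrow>\<^sub>0 int"
    unfolding cube_boundary_def by (simp only: frag_extend_fun_sum frag_extend_fun_cmul)
  have "frag_extend (cube_boundary m) (cube_boundary (Suc m) \<theta>)
      = (\<Sum>i<m. \<Sum>j<Suc m. frag_cmul ((-1) ^ (i + j)) (D i j))"
    unfolding sm unfolding frag_extend_cube_boundary frag_cmul_sum D_def
    by (simp only: frag_cmul_cmul power_Suc power_add) simp
  also have "\<dots> = (\<Sum>(i,j)\<in>{..<m} \<times> {..<Suc m}. frag_cmul ((-1) ^ (i + j)) (D i j))"
    by (simp add: sum.cartesian_product del: sum.lessThan_Suc)
  \<comment> \<open>By the cubical identity the term at \<open>(j, Suc i)\<close> with
    \<open>j \<le> i\<close> equals the one at \<open>(i, j)\<close>, and the exponents of the signs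
    differ by one: the two halves of the index set cancel.\<close>
  also have "{..<m} \<times> {..<Suc m} = {(i,j). i < m \<and> j \<le> i} \<union> (\<lambda>(i,j). (j, Suc i)) ` {(i,j). i < m \<and> j \<le> i}"
  proof -
    have "(i, j) \<in> (\<lambda>(i,j). (j, Suc i)) ` {(i,j). i < m \<and> j \<le> i}" if "i < m" "j < Suc m" "\<not> j \<le> i" for i j
      using that by (intro image_eqI[of _ _ "(j - 1, i)"]) auto
    then show ?thesis by fastforce
  qed
  also have "(\<Sum>(i,j)\<in>\<dots>. frag_cmul ((-1) ^ (i + j)) (D i j))
     = (\<Sum>(i,j)\<in>{(i,j). i < m \<and> j \<le> i}. frag_cmul ((-1) ^ (i + j)) (D i j))
      + (\<Sum>(i,j)\<in>(\<lambda>(i,j). (j, Suc i)) ` {(i,j). i < m \<and> j \<le> i}. frag_cmul ((-1) ^ (i + j)) (D i j))"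
  proof (rule sum.union_disjoint)
    show "finite {(i,j). i < m \<and> j \<le> i}"
      by (rule finite_subset[of _ "{..<m} \<times> {..<m}"]) auto
    then show "finite ((\<lambda>(i,j). (j, Suc i)) ` {(i,j). i < m \<and> j \<le> i})" by simp
  qed auto
  also have "(\<Sum>(i,j)\<in>(\<lambda>(i,j). (j, Suc i)) ` {(i,j). i < m \<and> j \<le> i}. frag_cmul ((-1) ^ (i + j)) (D i j))
     = (\<Sum>(i,j)\<in>{(i,j). i < m \<and> j \<le> i}. - frag_cmul ((-1) ^ (i + j)) (D i j))"
    by (subst sum.reindex) (auto simp: inj_on_def D_def face_diff_face_diff add.commute intro!: sum.cong)
  finally show ?thesis by (simp add: split_def sum_negf del: minus_frag_cmul)
qed

lemma face_cone_cube [simp]: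
  "face 0 True (cone_cube p \<theta>) = \<theta>"
  "face 0 False (cone_cube p \<theta>) = (\<lambda>_. p)"
  "face (Suc i) e (cone_cube p \<theta>) = cone_cube p (face i e \<theta>)"
  by (auto simp: face_def cone_cube_def insert_coord_def fun_eq_iff intro!: arg_cong[of _ _ \<theta>])

text \<open>The first direction contributes the two ends of the cone; the other faces are cones over
  faces, with signs reversed by the shift of directions. For \<open>m > 0\<close> the constant cube
  at the apex has no counterpart in the formula for simplices, but it is degenerate.\<close>

lemma cube_boundary_cone_cube:
  "cube_boundary (Suc m) (cone_cube p \<theta>)
    = frag_of \<theta> - frag_of (\<lambda>_. p) - frag_extend (\<lambda>\<theta>. frag_of (cone_cube p \<theta>)) (cube_boundary m \<theta>)"
  unfolding frag_extend_cube_boundary unfolding cube_boundary_def sum.lessThan_Suc_shift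
  by (simp add: face_diff_def frag_extend_diff sum_negf del: minus_frag_cmul flip: minus_frag_cmul)

section \<open>Degenerate cubes\<close>

lemma indep_face_same: "indep i \<theta> \<Longrightarrow> face i e \<theta> = face i e' \<theta>"
proof -
  assume "indep i \<theta>"
  moreover have "insert_coord i e x = (insert_coord i e' x)(i := e)" for x
    by (auto simp: insert_coord_def fun_eq_iff)
  ultimately show ?thesis unfolding face_def indep_def comp_def by metis
qed

text \<open>Fixing coordinate \<open>j\<close> moves the later coordinates down by one, hence the
  case distinction on the position of \<open>i\<close>.\<close>

lemma indep_face:
  assumes "indep i \<theta>" "j \<noteq> i" shows "indep (if i < j then i else i - 1) (face j e \<theta>)"
proof -
  have "insert_coord j e (x((if i < j then i else i - 1) := b)) = (insert_coord j e x)(i := b)" for x b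
    using assms(2) by (auto simp: insert_coord_def fun_eq_iff)
  then show ?thesis using assms(1) by (auto simp: indep_def face_def)
qed

lemma degenerate_face:
  assumes "i < Suc m" "indep i \<theta>" "j < Suc m" "j \<noteq> i" shows "degenerate m (face j e \<theta>)"
  unfolding degenerate_def
  by (rule exI[of _ "if i < j then i else i - 1"]) (use indep_face[OF assms(2,4), of e] assms in auto)

lemma not_degenerate_0 [simp]: "\<not> degenerate 0 \<theta>"
  by (simp add: degenerate_def)

lemma degenerate_const [simp]: "degenerate (Suc m) (\<lambda>_. p)"
  by (auto simp: degenerate_def indep_def)

lemma degenerate_cone_cube: "degenerate m \<theta> \<Longrightarrow> degenerate (Suc m) (cone_cube p \<theta>)"
proof -
  assume "degenerate m \<theta>"
  then obtain i where i: "i < m" "indep i \<theta>" by (auto simp: degenerate_def)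
  have "(\<lambda>j. (x(Suc i := b)) (Suc j)) = (\<lambda>j. x (Suc j))(i := b)" for x :: "nat \<Rightarrow> bool" and b by auto
  then have "indep (Suc i) (cone_cube p \<theta>)" using i(2) unfolding indep_def cone_cube_def
    by auto
  then show ?thesis using i by (auto simp: degenerate_def)
qed

text \<open>The two faces in a degenerate direction are equal and cancel; all other faces are degenerate.\<close>

lemma degenerate_cube_boundary:
  assumes "degenerate (Suc m) \<theta>" shows "supp (cube_boundary (Suc m) \<theta>) \<subseteq> {\<theta>. degenerate m \<theta>}"
proof -
  obtain i where i: "i < Suc m" "indep i \<theta>" using assms by (auto simp: degenerate_def)
  have "supp (frag_cmul ((-1) ^ Suc j) (face_diff j \<theta>)) \<subseteq> {\<theta>. degenerate m \<theta>}" if "j < Suc m" for j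
  proof (cases "j = i")
    case True
    then show ?thesis using indep_face_same[OF i(2), of True False] by (simp add: face_diff_def)
  next
    case False
    then show ?thesis using degenerate_face[OF i that]
      unfolding face_diff_def by (intro order_trans[OF keys_cmul] keys_diff_in) auto
  qed
  then show ?thesis unfolding cube_boundary_def by (intro order_trans[OF keys_sum]) blast
qed

section \<open>Chain maps between cubes and simplices\<close>

text \<open>The method of acyclic models: a chain map out of cubes is forced, cube by cube, by the cone on
  the least vertex. That it vanishes on degenerate cubes comes for free, without shuffles.\<close>

fun cube_to_simplices :: "nat \<Rightarrow> 'v cube \<Rightarrow> ('v list \<Rightarrow>\<^sub>0 int)" where
  "cube_to_simplices 0 \<theta> = frag_of [\<theta> origin]"
| "cube_to_simplices (Suc m) \<theta> =
     cone_simplex (\<theta> origin) (frag_extend (cube_to_simplices m) (cube_boundary (Suc m) \<theta>))"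

text \<open>The boundary of a cone returns the coned chain if that chain is a cycle. It is one
  because the map commutes with boundaries one dimension lower and the cubical boundary squares to
  zero; for edges, because both end points have the empty simplex as boundary.\<close>

lemma boundary_cube_to_simplices:
  "frag_extend simplex_boundary (cube_to_simplices (Suc m) \<theta>)
    = frag_extend (cube_to_simplices m) (cube_boundary (Suc m) \<theta>)"
proof (induction m arbitrary: \<theta>)
  case 0
  show ?case by (simp add: boundary_cone_simplex frag_extend_extend cube_boundary_def face_diff_def frag_extend_diff frag_extend_minus)
next
  case (Suc m)
  have "frag_extend simplex_boundary (frag_extend (cube_to_simplices (Suc m)) (cube_boundary (Suc (Suc m)) \<theta>))
     = frag_extend (cube_to_simplices m) (frag_extend (cube_boundary (Suc m)) (cube_boundary (Suc (Suc m)) \<theta>))"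
    unfolding frag_extend_extend Suc by simp
  then show ?case by (subst cube_to_simplices.simps) (simp add: boundary_cone_simplex cube_boundary_boundary
     del: cube_to_simplices.simps)
qed

text \<open>Apart from its value at the origin, \<open>\<theta>\<close> enters the recursion only
  through its boundary, which again consists of degenerate cubes. No 0-cube is degenerate, so the
  boundary of a degenerate edge is zero.\<close>

lemma cube_to_simplices_degenerate: "degenerate m \<theta> \<Longrightarrow> cube_to_simplices m \<theta> = 0"
proof (induction m arbitrary: \<theta>)
  case (Suc m)
  have "frag_extend (cube_to_simplices m) (cube_boundary (Suc m) \<theta>) = 0"
    using degenerate_cube_boundary[OF Suc.prems] Suc.IH by (blast intro: frag_extend_eq_0)
  then show ?case by simp
qed simp

text \<open>The vertex of the cube at \<open>x\<close> is \<open>v ! k\<close>, where \<open>k\<close> is the number of leading ones of \<open>x\<close>.\<close>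

fun simplex_to_cube :: "'v list \<Rightarrow> 'v cube" where
  "simplex_to_cube [] = (\<lambda>_. undefined)"
| "simplex_to_cube [p] = (\<lambda>_. p)"
| "simplex_to_cube (p # v) = cone_cube p (simplex_to_cube v)"

lemma simplex_to_cube_Cons: "v \<noteq> [] \<Longrightarrow> simplex_to_cube (p # v) = cone_cube p (simplex_to_cube v)"
  by (cases v) auto

abbreviation simplices_to_cubes :: "('v list \<Rightarrow>\<^sub>0 int) \<Rightarrow> ('v cube \<Rightarrow>\<^sub>0 int)" where
  "simplices_to_cubes \<equiv> frag_extend (\<lambda>v. frag_of (simplex_to_cube v))"

lemma keys_cone_cube_extend:
  assumes "supp c \<subseteq> {\<theta>. degenerate m \<theta>}"
  shows "supp (frag_extend (\<lambda>\<theta>. frag_of (cone_cube p \<theta>)) c) \<subseteq> {\<theta>. degenerate (Suc m) \<theta>}"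
  using assms degenerate_cone_cube by (intro keys_frag_extend_in) fastforce

text \<open>The cube of \<open>p # u\<close> is the cone over the cube of \<open>u\<close>, so both
  boundaries unfold by their cone formulas. They differ by the constant cube at \<open>p\<close> and
  by the cone over the inductive error, which are both degenerate. For an edge nothing
  differs.\<close>

lemma boundary_simplex_to_cube:
  "length v = Suc (Suc m) \<Longrightarrow>
    supp (cube_boundary (Suc m) (simplex_to_cube v) - simplices_to_cubes (simplex_boundary v))
     \<subseteq> {\<theta>. degenerate m \<theta>}"
proof (induction m arbitrary: v)
  case 0
  then obtain p q where "v = [p, q]" by (auto simp: length_Suc_conv)
  then show ?case by (simp add: cube_boundary_cone_cube frag_extend_diff)
next
  case (Suc m)
  then obtain p u where v: "v = p # u" "length u = Suc (Suc m)" by (auto simp: length_Suc_conv)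
  have ne: "w \<noteq> []" if "w \<in> supp (simplex_boundary u)" for w
    using keys_simplex_boundary[OF that] v by auto
  let ?K = "frag_extend (\<lambda>\<theta>. frag_of (cone_cube p \<theta>))"
  \<comment> \<open>Cones of simplices go to cones of cubes only over nonempty simplices, hence
    \<open>ne\<close>: the empty simplex of the augmented complex has no cube.\<close>
  have "simplices_to_cubes (cone_simplex p (simplex_boundary u)) = ?K (simplices_to_cubes (simplex_boundary u))"
    unfolding cone_simplex_def frag_extend_extend
    by (rule frag_extend_eq) (simp add: simplex_to_cube_Cons ne)
  then have "cube_boundary (Suc (Suc m)) (simplex_to_cube v) - simplices_to_cubes (simplex_boundary v)
    = 0 - frag_of (\<lambda>_. p) - ?K (cube_boundary (Suc m) (simplex_to_cube u) - simplices_to_cubes (simplex_boundary u))"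
    using v simplex_to_cube_Cons[of u p] by (cases "u = []") (auto simp: cube_boundary_cone_cube frag_extend_diff)
  also have "supp \<dots> \<subseteq> {\<theta>. degenerate (Suc m) \<theta>}"
    by (intro keys_diff_in keys_cone_cube_extend Suc.IH v) auto
  finally show ?case .
qed

section \<open>Chain homotopies\<close>

text \<open>The bracket is a cycle once the homotopy formula holds one dimension lower, so its cone
  on the first vertex solves the formula. In dimension 0 the round trip from simplices to cubes and
  back is the identity, and zero is a solution.\<close>

fun simplex_homotopy :: "nat \<Rightarrow> 'v list \<Rightarrow> ('v list \<Rightarrow>\<^sub>0 int)" where
  "simplex_homotopy 0 v = 0"
| "simplex_homotopy (Suc m) v =
     cone_simplex (hd v) (cube_to_simplices (Suc m) (simplex_to_cube v) - frag_of v
                          - frag_extend (simplex_homotopy m) (simplex_boundary v))"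

text \<open>Simplices go to cubes by a chain map only modulo degenerate cubes;
  \<open>cube_to_simplices\<close> kills these, so the round trip on simplices is an exact chain
  map.\<close>

lemma cube_to_simplices_to_cube:
  assumes "length v = Suc (Suc m)"
  shows "frag_extend (cube_to_simplices m) (cube_boundary (Suc m) (simplex_to_cube v))
       = frag_extend (\<lambda>u. cube_to_simplices m (simplex_to_cube u)) (simplex_boundary v)"
proof -
  have "frag_extend (cube_to_simplices m) (cube_boundary (Suc m) (simplex_to_cube v)
          - simplices_to_cubes (simplex_boundary v)) = 0"
    using boundary_simplex_to_cube[OF assms] cube_to_simplices_degenerate
    by (blast intro: frag_extend_eq_0)
  then show ?thesis by (simp add: frag_extend_diff frag_extend_extend)
qed

lemma boundary_simplex_homotopy:
  "length v = Suc m \<Longrightarrow>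
    frag_extend simplex_boundary (simplex_homotopy m v)
     = cube_to_simplices m (simplex_to_cube v) - frag_of v
       - (if m = 0 then 0 else frag_extend (simplex_homotopy (m - 1)) (simplex_boundary v))"
proof (induction m arbitrary: v)
  case 0
  then show ?case by (auto simp: length_Suc_conv)
next
  case (Suc m)
  have IH: "frag_extend (\<lambda>u. frag_extend simplex_boundary (simplex_homotopy m u)) (simplex_boundary v)
     = frag_extend (\<lambda>u. cube_to_simplices m (simplex_to_cube u) - frag_of u
         - (if m = 0 then 0 else frag_extend (simplex_homotopy (m - 1)) (simplex_boundary u))) (simplex_boundary v)"
    using keys_simplex_boundary[of _ v] Suc by (intro frag_extend_eq Suc.IH) fastforce
  have 0: "frag_extend (\<lambda>u. frag_extend (simplex_homotopy (m - 1)) (simplex_boundary u)) (simplex_boundary v) = 0"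
    by (simp add: simplex_boundary_boundary flip: frag_extend_extend)
  have "frag_extend simplex_boundary (frag_extend (simplex_homotopy m) (simplex_boundary v))
     = frag_extend (\<lambda>u. cube_to_simplices m (simplex_to_cube u)) (simplex_boundary v) - simplex_boundary v"
    unfolding frag_extend_extend IH using 0
    by (cases "m = 0") (simp_all add: frag_extend_fun_diff frag_extend_id)
  \<comment> \<open>The coned chain is a cycle, so the boundary of its cone is the chain
    itself.\<close>
  then have "frag_extend simplex_boundary (cube_to_simplices (Suc m) (simplex_to_cube v) - frag_of v
                          - frag_extend (simplex_homotopy m) (simplex_boundary v)) = 0"
    by (simp add: frag_extend_diff boundary_cube_to_simplices
      cube_to_simplices_to_cube[OF Suc.prems] del: cube_to_simplices.simps)
  then show ?case unfolding simplex_homotopy.simps boundary_cone_simplex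
    by (simp del: cube_to_simplices.simps)
qed

text \<open>The same recipe with the cone of cubes, which solves the homotopy formula only up to
  degenerate cubes.\<close>

fun cube_homotopy :: "nat \<Rightarrow> 'v cube \<Rightarrow> ('v cube \<Rightarrow>\<^sub>0 int)" where
  "cube_homotopy 0 \<theta> = 0"
| "cube_homotopy (Suc m) \<theta> =
     frag_extend (\<lambda>\<eta>. frag_of (cone_cube (\<theta> origin) \<eta>))
       (simplices_to_cubes (cube_to_simplices (Suc m) \<theta>) - frag_of \<theta>
        - frag_extend (cube_homotopy m) (cube_boundary (Suc m) \<theta>))"

text \<open>Needed for the dual homotopy to map normalized cochains to normalized ones. The round
  trip vanishes on a degenerate \<open>\<theta>\<close>; the two other terms are degenerate, and so
  are cones over them.\<close>

lemma cube_homotopy_degenerate: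
  "degenerate m \<theta> \<Longrightarrow> supp (cube_homotopy m \<theta>) \<subseteq> {\<theta>. degenerate (Suc m) \<theta>}"
proof (induction m arbitrary: \<theta>)
  case (Suc m)
  have "supp (frag_extend (cube_homotopy m) (cube_boundary (Suc m) \<theta>)) \<subseteq> {\<theta>. degenerate (Suc m) \<theta>}"
    using degenerate_cube_boundary[OF Suc.prems] Suc.IH by (intro keys_frag_extend_in) blast
  then show ?case unfolding cube_homotopy.simps cube_to_simplices_degenerate[OF Suc.prems]
    using Suc.prems by (intro keys_cone_cube_extend keys_diff_in) auto
qed simp

lemma keys_cube_to_simplices_length: "v \<in> supp (cube_to_simplices m \<theta>) \<Longrightarrow> length v = Suc m"
proof (induction m arbitrary: \<theta> v)
  case (Suc m)
  then show ?case
    using keys_cone_simplex[of "\<theta> origin" "frag_extend (cube_to_simplices m) (cube_boundary (Suc m) \<theta>)"]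
      keys_frag_extend[of "cube_to_simplices m" "cube_boundary (Suc m) \<theta>"]
    by fastforce
qed simp

definition depends :: "nat \<Rightarrow> 'v cube \<Rightarrow> bool" where
  "depends m \<theta> \<longleftrightarrow> \<theta> \<circ> truncate m = \<theta>"

lemma depends_face: assumes "depends (Suc m) \<theta>" "i \<le> m" shows "depends m (face i e \<theta>)"
proof -
  have "insert_coord i e (truncate m x) = truncate (Suc m) (insert_coord i e x)" for x
    using assms(2) by (auto simp: insert_coord_def truncate_def fun_eq_iff)
  then show ?thesis using assms(1) unfolding depends_def face_def comp_def by metis
qed

lemma keys_cube_boundary:
  "\<eta> \<in> supp (cube_boundary m \<theta>) \<Longrightarrow> \<exists>i<m. \<exists>e. \<eta> = face i e \<theta>"
proof -
  assume "\<eta> \<in> supp (cube_boundary m \<theta>)"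
  then obtain i where "i < m" "\<eta> \<in> supp (face_diff i \<theta>)"
    using keys_sum[of "\<lambda>i. frag_cmul ((-1) ^ Suc i) (face_diff i \<theta>)" "{..<m}"] unfolding cube_boundary_def by auto
  moreover have "supp (face_diff i \<theta>) \<subseteq> {face i False \<theta>, face i True \<theta>}"
    unfolding face_diff_def by (intro keys_diff_in) auto
  ultimately show ?thesis by blast
qed

text \<open>The argument for simplices, with two sources of degenerate cubes: the constants at the
  apex of a cubical cone, and the failure of \<open>simplices_to_cubes\<close> to be an exact chain
  map.\<close>

lemma boundary_cube_homotopy:
  "depends m \<theta> \<Longrightarrow>
    supp (frag_extend (cube_boundary (Suc m)) (cube_homotopy m \<theta>)
      - (simplices_to_cubes (cube_to_simplices m \<theta>) - frag_of \<theta>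
         - (if m = 0 then 0 else frag_extend (cube_homotopy (m - 1)) (cube_boundary m \<theta>)))) \<subseteq> {\<theta>. degenerate m \<theta>}"
proof (induction m arbitrary: \<theta>)
  case 0
  \<comment> \<open>A 0-cube is constant, so the round trip is the identity here; this matters
    because no 0-cube is degenerate and the formula has to hold exactly.\<close>
  have "truncate 0 x = origin" for x by (auto simp: truncate_def)
  then have "\<theta> = (\<lambda>_. \<theta> origin)" using 0 unfolding depends_def by (metis comp_apply)
  then show ?case by (simp add: frag_of_eq)
next
  case (Suc m)
  let ?K = "frag_extend (\<lambda>\<eta>. frag_of (cone_cube (\<theta> origin) \<eta>))"
  let ?b = "cube_boundary (Suc m) \<theta>"
  define w where "w = simplices_to_cubes (cube_to_simplices (Suc m) \<theta>) - frag_of \<theta> - frag_extend (cube_homotopy m) ?b"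
  define dw where "dw = frag_extend (cube_boundary (Suc m)) w"
  have b: "frag_extend (cube_boundary (Suc (Suc m))) (?K c)
     = c - frag_extend (\<lambda>_. frag_of (\<lambda>_. \<theta> origin)) c - ?K (frag_extend (cube_boundary (Suc m)) c)" for c
    by (simp add: frag_extend_extend cube_boundary_cone_cube frag_extend_fun_diff frag_extend_id)
  have d1: "supp (frag_extend (cube_boundary (Suc m)) (simplices_to_cubes (cube_to_simplices (Suc m) \<theta>))
     - simplices_to_cubes (frag_extend simplex_boundary (cube_to_simplices (Suc m) \<theta>))) \<subseteq> {\<theta>. degenerate m \<theta>}"
    unfolding frag_extend_extend frag_extend_of frag_extend_fun_diff[symmetric]
    by (intro keys_frag_extend_in boundary_simplex_to_cube keys_cube_to_simplices_length)
  have 0: "frag_extend (\<lambda>u. frag_extend (cube_homotopy (m - 1)) (cube_boundary m u)) ?b = 0"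
    by (simp add: cube_boundary_boundary flip: frag_extend_extend)
  have d2: "supp (frag_extend (cube_boundary (Suc m)) (frag_extend (cube_homotopy m) ?b)
     - frag_extend (\<lambda>\<eta>. simplices_to_cubes (cube_to_simplices m \<eta>) - frag_of \<eta>
         - (if m = 0 then 0 else frag_extend (cube_homotopy (m - 1)) (cube_boundary m \<eta>))) ?b) \<subseteq> {\<theta>. degenerate m \<theta>}"
    unfolding frag_extend_extend frag_extend_of frag_extend_fun_diff[symmetric]
    using keys_cube_boundary[of _ "Suc m" \<theta>] depends_face[OF Suc.prems] less_Suc_eq_le
    by (intro keys_frag_extend_in Suc.IH) blast
  have "frag_extend (\<lambda>\<eta>. simplices_to_cubes (cube_to_simplices m \<eta>) - frag_of \<eta>
         - (if m = 0 then 0 else frag_extend (cube_homotopy (m - 1)) (cube_boundary m \<eta>))) ?b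
       = simplices_to_cubes (frag_extend (cube_to_simplices m) ?b) - ?b"
    using 0 by (cases "m = 0") (simp_all add: frag_extend_fun_diff frag_extend_id frag_extend_extend frag_extend_eq_0)
  note d2 = d2[unfolded this]
  \<comment> \<open>The chain \<open>w\<close> is a cycle only modulo degenerate cubes: its boundary
    is the difference of the errors in \<open>d1\<close> and \<open>d2\<close>, whose main terms
    cancel by \<open>boundary_cube_to_simplices\<close>.\<close>
  have "dw = frag_extend (cube_boundary (Suc m)) (simplices_to_cubes (cube_to_simplices (Suc m) \<theta>))
     - simplices_to_cubes (frag_extend simplex_boundary (cube_to_simplices (Suc m) \<theta>))
     - (frag_extend (cube_boundary (Suc m)) (frag_extend (cube_homotopy m) ?b)
        - (simplices_to_cubes (frag_extend (cube_to_simplices m) ?b) - ?b))"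
    unfolding boundary_cube_to_simplices by (simp add: dw_def w_def frag_extend_diff del: cube_to_simplices.simps)
  then have "supp dw \<subseteq> {\<theta>. degenerate m \<theta>}"
    using keys_diff_in[OF d1 d2] by simp
  then have "supp (?K dw) \<subseteq> {\<theta>. degenerate (Suc m) \<theta>}" by (rule keys_cone_cube_extend)
  moreover have "supp (frag_extend (\<lambda>_. frag_of (\<lambda>_. \<theta> origin)) w) \<subseteq> {\<theta>. degenerate (Suc m) \<theta>}"
    by (rule keys_frag_extend_in) auto
  moreover have "frag_extend (cube_boundary (Suc (Suc m))) (cube_homotopy (Suc m) \<theta>) - w
     = 0 - frag_extend (\<lambda>_. frag_of (\<lambda>_. \<theta> origin)) w - ?K dw"
    unfolding cube_homotopy.simps w_def[symmetric] b dw_def by simp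
  moreover have "supp (0 - frag_extend (\<lambda>_. frag_of (\<lambda>_. \<theta> origin)) w - ?K dw) \<subseteq> {\<theta>. degenerate (Suc m) \<theta>}"
    by (intro keys_diff_in calculation) auto
  ultimately show ?case unfolding w_def by simp
qed

section \<open>Naturality and supports\<close>

abbreviation map_cubes :: "('v \<Rightarrow> 'w) \<Rightarrow> ('v cube \<Rightarrow>\<^sub>0 int) \<Rightarrow> ('w cube \<Rightarrow>\<^sub>0 int)" where
  "map_cubes f \<equiv> frag_extend (\<lambda>\<theta>. frag_of (f \<circ> \<theta>))"

lemma face_comp: "face i e (f \<circ> \<theta>) = f \<circ> face i e \<theta>"
  by (simp add: face_def comp_assoc)

lemma map_cube_boundary: "map_cubes f (cube_boundary m \<theta>) = cube_boundary m (f \<circ> \<theta>)"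
  unfolding frag_extend_cube_boundary
  by (simp add: cube_boundary_def face_diff_def frag_extend_diff face_comp)

text \<open>The common step of the naturality proofs: naturality known on the support of a chain, by
  induction, passes to the linear extension.\<close>

lemma map_frag_extend:
  "(\<And>x. x \<in> supp c \<Longrightarrow> frag_extend g (f x) = f' (h x)) \<Longrightarrow>
   frag_extend g (frag_extend f c) = frag_extend f' (frag_extend (\<lambda>x. frag_of (h x)) c)"
  unfolding frag_extend_extend by (rule frag_extend_eq) simp

lemma map_cube_to_simplices: "map_simplices f (cube_to_simplices m \<theta>) = cube_to_simplices m (f \<circ> \<theta>)"
proof (induction m arbitrary: \<theta>)
  case (Suc m)
  have "map_simplices f (frag_extend (cube_to_simplices m) (cube_boundary (Suc m) \<theta>))
     = frag_extend (cube_to_simplices m) (cube_boundary (Suc m) (f \<circ> \<theta>))"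
    unfolding map_cube_boundary[symmetric] using Suc unfolding map_simplices_def by (intro map_frag_extend)
  then show ?case unfolding cube_to_simplices.simps map_cone_simplex by simp
qed simp

lemma cone_cube_comp: "cone_cube (f p) (f \<circ> \<theta>) = f \<circ> cone_cube p \<theta>"
  by (auto simp: cone_cube_def)

lemma simplex_to_cube_map: "v \<noteq> [] \<Longrightarrow> simplex_to_cube (map f v) = f \<circ> simplex_to_cube v"
  by (induction v rule: induct_list012) (auto simp: cone_cube_comp[symmetric])

lemma map_simplices_to_cubes:
  "(\<And>v. v \<in> supp c \<Longrightarrow> v \<noteq> []) \<Longrightarrow>
    map_cubes f (simplices_to_cubes c) = simplices_to_cubes (map_simplices f c)"
  unfolding map_simplices_def by (rule map_frag_extend) (simp add: simplex_to_cube_map)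

lemma map_simplex_homotopy:
  "length v = Suc m \<Longrightarrow> map_simplices f (simplex_homotopy m v) = simplex_homotopy m (map f v)"
proof (induction m arbitrary: v)
  case (Suc m)
  have "map_simplices f (frag_extend (simplex_homotopy m) (simplex_boundary v))
     = frag_extend (simplex_homotopy m) (simplex_boundary (map f v))"
    unfolding map_simplex_boundary[symmetric] using Suc.IH keys_simplex_boundary[of _ v] Suc.prems
    unfolding map_simplices_def by (intro map_frag_extend) fastforce
  moreover have "v \<noteq> []" using Suc.prems by auto
  ultimately show ?case
    by (simp add: map_cone_simplex map_cube_to_simplices simplex_to_cube_map hd_map del: cube_to_simplices.simps)
qed simp

lemma map_cube_homotopy: "map_cubes f (cube_homotopy m \<theta>) = cube_homotopy m (f \<circ> \<theta>)"
proof (induction m arbitrary: \<theta>)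
  case (Suc m)
  have 1: "map_cubes f (frag_extend (cube_homotopy m) (cube_boundary (Suc m) \<theta>))
     = frag_extend (cube_homotopy m) (cube_boundary (Suc m) (f \<circ> \<theta>))"
    unfolding map_cube_boundary[symmetric] using Suc by (intro map_frag_extend)
  have 2: "map_cubes f (simplices_to_cubes (cube_to_simplices (Suc m) \<theta>))
     = simplices_to_cubes (cube_to_simplices (Suc m) (f \<circ> \<theta>))"
    unfolding map_cube_to_simplices[symmetric]
    by (rule map_simplices_to_cubes) (use keys_cube_to_simplices_length in fastforce)
  have 3: "map_cubes f (frag_extend (\<lambda>\<eta>. frag_of (cone_cube p \<eta>)) c)
    = frag_extend (\<lambda>\<eta>. frag_of (cone_cube (f p) \<eta>)) (map_cubes f c)" for p c
    by (rule map_frag_extend) (simp add: cone_cube_comp)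
  show ?case unfolding cube_homotopy.simps 3 by (simp add: frag_extend_diff 1 2 del: cube_to_simplices.simps)
qed simp

text \<open>Only weakly increasing: the Baues-Wirsching complex includes chains with identity
  arrows, and cones may repeat their vertex.\<close>

definition simplices_in :: "nat \<Rightarrow> 'v::order \<Rightarrow> 'v \<Rightarrow> 'v list set" where
  "simplices_in m p q = {v. length v = Suc m \<and> sorted_wrt (\<le>) v \<and> set v \<subseteq> {p..q}}"

definition cubes_in :: "nat \<Rightarrow> 'v::order \<Rightarrow> 'v \<Rightarrow> 'v cube set" where
  "cubes_in m p q = {\<theta>. mono \<theta> \<and> depends m \<theta> \<and> (\<forall>x. p \<le> \<theta> x \<and> \<theta> x \<le> q)}"

lemma simplices_in_Cons:
  "v \<in> simplices_in m a q \<Longrightarrow> p \<le> a \<Longrightarrow> a \<le> q \<Longrightarrow> a # v \<in> simplices_in (Suc m) p q"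
  by (force simp: simplices_in_def)

text \<open>Raising the lower end of the interval to the first vertex is what lets a cone on that
  vertex stay ordered.\<close>

lemma simplices_in_hd: "v \<in> simplices_in m p q \<Longrightarrow> v \<in> simplices_in m (hd v) q \<and> p \<le> hd v \<and> hd v \<le> q"
  by (cases v) (auto simp: simplices_in_def)

lemma simplices_in_boundary:
  "v \<in> simplices_in (Suc m) p q \<Longrightarrow> supp (simplex_boundary v) \<subseteq> simplices_in m p q"
  using keys_simplex_boundary[of _ v "(\<le>)"] by (force simp: simplices_in_def)

lemma keys_cone_simplex_in:
  assumes "supp c \<subseteq> simplices_in m a q" "p \<le> a" "a \<le> q"
  shows "supp (cone_simplex a c) \<subseteq> simplices_in (Suc m) p q"
  using keys_cone_simplex[of a c] assms simplices_in_Cons[of _ m a q p] by blast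

lemma mono_insert_coord: "mono (insert_coord i e)"
  by (auto simp: mono_def insert_coord_def le_fun_def)

lemma cubes_in_face: "\<theta> \<in> cubes_in (Suc m) p q \<Longrightarrow> i < Suc m \<Longrightarrow> face i e \<theta> \<in> cubes_in m p q"
  using mono_insert_coord[of i e] depends_face[of m \<theta> i e]
  by (auto simp: cubes_in_def) (auto simp: face_def mono_def)

lemma cubes_in_bot: "\<theta> \<in> cubes_in m p q \<Longrightarrow> \<theta> \<in> cubes_in m (\<theta> origin) q \<and> p \<le> \<theta> origin \<and> \<theta> origin \<le> q"
  by (auto simp: cubes_in_def mono_def le_fun_def)

lemma cubes_in_boundary:
  "\<theta> \<in> cubes_in (Suc m) p q \<Longrightarrow> supp (cube_boundary (Suc m) \<theta>) \<subseteq> cubes_in m p q"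
  using keys_cube_boundary[of _ "Suc m" \<theta>] cubes_in_face by blast

text \<open>The induction varies the lower end \<open>p\<close>: all faces lie above
  \<open>\<theta> origin\<close>, so the simplices obtained from them can be coned on it and remain
  ordered.\<close>

lemma keys_cube_to_simplices:
  "\<theta> \<in> cubes_in m p q \<Longrightarrow> supp (cube_to_simplices m \<theta>) \<subseteq> simplices_in m p q"
proof (induction m arbitrary: \<theta> p)
  case 0
  then show ?case using cubes_in_bot[OF 0] by (auto simp: simplices_in_def)
next
  case (Suc m)
  note b = cubes_in_bot[OF Suc.prems]
  have "supp (frag_extend (cube_to_simplices m) (cube_boundary (Suc m) \<theta>)) \<subseteq> simplices_in m (\<theta> origin) q"
    using cubes_in_boundary[of \<theta> m "\<theta> origin" q] b by (intro keys_frag_extend_in Suc.IH) blast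
  then show ?case using b unfolding cube_to_simplices.simps by (intro keys_cone_simplex_in) auto
qed

lemma cone_cube_in: 
  assumes "\<theta> \<in> cubes_in m a q" "p \<le> a" "a \<le> q" shows "cone_cube a \<theta> \<in> cubes_in (Suc m) p q"
proof -
  have "cone_cube a \<theta> x \<le> cone_cube a \<theta> y" if "x \<le> y" for x y
    using that assms(1) monoD[of \<theta> "\<lambda>j. x (Suc j)" "\<lambda>j. y (Suc j)"]
    by (auto simp: cubes_in_def cone_cube_def le_fun_def)
  moreover have "depends (Suc m) (cone_cube a \<theta>)"
  proof -
    have "(\<lambda>j. truncate (Suc m) x (Suc j)) = truncate m (\<lambda>j. x (Suc j))" "truncate (Suc m) x 0 = x 0" for x
      by (auto simp: truncate_def)
    then show ?thesis using assms(1) unfolding cubes_in_def depends_def cone_cube_def fun_eq_iff comp_def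
      by simp
  qed
  ultimately show ?thesis using assms by (auto simp: cubes_in_def mono_def cone_cube_def intro: order_trans)
qed

lemma simplex_to_cube_in: "v \<in> simplices_in m p q \<Longrightarrow> simplex_to_cube v \<in> cubes_in m p q"
proof (induction m arbitrary: v p)
  case 0
  then show ?case by (auto simp: simplices_in_def cubes_in_def length_Suc_conv mono_def depends_def)
next
  case (Suc m)
  then obtain a u where v: "v = a # u" "length u = Suc m" by (auto simp: simplices_in_def length_Suc_conv)
  then have "u \<in> simplices_in m a q" "p \<le> a" "a \<le> q" using Suc.prems by (auto simp: simplices_in_def)
  moreover have "simplex_to_cube v = cone_cube a (simplex_to_cube u)"
    using v by (cases "u = []") (auto simp: simplex_to_cube_Cons)
  ultimately show ?case using Suc.IH cone_cube_in[of "simplex_to_cube u" m a q p] by auto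
qed

lemma keys_simplex_homotopy:
  "v \<in> simplices_in m p q \<Longrightarrow> supp (simplex_homotopy m v) \<subseteq> simplices_in (Suc m) p q"
proof (induction m arbitrary: v p)
  case (Suc m)
  note b = simplices_in_hd[OF Suc.prems]
  have "supp (frag_extend (simplex_homotopy m) (simplex_boundary v)) \<subseteq> simplices_in (Suc m) (hd v) q"
    using simplices_in_boundary[of v m "hd v" q] b by (intro keys_frag_extend_in Suc.IH) blast
  then show ?case using b unfolding simplex_homotopy.simps
    by (intro keys_cone_simplex_in keys_diff_in keys_cube_to_simplices simplex_to_cube_in) auto
qed simp

lemma keys_simplices_to_cubes:
  "supp c \<subseteq> simplices_in m p q \<Longrightarrow> supp (simplices_to_cubes c) \<subseteq> cubes_in m p q"
  using simplex_to_cube_in by (intro keys_frag_extend_in) fastforce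

lemma keys_cube_homotopy:
  "\<theta> \<in> cubes_in m p q \<Longrightarrow> supp (cube_homotopy m \<theta>) \<subseteq> cubes_in (Suc m) p q"
proof (induction m arbitrary: \<theta> p)
  case (Suc m)
  note b = cubes_in_bot[OF Suc.prems]
  have "supp (frag_extend (cube_homotopy m) (cube_boundary (Suc m) \<theta>)) \<subseteq> cubes_in (Suc m) (\<theta> origin) q"
    using cubes_in_boundary[of \<theta> m "\<theta> origin" q] b by (intro keys_frag_extend_in Suc.IH) blast
  then have "supp (simplices_to_cubes (cube_to_simplices (Suc m) \<theta>) - frag_of \<theta>
        - frag_extend (cube_homotopy m) (cube_boundary (Suc m) \<theta>)) \<subseteq> cubes_in (Suc m) (\<theta> origin) q"
    (is "supp ?w \<subseteq> _")
    using b by (intro keys_diff_in keys_simplices_to_cubes keys_cube_to_simplices) auto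
  then have "supp (frag_of (cone_cube (\<theta> origin) \<eta>)) \<subseteq> cubes_in (Suc (Suc m)) p q"
    if "\<eta> \<in> supp ?w" for \<eta>
    using that b cone_cube_in[of \<eta> "Suc m" "\<theta> origin" q p] by auto
  then show ?case unfolding cube_homotopy.simps by (rule keys_frag_extend_in)
qed simp

text \<open>The closed form of the recursive boundary, to be matched with the alternating sum in the
  Baues-Wirsching differential.\<close>

lemma simplex_boundary_sum:
  "simplex_boundary v = (\<Sum>j<length v. frag_cmul ((-1) ^ j) (frag_of (take j v @ drop (Suc j) v)))"
proof (induction v)
  case (Cons p v)
  then show ?case
    by (simp only: length_Cons sum.lessThan_Suc_shift simplex_boundary.simps cone_simplex_def
        frag_extend_sum[OF finite_lessThan] o_def frag_extend_cmul frag_extend_of)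
      (simp add: sum_negf del: minus_frag_cmul sum.lessThan_Suc flip: minus_frag_cmul)
qed simp

section \<open>Linear extension into abelian groups\<close>

text \<open>Values of \<open>f\<close> outside the group are replaced by \<open>\<one>\<close>, which makes \<open>lin G f\<close> a
  homomorphism without side conditions.\<close>

definition lin :: "('g, 'b) monoid_scheme \<Rightarrow> ('a \<Rightarrow> 'g) \<Rightarrow> ('a \<Rightarrow>\<^sub>0 int) \<Rightarrow> 'g" where
  "lin G f = (SOME h. h \<in> hom (free_Abelian_group UNIV) G \<and>
     (\<forall>x. h (frag_of x) = (if f x \<in> carrier G then f x else \<one>\<^bsub>G\<^esub>)))"

section \<open>Homomorphisms from free abelian groups to a given group\<close>

context comm_group
begin

lemma lin_props:
  "lin G f \<in> hom (free_Abelian_group UNIV) G \<and>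
     (\<forall>x. lin G f (frag_of x) = (if f x \<in> carrier G then f x else \<one>))"
proof -
  let ?f = "\<lambda>x. if f x \<in> carrier G then f x else \<one>"
  have "?f ` UNIV \<subseteq> carrier G" by auto
  from free_Abelian_group_universal[OF this]
  have "\<exists>h. h \<in> hom (free_Abelian_group UNIV) G \<and> (\<forall>x. h (frag_of x) = ?f x)"
    by (metis UNIV_I)
  then show ?thesis unfolding lin_def by (rule someI_ex)
qed

lemma lin_of: "f x \<in> carrier G \<Longrightarrow> lin G f (frag_of x) = f x"
  using lin_props by metis

lemma lin_closed [simp]: "lin G f c \<in> carrier G"
  using lin_props[of f] by (auto simp: hom_def free_Abelian_group_def)

lemma lin_add: "lin G f (c + d) = lin G f c \<otimes> lin G f d"
  using lin_props[of f] by (auto simp: hom_def free_Abelian_group_def)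

lemma lin_0 [simp]: "lin G f 0 = \<one>"
  using lin_add[of f 0 0] by (simp add: r_cancel_one')

lemma lin_diff: "lin G f (c - d) = lin G f c \<otimes> inv (lin G f d)"
  using lin_add[of f "c - d" d] by (simp add: inv_solve_right)

lemma lin_minus: "lin G f (- c) = inv (lin G f c)"
  using lin_diff[of f 0 c] by simp

lemma lin_cong:
  assumes "\<And>x. x \<in> supp c \<Longrightarrow> f x = g x" shows "lin G f c = lin G g c"
proof -
  have "supp c \<subseteq> {x. f x = g x}" using assms by auto
  then show ?thesis
  proof (induction c rule: frag_induction)
    case (one x)
    then show ?case using lin_props[of f] lin_props[of g] by simp
  qed (auto simp: lin_diff)
qed

lemma lin_hom:
  assumes "comm_group H" "h \<in> hom G H" "\<And>x. x \<in> supp c \<Longrightarrow> f x \<in> carrier G"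
  shows "h (lin G f c) = lin H (\<lambda>x. h (f x)) c"
proof -
  interpret H: comm_group H by fact
  interpret h: group_hom G H h using assms by unfold_locales
  have "supp c \<subseteq> {x. f x \<in> carrier G}" using assms by auto
  then show ?thesis
  proof (induction c rule: frag_induction)
    case (one x)
    then show ?case using assms(2) by (simp add: lin_of H.lin_of hom_def Pi_iff)
  qed (auto simp: lin_diff H.lin_diff)
qed

lemma lin_extend: "lin G f (frag_extend b c) = lin G (\<lambda>x. lin G f (b x)) c"
  using subset_UNIV by (induction c rule: frag_induction) (auto simp: lin_diff frag_extend_diff lin_of)

lemma lin_one: "(\<And>x. x \<in> supp c \<Longrightarrow> f x = \<one>) \<Longrightarrow> lin G f c = \<one>"
proof -
  assume "\<And>x. x \<in> supp c \<Longrightarrow> f x = \<one>"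
  then have "supp c \<subseteq> {x. f x = \<one>}" by auto
  then show ?thesis by (induction c rule: frag_induction) (auto simp: lin_diff lin_of)
qed

lemma lin_sum: "finite I \<Longrightarrow> lin G f (\<Sum>i\<in>I. c i) = finprod G (\<lambda>i. lin G f (c i)) I"
  by (induction I rule: finite_induct) (auto simp: lin_add)

lemma lin_sign: "lin G f (frag_cmul ((-1) ^ i) c) = lin G f c [^] ((-1 :: int) ^ i)"
  by (cases "even i") (auto simp: lin_minus int_pow_neg)

end

section \<open>Preadditive categories\<close>

context preadditive_category
begin

lemma Hom_Obj: "f \<in> Hom A x y \<Longrightarrow> x \<in> Obj A" "f \<in> Hom A x y \<Longrightarrow> y \<in> Obj A"
  using Dom_in Cod_in by (auto simp: Hom_def)

lemma Zero_in: "x \<in> Obj A \<Longrightarrow> y \<in> Obj A \<Longrightarrow> Zero A x y \<in> Hom A x y"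
  using comm_group.axioms(2)[OF hom_group, THEN group.is_monoid, THEN monoid.one_closed, of x y]
  by (simp add: hom_group_def)

lemma hom_group_simps:
  "carrier (hom_group A x y) = Hom A x y"
  "f \<otimes>\<^bsub>hom_group A x y\<^esub> g = f \<^bold>+ g"
  "\<one>\<^bsub>hom_group A x y\<^esub> = Zero A x y"
  by (simp_all add: hom_group_def)

lemma left_comp_hom:
  "g \<in> Hom A y z \<Longrightarrow> (\<lambda>f. g \<cdot> f) \<in> hom (hom_group A x y) (hom_group A x z)"
  by (auto simp: hom_def hom_group_simps Comp_Add intro: Comp_in)

lemma right_comp_hom:
  "f \<in> Hom A x y \<Longrightarrow> (\<lambda>g. g \<cdot> f) \<in> hom (hom_group A y z) (hom_group A x z)"
  by (auto simp: hom_def hom_group_simps Add_Comp intro: Comp_in)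

lemma Comp_Zero: "g \<in> Hom A y z \<Longrightarrow> x \<in> Obj A \<Longrightarrow> g \<cdot> Zero A x y = Zero A x z"
  using group_hom.hom_one[of "hom_group A x y" "hom_group A x z" "\<lambda>f. g \<cdot> f"] left_comp_hom
  by (simp add: group_hom_def group_hom_axioms_def hom_group comm_group.axioms(2) Hom_Obj hom_group_simps)

lemma Zero_Comp: "f \<in> Hom A x y \<Longrightarrow> z \<in> Obj A \<Longrightarrow> Zero A y z \<cdot> f = Zero A x z"
  using group_hom.hom_one[of "hom_group A y z" "hom_group A x z" "\<lambda>g. g \<cdot> f"] right_comp_hom
  by (simp add: group_hom_def group_hom_axioms_def hom_group comm_group.axioms(2) Hom_Obj hom_group_simps)

lemma Add_in: "f \<in> Hom A x y \<Longrightarrow> g \<in> Hom A x y \<Longrightarrow> f \<^bold>+ g \<in> Hom A x y"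
  using comm_group.axioms(2)[OF hom_group, THEN group.is_monoid, THEN monoid.m_closed, of x y f g] Hom_Obj
  by (simp add: hom_group_simps)

lemma Add_Zero: "f \<in> Hom A x y \<Longrightarrow> f \<^bold>+ Zero A x y = f"
  using comm_group.axioms(2)[OF hom_group, THEN group.is_monoid, THEN monoid.r_one, of x y f] Hom_Obj
  by (simp add: hom_group_simps)

lemma is_kernel_mono:
  assumes "is_kernel A f k" "u \<in> Hom A w (Dom A k)" "v \<in> Hom A w (Dom A k)" "k \<cdot> u = k \<cdot> v"
  shows "u = v"
proof -
  have k: "k \<in> Hom A (Dom A k) (Dom A f)" using assms(1) by (auto simp: is_kernel_def Hom_def)
  have f: "f \<in> Hom A (Dom A f) (Cod A f)" using assms(1) by (auto simp: is_kernel_def Hom_def)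
  have "f \<cdot> (k \<cdot> u) = Zero A w (Cod A f)"
    using assms(1) Comp_assoc[OF assms(2) k f] Zero_Comp[OF assms(2)] Hom_Obj(2)[OF f] by (simp add: is_kernel_def)
  then have "\<exists>!t. t \<in> Hom A w (Dom A k) \<and> k \<cdot> t = k \<cdot> u"
    using assms(1) Comp_in[OF assms(2) k] by (auto simp: is_kernel_def)
  then show ?thesis using assms by auto
qed

lemma is_kernel_lift:
  assumes "is_kernel A f k" "h \<in> Hom A w (Dom A f)" "f \<cdot> h = Zero A w (Cod A f)"
  obtains u where "u \<in> Hom A w (Dom A k)" "k \<cdot> u = h"
  using assms unfolding is_kernel_def by blast

text \<open>Coboundaries among generalized elements \<open>z : W \<rightarrow> X n\<close>; in degree \<open>0\<close> only zero.\<close>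

definition cobound :: "(nat \<Rightarrow> 'o) \<Rightarrow> (nat \<Rightarrow> 'm) \<Rightarrow> nat \<Rightarrow> 'o \<Rightarrow> 'm \<Rightarrow> bool" where
  "cobound X d n W z = (case n of 0 \<Rightarrow> z = Zero A W (X 0) | Suc m \<Rightarrow> \<exists>u \<in> Hom A W (X m). z = d m \<cdot> u)"

end

locale cochain_complex = preadditive_category A
  for A :: "('o, 'm, 'z) addcat_scheme" (structure) +
  fixes X :: "nat \<Rightarrow> 'o" and d :: "nat \<Rightarrow> 'm"
  assumes X_in: "X n \<in> Obj A"
    and d_in: "d n \<in> Hom A (X n) (X (Suc n))"
    and d_d: "d (Suc n) \<cdot> d n = Zero A (X n) (X (Suc (Suc n)))"
begin

lemma cobound_in: "cobound X d n W z \<Longrightarrow> W \<in> Obj A \<Longrightarrow> z \<in> Hom A W (X n)"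
  using Zero_in[of W "X 0"] X_in Comp_in[OF _ d_in] by (auto simp: cobound_def split: nat.splits)

lemma d_cobound: "cobound X d n W z \<Longrightarrow> W \<in> Obj A \<Longrightarrow> d n \<cdot> z = Zero A W (X (Suc n))"
  using Comp_Zero[OF d_in] Comp_assoc[OF _ d_in d_in] d_d Zero_Comp[OF _ X_in]
  by (auto simp: cobound_def split: nat.splits)

lemma cobound_comp: "cobound X d n W z \<Longrightarrow> u \<in> Hom A V W \<Longrightarrow> cobound X d n V (z \<cdot> u)"
proof (cases n)
  case 0
  then show "cobound X d n W z \<Longrightarrow> u \<in> Hom A V W \<Longrightarrow> cobound X d n V (z \<cdot> u)"
    using Zero_Comp[OF _ X_in] by (simp add: cobound_def)
next
  case (Suc m)
  assume "cobound X d n W z" "u \<in> Hom A V W"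
  then obtain t where "t \<in> Hom A W (X m)" "z = d m \<cdot> t" by (auto simp: cobound_def Suc)
  with \<open>u \<in> _\<close> show "cobound X d n V (z \<cdot> u)"
    using Comp_assoc[of u V W t "X m" "d m"] d_in[of m] Comp_in[of u V W t "X m"]
    by (auto simp: cobound_def Suc intro!: bexI[of _ "t \<cdot> u"])
qed

lemma cobound_Add:
  "cobound X d n W z \<Longrightarrow> cobound X d n W z' \<Longrightarrow> W \<in> Obj A \<Longrightarrow> cobound X d n W (z \<^bold>+ z')"
proof (cases n)
  case 0
  then show "cobound X d n W z \<Longrightarrow> cobound X d n W z' \<Longrightarrow> W \<in> Obj A \<Longrightarrow> cobound X d n W (z \<^bold>+ z')"
    using Add_Zero[OF Zero_in[OF _ X_in]] by (simp add: cobound_def)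
next
  case (Suc m)
  assume "cobound X d n W z" "cobound X d n W z'"
  then obtain t t' where t: "t \<in> Hom A W (X m)" "z = d m \<cdot> t" "t' \<in> Hom A W (X m)" "z' = d m \<cdot> t'"
    by (auto simp: cobound_def Suc)
  then show "cobound X d n W (z \<^bold>+ z')" using Comp_Add[OF t(1,3) d_in]
    by (auto simp: cobound_def Suc Add_in intro!: bexI[of _ "t \<^bold>+ t'"])
qed

end

text \<open>The universal property of cocycles modulo coboundaries, with coboundaries tested on
  generalized elements. In this form it covers degree 0, where \<open>q\<close> can be an identity,
  and positive degrees, where \<open>q\<close> can be a cokernel.\<close>

definition (in preadditive_category) cohomology_quotient ::
    "(nat \<Rightarrow> 'o) \<Rightarrow> (nat \<Rightarrow> 'm) \<Rightarrow> nat \<Rightarrow> 'm \<Rightarrow> 'm \<Rightarrow> bool" where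
  "cohomology_quotient X d n k q \<longleftrightarrow> is_kernel A (d n) k \<and> q \<in> Hom A (Dom A k) (cohomology A d n) \<and>
    (\<forall>W. \<forall>z \<in> Hom A W (Dom A k). cobound X d n W (k \<cdot> z) \<longrightarrow> q \<cdot> z = Zero A W (cohomology A d n)) \<and>
    (\<forall>W. \<forall>h \<in> Hom A (Dom A k) W.
      (\<forall>V. \<forall>z \<in> Hom A V (Dom A k). cobound X d n V (k \<cdot> z) \<longrightarrow> h \<cdot> z = Zero A V W)
      \<longrightarrow> (\<exists>!v. v \<in> Hom A (cohomology A d n) W \<and> v \<cdot> q = h))"

lemma (in abelian_category) ex_cohomology_quotient:
  assumes "cochain_complex A X d"
  shows "\<exists>k q. cohomology_quotient X d n k q"
proof -
  interpret cochain_complex A X d by fact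
  let ?k = "Defs.kernel A (d n)"
  have k: "is_kernel A (d n) ?k" unfolding Defs.kernel_def
    using has_kernels[of "d n"] d_in[of n] by (auto simp: Hom_def intro: someI_ex)
  have dn: "Dom A (d n) = X n" "Cod A (d n) = X (Suc n)" using d_in[of n] by (auto simp: Hom_def)
  have kin: "?k \<in> Hom A (Dom A ?k) (X n)" using k d_in[of n] by (auto simp: is_kernel_def Hom_def)
  note Z = Hom_Obj(1)[OF kin]
  show ?thesis
  proof (cases n)
    case 0
    then have H: "cohomology A d n = Dom A ?k" by (simp add: cohomology_def)
    show ?thesis
      unfolding cohomology_quotient_def H
    proof (intro exI conjI allI ballI impI)
      show "is_kernel A (d n) ?k" by fact
      show "Id A (Dom A ?k) \<in> Hom A (Dom A ?k) (Dom A ?k)" using Id_in[OF Z] .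
      show "Id A (Dom A ?k) \<cdot> z = Zero A W (Dom A ?k)"
        if "z \<in> Hom A W (Dom A ?k)" "cobound X d n W (?k \<cdot> z)" for W z
      proof -
        have "?k \<cdot> z = ?k \<cdot> Zero A W (Dom A ?k)"
          using that Comp_Zero[OF kin] Hom_Obj by (simp add: cobound_def 0)
        then show ?thesis using is_kernel_mono[OF k that(1) Zero_in] Id_Comp[OF that(1)] Hom_Obj[OF that(1)]
          by auto
      qed
      show "\<exists>!v. v \<in> Hom A (Dom A ?k) W \<and> v \<cdot> Id A (Dom A ?k) = h" if "h \<in> Hom A (Dom A ?k) W" for W h
        using that Comp_Id by auto
    qed
  next
    case (Suc m)
    let ?b = "factor_through A ?k (d m)"
    have b: "?b \<in> Hom A (X m) (Dom A ?k)" "?k \<cdot> ?b = d m"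
    proof -
      have dm: "d m \<in> Hom A (X m) (Dom A (d n))" "Dom A (d m) = X m"
        using d_in[of m] dn Suc by (auto simp: Hom_def)
      have "d n \<cdot> d m = Zero A (X m) (Cod A (d n))" using d_d[of m] dn Suc by simp
      then have "\<exists>!u. u \<in> Hom A (Dom A (d m)) (Dom A ?k) \<and> ?k \<cdot> u = d m"
        using k dm unfolding is_kernel_def by auto
      from theI'[OF this] show "?b \<in> Hom A (X m) (Dom A ?k)" "?k \<cdot> ?b = d m"
        unfolding factor_through_def dm(2) by auto
    qed
    let ?q = "cokernel A ?b"
    have q: "is_cokernel A ?b ?q" unfolding cokernel_def
      using has_cokernels[of ?b] b by (auto simp: Hom_def intro: someI_ex)
    have bb: "Dom A ?b = X m" "Cod A ?b = Dom A ?k" using b by (auto simp: Hom_def)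
    have H: "cohomology A d n = Cod A ?q" by (simp add: cohomology_def Suc)
    have qin: "?q \<in> Hom A (Dom A ?k) (Cod A ?q)" using q bb by (auto simp: is_cokernel_def Hom_def)
    show ?thesis
      unfolding cohomology_quotient_def H
    proof (intro exI conjI allI ballI impI)
      show "is_kernel A (d n) ?k" by fact
      show "?q \<in> Hom A (Dom A ?k) (Cod A ?q)" by fact
      show "?q \<cdot> z = Zero A W (Cod A ?q)"
        if z: "z \<in> Hom A W (Dom A ?k)" "cobound X d n W (?k \<cdot> z)" for W z
      proof -
        obtain t where t: "t \<in> Hom A W (X m)" "?k \<cdot> z = d m \<cdot> t" using z(2) by (auto simp: cobound_def Suc)
        have "?k \<cdot> z = ?k \<cdot> (?b \<cdot> t)" using t b Comp_assoc[OF t(1) b(1) kin] by simp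
        then have "z = ?b \<cdot> t" using is_kernel_mono[OF k z(1)] Comp_in[OF t(1) b(1)] by simp
        then have "?q \<cdot> z = Zero A (X m) (Cod A ?q) \<cdot> t"
          using Comp_assoc[OF t(1) b(1) qin] q bb by (simp add: is_cokernel_def)
        then show ?thesis using Zero_Comp[OF t(1)] Hom_Obj(2)[OF qin] by simp
      qed
      show "\<exists>!v. v \<in> Hom A (Cod A ?q) W \<and> v \<cdot> ?q = h"
        if h: "h \<in> Hom A (Dom A ?k) W" "\<forall>V. \<forall>z \<in> Hom A V (Dom A ?k). cobound X d n V (?k \<cdot> z) \<longrightarrow> h \<cdot> z = Zero A V W"
        for W h
      proof -
        \<comment> \<open>The generic coboundary is \<open>d m\<close> applied to the identity of
          \<open>X m\<close>. A map that kills all coboundaries therefore kills \<open>?b\<close>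
          and factors through the cokernel.\<close>
        have "cobound X d n (X m) (?k \<cdot> ?b)"
          using b(2) Comp_Id[OF d_in[of m]] Id_in[OF X_in[of m]] by (auto simp: cobound_def Suc intro!: bexI[of _ "Id A (X m)"])
        then have "h \<cdot> ?b = Zero A (X m) W" using h(2) b(1) by blast
        then show ?thesis using q h(1) bb unfolding is_cokernel_def by auto
      qed
    qed
  qed
qed

text \<open>By the Yoneda lemma it suffices to compare the cohomology groups of generalized elements:
  applying surjectivity to the inclusion of the cocycles yields the inverse.\<close>

lemma (in abelian_category) cohomology_isomorphic:
  assumes X: "cochain_complex A X d" and Y: "cochain_complex A Y e"
    and f: "\<And>n. f n \<in> Hom A (X n) (Y n)"
    and fd: "\<And>n. f (Suc n) \<cdot> d n = e n \<cdot> f n"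
    and surj: "\<And>W y. y \<in> Hom A W (Y n) \<Longrightarrow> e n \<cdot> y = Zero A W (Y (Suc n)) \<Longrightarrow>
       \<exists>x \<in> Hom A W (X n). d n \<cdot> x = Zero A W (X (Suc n)) \<and> (\<exists>b. cobound Y e n W b \<and> f n \<cdot> x = y \<^bold>+ b)"
    and inj: "\<And>W x. x \<in> Hom A W (X n) \<Longrightarrow> d n \<cdot> x = Zero A W (X (Suc n)) \<Longrightarrow>
       cobound Y e n W (f n \<cdot> x) \<Longrightarrow> cobound X d n W x"
  shows "isomorphic A (cohomology A e n) (cohomology A d n)"
proof -
  interpret X: cochain_complex A X d by fact
  interpret Y: cochain_complex A Y e by fact
  let ?H = "cohomology A d n" and ?H' = "cohomology A e n"
  obtain k q where kq: "cohomology_quotient X d n k q" using ex_cohomology_quotient[OF X] by blast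
  then have k: "is_kernel A (d n) k" and q: "q \<in> Hom A (Dom A k) ?H"
    and q0: "\<And>W z. z \<in> Hom A W (Dom A k) \<Longrightarrow> cobound X d n W (k \<cdot> z) \<Longrightarrow> q \<cdot> z = Zero A W ?H"
    and qf: "\<And>W h. h \<in> Hom A (Dom A k) W
      \<Longrightarrow> (\<And>V z. z \<in> Hom A V (Dom A k) \<Longrightarrow> cobound X d n V (k \<cdot> z) \<Longrightarrow> h \<cdot> z = Zero A V W)
      \<Longrightarrow> \<exists>!v. v \<in> Hom A ?H W \<and> v \<cdot> q = h"
    unfolding cohomology_quotient_def by simp_all
  obtain k' q' where kq': "cohomology_quotient Y e n k' q'" using ex_cohomology_quotient[OF Y] by blast
  then have k': "is_kernel A (e n) k'" and q': "q' \<in> Hom A (Dom A k') ?H'"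
    and q0': "\<And>W z. z \<in> Hom A W (Dom A k') \<Longrightarrow> cobound Y e n W (k' \<cdot> z) \<Longrightarrow> q' \<cdot> z = Zero A W ?H'"
    and qf': "\<And>W h. h \<in> Hom A (Dom A k') W
      \<Longrightarrow> (\<And>V z. z \<in> Hom A V (Dom A k') \<Longrightarrow> cobound Y e n V (k' \<cdot> z) \<Longrightarrow> h \<cdot> z = Zero A V W)
      \<Longrightarrow> \<exists>!v. v \<in> Hom A ?H' W \<and> v \<cdot> q' = h"
    unfolding cohomology_quotient_def by simp_all
  let ?Z = "Dom A k" and ?Z' = "Dom A k'"
  have dn: "Dom A (d n) = X n" "Cod A (d n) = X (Suc n)" using X.d_in[of n] by (auto simp: Hom_def)
  have en: "Dom A (e n) = Y n" "Cod A (e n) = Y (Suc n)" using Y.d_in[of n] by (auto simp: Hom_def)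
  have kin: "k \<in> Hom A ?Z (X n)" "d n \<cdot> k = Zero A ?Z (X (Suc n))"
    using k dn by (auto simp: is_kernel_def Hom_def)
  have kin': "k' \<in> Hom A ?Z' (Y n)" "e n \<cdot> k' = Zero A ?Z' (Y (Suc n))"
    using k' en by (auto simp: is_kernel_def Hom_def)
  note Z = Hom_Obj(1)[OF kin(1)] and Z' = Hom_Obj(1)[OF kin'(1)] and H = Hom_Obj(2)[OF q] and H' = Hom_Obj(2)[OF q']
  have fk: "f n \<cdot> k \<in> Hom A ?Z (Y n)" using Comp_in[OF kin(1) f] .
  have "e n \<cdot> (f n \<cdot> k) = Zero A ?Z (Y (Suc n))"
    using Comp_assoc[OF kin(1) f Y.d_in] Comp_assoc[OF kin(1) X.d_in f] kin(2) fd Comp_Zero[OF f Z] by simp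
  \<comment> \<open>The map \<open>f n\<close> takes cocycles to cocycles; \<open>u\<close> is the
    induced map between the objects of cocycles.\<close>
  then obtain u where u: "u \<in> Hom A ?Z ?Z'" "k' \<cdot> u = f n \<cdot> k"
    using is_kernel_lift[OF k', of "f n \<cdot> k" ?Z] fk en by auto
  have fcob: "cobound Y e n W (f n \<cdot> z)" if z: "cobound X d n W z" "W \<in> Obj A" for W z
  proof (cases n)
    case 0
    then show ?thesis using z Comp_Zero[OF f] by (simp add: cobound_def)
  next
    case (Suc m)
    then obtain t where t: "t \<in> Hom A W (X m)" "z = d m \<cdot> t" using z by (auto simp: cobound_def)
    then have "f n \<cdot> z = e m \<cdot> (f m \<cdot> t)"
      using Comp_assoc[OF t(1) X.d_in f] Comp_assoc[OF t(1) f Y.d_in] fd by (simp add: Suc)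
    then show ?thesis using Comp_in[OF t(1) f] by (auto simp: cobound_def Suc)
  qed
  have "(q' \<cdot> u) \<cdot> z = Zero A V ?H'" if z: "z \<in> Hom A V ?Z" "cobound X d n V (k \<cdot> z)" for V z
  proof -
    have "k' \<cdot> (u \<cdot> z) = f n \<cdot> (k \<cdot> z)"
      using Comp_assoc[OF z(1) u(1) kin'(1)] u(2) Comp_assoc[OF z(1) kin(1) f] by simp
    then show ?thesis using q0'[OF Comp_in[OF z(1) u(1)]] fcob[OF z(2)] Hom_Obj[OF z(1)]
      Comp_assoc[OF z(1) u(1) q'] by simp
  qed
  from qf[OF Comp_in[OF u(1) q'] this] obtain v where v: "v \<in> Hom A ?H ?H'" "v \<cdot> q = q' \<cdot> u" by auto
  \<comment> \<open>The inclusion \<open>k'\<close> is the generic cocycle of \<open>Y\<close>. Its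
    preimage \<open>x\<close>, which is correct up to the coboundary \<open>b\<close>, gives the
    candidate for the inverse.\<close>
  obtain x b where x: "x \<in> Hom A ?Z' (X n)" "d n \<cdot> x = Zero A ?Z' (X (Suc n))"
    and b: "cobound Y e n ?Z' b" "f n \<cdot> x = k' \<^bold>+ b" using surj[OF kin'] by auto
  obtain s where s: "s \<in> Hom A ?Z' ?Z" "k \<cdot> s = x" using is_kernel_lift[OF k, of x ?Z'] x dn by auto
  note bin = Y.cobound_in[OF b(1) Z']
  \<comment> \<open>\<open>f n\<close> maps \<open>x \<cdot> z\<close> to a sum of two coboundaries,
    so by injectivity \<open>x \<cdot> z\<close> is a coboundary and \<open>q\<close> kills
    it.\<close>
  have "(q \<cdot> s) \<cdot> z = Zero A V ?H" if z: "z \<in> Hom A V ?Z'" "cobound Y e n V (k' \<cdot> z)" for V z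
  proof -
    have V: "V \<in> Obj A" using Hom_Obj[OF z(1)] by simp
    have "f n \<cdot> (x \<cdot> z) = k' \<cdot> z \<^bold>+ b \<cdot> z"
      using Comp_assoc[OF z(1) x(1) f] b(2) Add_Comp[OF z(1) kin'(1) bin] by simp
    moreover have "cobound Y e n V (k' \<cdot> z \<^bold>+ b \<cdot> z)"
      using Y.cobound_Add[OF z(2) Y.cobound_comp[OF b(1) z(1)] V] .
    moreover have "d n \<cdot> (x \<cdot> z) = Zero A V (X (Suc n))"
      using Comp_assoc[OF z(1) x(1) X.d_in] x(2) Zero_Comp[OF z(1) X.X_in] by simp
    ultimately have "cobound X d n V (k \<cdot> (s \<cdot> z))"
      using inj[OF Comp_in[OF z(1) x(1)]] Comp_assoc[OF z(1) s(1) kin(1)] s(2) by simp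
    then show ?thesis using q0[OF Comp_in[OF z(1) s(1)]] Comp_assoc[OF z(1) s(1) q] by simp
  qed
  from qf'[OF Comp_in[OF s(1) q] this] obtain v' where v': "v' \<in> Hom A ?H' ?H" "v' \<cdot> q' = q \<cdot> s" by auto
  \<comment> \<open>On cocycles the composite is the identity plus \<open>c\<close>; this
    \<open>c\<close> represents the coboundary \<open>b\<close>, so \<open>q'\<close> kills
    it.\<close>
  have "(v \<cdot> v') \<cdot> q' = q'"
  proof -
    obtain c where c: "c \<in> Hom A ?Z' ?Z'" "k' \<cdot> c = b"
      using is_kernel_lift[OF k', of b ?Z'] bin Y.d_cobound[OF b(1) Z'] en by auto
    have "k' \<cdot> (u \<cdot> s) = k' \<cdot> (Id A ?Z' \<^bold>+ c)"
      using Comp_assoc[OF s(1) u(1) kin'(1)] Comp_assoc[OF s(1) kin(1) f] u(2) s(2) b(2) c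
        Comp_Add[OF Id_in[OF Z'] c(1) kin'(1)] Comp_Id[OF kin'(1)] by simp
    then have "u \<cdot> s = Id A ?Z' \<^bold>+ c"
      using is_kernel_mono[OF k' Comp_in[OF s(1) u(1)] Add_in[OF Id_in[OF Z'] c(1)]] by simp
    then have "q' \<cdot> (u \<cdot> s) = q'"
      using Comp_Add[OF Id_in[OF Z'] c(1) q'] Comp_Id[OF q'] q0'[OF c(1)] c(2) b(1) Add_Zero[OF q'] by simp
    then show ?thesis
      using Comp_assoc[OF q' v'(1) v(1)] v'(2) Comp_assoc[OF s(1) q v(1)] v(2) Comp_assoc[OF s(1) u(1) q'] by simp
  qed
  moreover have "Id A ?H' \<cdot> q' = q'" using Id_Comp[OF q'] .
  ultimately have vv': "v \<cdot> v' = Id A ?H'"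
    using qf'[OF q' q0'] Comp_in[OF v'(1) v(1)] Id_in[OF H'] by auto
  have "(v' \<cdot> v) \<cdot> q = q"
  proof -
    interpret XZ: comm_group "hom_group A ?Z (X n)" using hom_group[OF Z X.X_in] .
    interpret YZ: comm_group "hom_group A ?Z (Y n)" using hom_group[OF Z Y.X_in] .
    interpret X'Z: comm_group "hom_group A ?Z (X (Suc n))" using hom_group[OF Z X.X_in] .
    let ?i = "inv\<^bsub>hom_group A ?Z (X n)\<^esub> k"
    \<comment> \<open>The deviation of the round trip from the identity on cocycles. Since
      \<open>f n\<close> maps it to the coboundary \<open>b \<cdot> u\<close>, injectivity makes it
      a coboundary, which \<open>q\<close> kills.\<close>
    let ?D = "x \<cdot> u \<^bold>+ ?i"
    interpret f: group_hom "hom_group A ?Z (X n)" "hom_group A ?Z (Y n)" "\<lambda>x. f n \<cdot> x"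
      by unfold_locales (rule left_comp_hom[OF f])
    interpret d: group_hom "hom_group A ?Z (X n)" "hom_group A ?Z (X (Suc n))" "\<lambda>x. d n \<cdot> x"
      by unfold_locales (rule left_comp_hom[OF X.d_in])
    have i: "?i \<in> Hom A ?Z (X n)" using XZ.inv_closed[of k] kin by (simp add: hom_group_simps)
    have xu: "x \<cdot> u \<in> Hom A ?Z (X n)" using Comp_in[OF u(1) x(1)] .
    have D: "?D \<in> Hom A ?Z (X n)" using Add_in[OF xu i] .
    have "d n \<cdot> ?i = Zero A ?Z (X (Suc n))" using d.hom_inv[of k] kin X'Z.inv_one by (simp add: hom_group_simps)
    then have dD: "d n \<cdot> ?D = Zero A ?Z (X (Suc n))"
      using Comp_Add[OF xu i X.d_in] Comp_assoc[OF u(1) x(1) X.d_in] x(2) Zero_Comp[OF u(1) X.X_in]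
       Add_Zero[OF Zero_in[OF Z X.X_in]] by simp
    have bu: "b \<cdot> u \<in> Hom A ?Z (Y n)" using Comp_in[OF u(1) bin] .
    have "f n \<cdot> (x \<cdot> u) = f n \<cdot> k \<^bold>+ b \<cdot> u"
      using Comp_assoc[OF u(1) x(1) f] b(2) Add_Comp[OF u(1) kin'(1) bin] u(2) by simp
    then have "f n \<cdot> ?D = (f n \<cdot> k \<^bold>+ b \<cdot> u) \<^bold>+ inv\<^bsub>hom_group A ?Z (Y n)\<^esub> (f n \<cdot> k)"
      using Comp_Add[OF xu i f] f.hom_inv[of k] kin by (simp add: hom_group_simps)
    also have "\<dots> = b \<cdot> u"
      using YZ.inv_solve_right[of "b \<cdot> u" "f n \<cdot> k \<^bold>+ b \<cdot> u" "f n \<cdot> k"] YZ.m_comm[of "b \<cdot> u" "f n \<cdot> k"] bu fk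
       Add_in[OF fk bu] by (simp add: hom_group_simps)
    finally have "cobound Y e n ?Z (f n \<cdot> ?D)" using Y.cobound_comp[OF b(1) u(1)] by simp
    then have D0: "cobound X d n ?Z ?D" using inj[OF D dD] by simp
    obtain c where c: "c \<in> Hom A ?Z ?Z" "k \<cdot> c = ?D" using is_kernel_lift[OF k, of ?D ?Z] D dD dn by auto
    have "x \<cdot> u = k \<^bold>+ ?D"
      using XZ.inv_solve_right[of ?D "x \<cdot> u" k] XZ.m_comm[of ?D k] xu kin D by (simp add: hom_group_simps)
    then have "k \<cdot> (s \<cdot> u) = k \<cdot> (Id A ?Z \<^bold>+ c)"
      using Comp_assoc[OF u(1) s(1) kin(1)] s(2) c Comp_Add[OF Id_in[OF Z] c(1) kin(1)] Comp_Id[OF kin(1)] by simp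
    then have "s \<cdot> u = Id A ?Z \<^bold>+ c"
      using is_kernel_mono[OF k Comp_in[OF u(1) s(1)] Add_in[OF Id_in[OF Z] c(1)]] by simp
    then have "q \<cdot> (s \<cdot> u) = q"
      using Comp_Add[OF Id_in[OF Z] c(1) q] Comp_Id[OF q] q0[OF c(1)] c(2) D0 Add_Zero[OF q] by simp
    then show ?thesis
      using Comp_assoc[OF q v(1) v'(1)] v(2) Comp_assoc[OF u(1) q' v'(1)] v'(2) Comp_assoc[OF u(1) s(1) q] by simp
  qed
  moreover have "Id A ?H \<cdot> q = q" using Id_Comp[OF q] .
  ultimately have "v' \<cdot> v = Id A ?H"
    using qf[OF q q0] Comp_in[OF v(1) v'(1)] Id_in[OF H] by auto
  then show ?thesis using v(1) v'(1) vv' unfolding isomorphic_def by blast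
qed

section \<open>Small products\<close>

lemma small_subset: "small U B \<Longrightarrow> A \<subseteq> B \<Longrightarrow> small U A"
  unfolding small_def by (meson inj_on_subset)

lemma small_inj: "small U B \<Longrightarrow> inj_on f A \<Longrightarrow> f ` A \<subseteq> B \<Longrightarrow> small U A"
  unfolding small_def by (meson comp_inj_on inj_on_subset)

text \<open>An infinite type is equipotent with its square.\<close>

lemma small_Times:
  assumes "infinite (UNIV :: 'u set)" "small TYPE('u) A" "small TYPE('u) B"
  shows "small TYPE('u) (A \<times> B)"
proof -
  obtain e1 :: "_ \<Rightarrow> 'u" and e2 :: "_ \<Rightarrow> 'u" where e: "inj_on e1 A" "inj_on e2 B"
    using assms by (auto simp: small_def)
  have "|UNIV \<times> UNIV :: ('u \<times> 'u) set| =o |UNIV :: 'u set|"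
    using card_of_Times_same_infinite[OF assms(1)] by simp
  then obtain h :: "'u \<times> 'u \<Rightarrow> 'u" where "bij_betw h (UNIV \<times> UNIV) UNIV"
    using card_of_ordIso[of "UNIV :: ('u \<times> 'u) set" "UNIV :: 'u set"] by auto
  then have "inj h" by (simp add: bij_betw_def)
  then have "inj_on (\<lambda>(a, b). h (e1 a, e2 b)) (A \<times> B)"
    by (auto intro!: inj_onI dest!: injD[OF \<open>inj h\<close>] inj_onD[OF e(1)] inj_onD[OF e(2)])
  then show ?thesis unfolding small_def by blast
qed

lemma small_lists:
  assumes "infinite (UNIV :: 'u set)" "small TYPE('u) A"
  shows "small TYPE('u) {xs. length xs = n \<and> set xs \<subseteq> A}"
proof (induction n)
  case 0
  then show ?case by (auto simp: small_def inj_on_def)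
next
  case (Suc n)
  show ?case
  proof (rule small_inj[OF small_Times[OF assms Suc], of "\<lambda>xs. (hd xs, tl xs)"])
    show "inj_on (\<lambda>xs. (hd xs, tl xs)) {xs. length xs = Suc n \<and> set xs \<subseteq> A}"
      by (rule inj_onI, rule list.expand) auto
  qed (auto simp: length_Suc_conv)
qed

lemma small_finite: "infinite (UNIV :: 'u set) \<Longrightarrow> finite A \<Longrightarrow> small TYPE('u) A"
  unfolding small_def using infinite_arbitrarily_large[of "UNIV :: 'u set" "card A"]
  by (metis finite_same_card_bij bij_betw_imp_inj_on)

text \<open>\<open>AB3_star\<close> concerns index sets inside the type \<open>'u\<close>. An
  injection of \<open>I\<close> into \<open>'u\<close> transports a product to \<open>I\<close>, and
  the choice in \<open>prod_ob\<close> and \<open>prod_pr\<close> then selects a product.\<close>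

lemma is_product_prod_ob:
  assumes "AB3_star TYPE('u) A" "small TYPE('u) I" "\<And>i. i \<in> I \<Longrightarrow> X i \<in> Obj A"
  shows "is_product A I X (prod_ob A I X) (prod_pr A I X)"
proof -
  obtain e :: "_ \<Rightarrow> 'u" where e: "inj_on e I" using assms(2) by (auto simp: small_def)
  obtain P p where p: "is_product A (e ` I) (\<lambda>j. X (inv_into I e j)) P p"
    using assms(1)[unfolded AB3_star_def, rule_format, of "e ` I" "\<lambda>j. X (inv_into I e j)"]
      assms(3) inv_into_into[of _ e I] by blast
  have "is_product A I X P (p \<circ> e)"
    unfolding is_product_def
  proof (intro conjI ballI allI impI)
    show "P \<in> Obj A" using p by (simp add: is_product_def)
    show "(p \<circ> e) i \<in> Hom A P (X i)" if "i \<in> I" for i using p e that by (force simp: is_product_def)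
    fix W h assume W: "W \<in> Obj A" and h: "\<forall>i\<in>I. h i \<in> Hom A W (X i)"
    have "\<forall>j\<in>e ` I. (\<lambda>j. h (inv_into I e j)) j \<in> Hom A W (X (inv_into I e j))" using h e by auto
    from p[unfolded is_product_def, THEN conjunct2, THEN conjunct2, rule_format, OF W this[rule_format]]
    have "\<exists>!u. u \<in> Hom A W P \<and> (\<forall>j\<in>e ` I. p j \<cdot>\<^bsub>A\<^esub> u = h (inv_into I e j))" .
    then show "\<exists>!u. u \<in> Hom A W P \<and> (\<forall>i\<in>I. (p \<circ> e) i \<cdot>\<^bsub>A\<^esub> u = h i)" using e by simp
  qed
  then have "\<exists>Pp. case Pp of (P, p) \<Rightarrow> is_product A I X P p" by auto
  from someI_ex[OF this] show ?thesis
    unfolding prod_ob_def prod_pr_def chosen_product_def by (simp only: split_def)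
qed

lemma is_product_unique:
  assumes "is_product A I X P p" "category A" "u \<in> Hom A W P" "v \<in> Hom A W P"
    "\<And>i. i \<in> I \<Longrightarrow> p i \<cdot>\<^bsub>A\<^esub> u = p i \<cdot>\<^bsub>A\<^esub> v"
  shows "u = v"
proof -
  interpret category A by fact
  have "W \<in> Obj A" using assms(3) Dom_in by (auto simp: Hom_def)
  moreover have "\<forall>i\<in>I. p i \<cdot>\<^bsub>A\<^esub> u \<in> Hom A W (X i)" using assms(1,3) Comp_in by (auto simp: is_product_def)
  ultimately have "\<exists>!t. t \<in> Hom A W P \<and> (\<forall>i\<in>I. p i \<cdot>\<^bsub>A\<^esub> t = p i \<cdot>\<^bsub>A\<^esub> u)"
    using assms(1)[unfolded is_product_def, THEN conjunct2, THEN conjunct2, rule_format, of W "\<lambda>i. p i \<cdot>\<^bsub>A\<^esub> u"] by simp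
  moreover have "u \<in> Hom A W P \<and> (\<forall>i\<in>I. p i \<cdot>\<^bsub>A\<^esub> u = p i \<cdot>\<^bsub>A\<^esub> u)" using assms(3) by simp
  moreover have "v \<in> Hom A W P \<and> (\<forall>i\<in>I. p i \<cdot>\<^bsub>A\<^esub> v = p i \<cdot>\<^bsub>A\<^esub> u)" using assms(4) assms(5)[symmetric] by blast
  ultimately show ?thesis by (elim ex1E) blast
qed

lemma prod_lift:
  assumes "is_product A I X (prod_ob A I X) (prod_pr A I X)" "W \<in> Obj A" "\<And>i. i \<in> I \<Longrightarrow> h i \<in> Hom A W (X i)"
  shows "prod_lift A I X W h \<in> Hom A W (prod_ob A I X)"
    "i \<in> I \<Longrightarrow> prod_pr A I X i \<cdot>\<^bsub>A\<^esub> prod_lift A I X W h = h i"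
proof -
  have "\<exists>!u. u \<in> Hom A W (prod_ob A I X) \<and> (\<forall>i\<in>I. prod_pr A I X i \<cdot>\<^bsub>A\<^esub> u = h i)"
    using assms(1)[unfolded is_product_def, THEN conjunct2, THEN conjunct2, rule_format, of W h] assms(2,3) by simp
  from theI'[OF this] show "prod_lift A I X W h \<in> Hom A W (prod_ob A I X)"
    "i \<in> I \<Longrightarrow> prod_pr A I X i \<cdot>\<^bsub>A\<^esub> prod_lift A I X W h = h i"
    unfolding prod_lift_def by auto
qed

section \<open>Diagrams indexed by ordered sets\<close>

text \<open>A functor on the ordered type \<open>'v\<close>, with \<open>ar x y\<close> constrained
  only for \<open>x \<le> y\<close>. The index poset is a whole type, so \<open>[n]\<close> and the
  finite cubes are represented by \<open>nat\<close> and by coordinate sequences, with diagrams that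
  ignore whatever lies beyond the finite part.\<close>

definition diagram :: "('o, 'm, 'z) precat_scheme \<Rightarrow> ('v::order \<Rightarrow> 'o) \<Rightarrow> ('v \<Rightarrow> 'v \<Rightarrow> 'm) \<Rightarrow> bool" where
  "diagram C ob ar \<longleftrightarrow> (\<forall>x. ob x \<in> Obj C \<and> ar x x = Id C (ob x)) \<and>
     (\<forall>x y. x \<le> y \<longrightarrow> ar x y \<in> Hom C (ob x) (ob y)) \<and>
     (\<forall>x y z. x \<le> y \<longrightarrow> y \<le> z \<longrightarrow> ar y z \<cdot>\<^bsub>C\<^esub> ar x y = ar x z)"

lemma diagramD:
  assumes "diagram C ob ar"
  shows "ob x \<in> Obj C" "ar x x = Id C (ob x)" "x \<le> y \<Longrightarrow> ar x y \<in> Hom C (ob x) (ob y)"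
    "x \<le> y \<Longrightarrow> y \<le> z \<Longrightarrow> ar y z \<cdot>\<^bsub>C\<^esub> ar x y = ar x z"
  using assms by (auto simp: diagram_def)

fun arrows :: "('v \<Rightarrow> 'v \<Rightarrow> 'm) \<Rightarrow> 'v list \<Rightarrow> 'm list" where
  "arrows ar (a # b # v) = ar a b # arrows ar (b # v)"
| "arrows ar v = []"

lemma length_arrows [simp]: "length (arrows ar v) = length v - 1"
  by (induction ar v rule: arrows.induct) auto

lemma nth_arrows: "Suc i < length v \<Longrightarrow> arrows ar v ! i = ar (v ! i) (v ! Suc i)"
  by (induction ar v arbitrary: i rule: arrows.induct) (auto simp: nth_Cons split: nat.splits)

lemma drop_arrows: "drop i (arrows ar v) = arrows ar (drop i v)"
  by (induction ar v arbitrary: i rule: arrows.induct) (auto simp: drop_Cons split: nat.splits)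

lemma take_arrows: "take i (arrows ar v) = arrows ar (take (Suc i) v)"
proof (induction ar v arbitrary: i rule: arrows.induct)
  case (1 ar a b v)
  then show ?case by (cases i) auto
qed auto

lemma arrows_cong:
  "sorted_wrt (\<le>) v \<Longrightarrow> (\<And>x y. (x :: 'v :: order) \<le> y \<Longrightarrow> ar x y = ar' (f x) (f y)) \<Longrightarrow> arrows ar v = arrows ar' (map f v)"
  by (induction ar v rule: arrows.induct) auto

fun path_end :: "('o, 'm, 'z) precat_scheme \<Rightarrow> 'o \<Rightarrow> 'm list \<Rightarrow> 'o" where
  "path_end C c [] = c"
| "path_end C c (\<alpha> # \<alpha>s) = path_end C (Cod C \<alpha>) \<alpha>s"

definition chain_of :: "('v \<Rightarrow> 'o) \<Rightarrow> ('v \<Rightarrow> 'v \<Rightarrow> 'm) \<Rightarrow> 'v list \<Rightarrow> 'o \<times> 'm list" where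
  "chain_of ob ar v = (ob (hd v), arrows ar v)"

text \<open>A chain as a diagram indexed by the natural numbers, constant from its length on.\<close>

definition chain_ob :: "('o, 'm, 'z) precat_scheme \<Rightarrow> 'o \<times> 'm list \<Rightarrow> nat \<Rightarrow> 'o" where
  "chain_ob C s i = path_end C (fst s) (take i (snd s))"

definition chain_ar :: "('o, 'm, 'z) precat_scheme \<Rightarrow> 'o \<times> 'm list \<Rightarrow> nat \<Rightarrow> nat \<Rightarrow> 'm" where
  "chain_ar C s i j = path_comp C (chain_ob C s i) (take (j - i) (drop i (snd s)))"

text \<open>Padding with zeros embeds the vertices of all finite cubes into one poset of sequences;
  \<open>corner n\<close> is the top vertex of the \<open>n\<close>-cube there.\<close>

definition coords :: "bool list \<Rightarrow> nat \<Rightarrow> bool" where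
  "coords x = (\<lambda>j. j < length x \<and> x ! j)"

definition corner :: "nat \<Rightarrow> nat \<Rightarrow> bool" where
  "corner n = (\<lambda>j. j < n)"

definition cube_of :: "nat \<Rightarrow> ('v \<Rightarrow> 'o) \<Rightarrow> ('v \<Rightarrow> 'v \<Rightarrow> 'm) \<Rightarrow> 'v cube \<Rightarrow> ('o, 'm) cube_ftor" where
  "cube_of m ob ar \<theta> = \<lparr>Fo = (\<lambda>x \<in> vertices m. ob (\<theta> (coords x))),
     Fa = restrict (\<lambda>(x, y). ar (\<theta> (coords x)) (\<theta> (coords y))) (Arr (cube_poset m))\<rparr>"

text \<open>A cube of \<open>C\<close> regarded as a diagram on coordinate sequences. By
  \<open>cube_of_cube\<close> it is the universal cube read in its own diagram.\<close>

definition cube_ob :: "nat \<Rightarrow> ('o, 'm) cube_ftor \<Rightarrow> (nat \<Rightarrow> bool) \<Rightarrow> 'o" where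
  "cube_ob n g x = Fo g (map x [0..<n])"

definition cube_ar :: "nat \<Rightarrow> ('o, 'm) cube_ftor \<Rightarrow> (nat \<Rightarrow> bool) \<Rightarrow> (nat \<Rightarrow> bool) \<Rightarrow> 'm" where
  "cube_ar n g x y = Fa g (map x [0..<n], map y [0..<n])"

lemma coords_map [simp]: "coords (map x [0..<n]) = truncate n x"
  by (auto simp: coords_def truncate_def)

lemma coords_bot_top [simp]: "coords (bot_vertex n) = origin" "coords (top_vertex n) = corner n"
  by (auto simp: coords_def bot_vertex_def top_vertex_def corner_def)

lemma map_coords: "x \<in> vertices n \<Longrightarrow> map (truncate n (coords x)) [0..<n] = x"
  by (auto simp: vertices_def coords_def truncate_def intro!: nth_equalityI)

lemma map_in_poset: "x \<le> y \<Longrightarrow> (map x [0..<n], map y [0..<n]) \<in> Arr (cube_poset n)"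
  by (auto simp: cube_poset_def vertices_def list_all2_conv_all_nth le_fun_def)

lemma coords_mono: "(x, y) \<in> Arr (cube_poset n) \<Longrightarrow> coords x \<le> coords y"
  by (auto simp: cube_poset_def vertices_def list_all2_conv_all_nth le_fun_def coords_def)

lemma truncate_in: "truncate n \<in> cubes_in n origin (corner n)"
  by (auto simp: cubes_in_def mono_def truncate_def corner_def depends_def le_fun_def fun_eq_iff)

lemma upt_in: "[0..<Suc n] \<in> simplices_in n 0 n"
  by (auto simp: simplices_in_def sorted_wrt_upt simp del: upt_Suc)

lemma diag_cube_of: "diag n (cube_of n ob ar \<theta>) = ar (\<theta> origin) (\<theta> (corner n))"
  by (simp add: diag_def cube_of_def bot_vertex_le)

lemma diag_eq: "diag n g = cube_ar n g origin (corner n)"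
proof -
  have "map origin [0..<n] = bot_vertex n" by (simp add: bot_vertex_def map_replicate_const)
  moreover have "map (corner n) [0..<n] = top_vertex n"
    by (auto simp: top_vertex_def corner_def intro!: nth_equalityI)
  ultimately show ?thesis by (simp add: diag_def cube_ar_def)
qed

lemma cube_of_cube: "g \<in> functors (cube_poset n) C \<Longrightarrow> cube_of n (cube_ob n g) (cube_ar n g) (truncate n) = g"
  by (cases g) (auto simp: cube_of_def cube_ob_def cube_ar_def functors_def extensional_def fun_eq_iff
      map_coords cube_poset_def)

text \<open>The diagram of the cube picked out by \<open>\<theta>\<close> is the given one
  restricted along \<open>\<theta>\<close>; this is the input for the naturality of
  evaluation.\<close>

lemma cube_ob_cube_of:
  assumes "depends n \<theta>"
  shows "cube_ob n (cube_of n ob ar \<theta>) x = ob (\<theta> x)"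
    and "x \<le> y \<Longrightarrow> cube_ar n (cube_of n ob ar \<theta>) x y = ar (\<theta> x) (\<theta> y)"
proof -
  have t: "\<theta> (truncate n x) = \<theta> x" for x using assms by (metis comp_apply depends_def)
  show "cube_ob n (cube_of n ob ar \<theta>) x = ob (\<theta> x)"
    by (simp add: cube_ob_def cube_of_def vertices_def t)
  show "x \<le> y \<Longrightarrow> cube_ar n (cube_of n ob ar \<theta>) x y = ar (\<theta> x) (\<theta> y)"
    using map_in_poset[of x y n] by (simp add: cube_ar_def cube_of_def t)
qed

section \<open>Chains and cubes of a category as diagrams\<close>

context category
begin

lemma path_end_append: "path_end C c (xs @ ys) = path_end C (path_end C c xs) ys"
  by (induction xs arbitrary: c) auto

lemma is_path_append: "is_path C c (xs @ ys) \<longleftrightarrow> is_path C c xs \<and> is_path C (path_end C c xs) ys"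
proof (induction xs arbitrary: c)
  case Nil
  have "is_path C c ys \<Longrightarrow> c \<in> Obj C" by (cases ys) (auto simp: Dom_in)
  then show ?case by auto
qed auto

lemma path_comp_in: "is_path C c xs \<Longrightarrow> path_comp C c xs \<in> Hom C c (path_end C c xs)"
proof (induction xs arbitrary: c)
  case Nil
  then show ?case by (simp add: Id_in)
next
  case (Cons a xs)
  then show ?case using Comp_in[of a c "Cod C a"] by (auto simp: Hom_def)
qed

lemma path_comp_append:
  "is_path C c (xs @ ys) \<Longrightarrow> path_comp C c (xs @ ys) = path_comp C (path_end C c xs) ys \<cdot> path_comp C c xs"
proof (induction xs arbitrary: c)
  case Nil
  then show ?case using path_comp_in[OF Nil] Comp_Id by simp
next
  case (Cons a xs)
  then have "a \<in> Hom C c (Cod C a)" "is_path C (Cod C a) (xs @ ys)" by (auto simp: Hom_def)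
  then show ?case using Cons Comp_assoc[of a c "Cod C a"] path_comp_in[of "Cod C a" xs]
    path_comp_in[of "path_end C (Cod C a) xs" ys] by (auto simp: is_path_append)
qed

text \<open>Segments of the list of arrows concatenate, so their composites compose; past the end of
  the list the segments are empty.\<close>

lemma diagram_chain:
  assumes "s \<in> chains C n" shows "diagram C (chain_ob C s) (chain_ar C s)"
proof -
  obtain c \<alpha>s where s: "s = (c, \<alpha>s)" "is_path C c \<alpha>s" using assms by (auto simp: chains_def)
  have split: "take y \<alpha>s = take x \<alpha>s @ take (y - x) (drop x \<alpha>s)" if "x \<le> y" for x y
    using take_add[of x "y - x" \<alpha>s] that by simp
  have take: "is_path C c (take y \<alpha>s)" for y
    using s(2) is_path_append[of c "take y \<alpha>s" "drop y \<alpha>s"] by simp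
  have part: "is_path C (chain_ob C s x) (take (y - x) (drop x \<alpha>s))"
     "path_end C (chain_ob C s x) (take (y - x) (drop x \<alpha>s)) = chain_ob C s y" if "x \<le> y" for x y
    using take[of y] is_path_append[of c "take x \<alpha>s" "take (y - x) (drop x \<alpha>s)"]
      path_end_append[of c "take x \<alpha>s" "take (y - x) (drop x \<alpha>s)"] split[OF that]
    by (simp_all add: s chain_ob_def)
  show ?thesis unfolding diagram_def
  proof (intro conjI allI impI)
    show "chain_ob C s x \<in> Obj C" for x using part(1)[of x x] by simp
    show "chain_ar C s x x = Id C (chain_ob C s x)" for x by (simp add: chain_ar_def)
    show "chain_ar C s x y \<in> Hom C (chain_ob C s x) (chain_ob C s y)" if "x \<le> y" for x y
      using path_comp_in[OF part(1)[OF that]] part(2)[OF that] by (simp add: chain_ar_def s)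
    show "chain_ar C s y z \<cdot> chain_ar C s x y = chain_ar C s x z" if "x \<le> y" "y \<le> z" for x y z
    proof -
      have "take (z - x) (drop x \<alpha>s) = take (y - x) (drop x \<alpha>s) @ take (z - y) (drop y \<alpha>s)"
        using take_add[of "y - x" "z - y" "drop x \<alpha>s"] that by simp
      then show ?thesis
        using path_comp_append[of "chain_ob C s x" "take (y - x) (drop x \<alpha>s)" "take (z - y) (drop y \<alpha>s)"]
         part(1)[of x z] part(2)[of x y] that by (simp add: chain_ar_def s)
    qed
  qed
qed

lemma chain_ar_full: "length \<alpha>s = n \<Longrightarrow> chain_ar C (c, \<alpha>s) 0 n = path_comp C c \<alpha>s"
  by (simp add: chain_ar_def chain_ob_def)

text \<open>Every chain is the universal simplex read in its own diagram.\<close>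

lemma chain_of_chain:
  assumes "s \<in> chains C n" shows "chain_of (chain_ob C s) (chain_ar C s) [0..<Suc n] = s"
proof -
  obtain c \<alpha>s where s: "s = (c, \<alpha>s)" "is_path C c \<alpha>s" "length \<alpha>s = n" using assms by (auto simp: chains_def)
  have "chain_ar C s i (Suc i) = \<alpha>s ! i" if "i < n" for i
  proof -
    have "is_path C (path_end C c (take i \<alpha>s)) (drop i \<alpha>s)"
      using s(2) is_path_append[of c "take i \<alpha>s" "drop i \<alpha>s"] by simp
    then have "\<alpha>s ! i \<in> Arr C" using that s(3) by (metis Cons_nth_drop_Suc is_path.simps(2))
    then show ?thesis using that s(3) Id_Comp[of "\<alpha>s ! i" "Dom C (\<alpha>s ! i)" "Cod C (\<alpha>s ! i)"]
      by (simp add: chain_ar_def s(1) take_Suc hd_drop_conv_nth Hom_def)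
  qed
  then have "arrows (chain_ar C s) [0..<Suc n] = \<alpha>s"
    using s(3) by (auto intro!: nth_equalityI simp: nth_arrows simp del: upt_Suc)
  then show ?thesis by (simp add: chain_of_def chain_ob_def s(1) hd_upt del: upt_Suc)
qed

context
  fixes ob :: "'v::order \<Rightarrow> 'o" and ar :: "'v \<Rightarrow> 'v \<Rightarrow> 'm"
  assumes D: "diagram C ob ar"
begin

lemma is_path_arrows:
  "sorted_wrt (\<le>) (a # v) \<Longrightarrow> is_path C (ob a) (arrows ar (a # v)) \<and>
     path_end C (ob a) (arrows ar (a # v)) = ob (last (a # v)) \<and>
     path_comp C (ob a) (arrows ar (a # v)) = ar a (last (a # v))"
proof (induction v arbitrary: a)
  case Nil
  then show ?case using diagramD[OF D] by auto
next
  case (Cons b v)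
  then have "a \<le> b" "b \<le> last (b # v)" using last_in_set[of "b # v"] by auto
  then show ?case using Cons diagramD(3)[OF D \<open>a \<le> b\<close>] diagramD(4)[OF D, of a b "last (b # v)"]
    by (auto simp: Hom_def)
qed

lemma chain_of_in: "v \<in> simplices_in n p q \<Longrightarrow> chain_of ob ar v \<in> chains C n"
  using is_path_arrows[of "hd v" "tl v"] by (cases v) (auto simp: simplices_in_def chain_of_def chains_def)

lemma path_comp_chain_of:
  "v \<in> simplices_in n p q \<Longrightarrow> path_comp C (fst (chain_of ob ar v)) (snd (chain_of ob ar v)) = ar (hd v) (last v)"
  using is_path_arrows[of "hd v" "tl v"] by (cases v) (auto simp: simplices_in_def chain_of_def)

text \<open>The counterpart of \<open>cube_ob_cube_of\<close> for simplices. The minimum with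
  \<open>n\<close> appears because the diagram of a chain is constant from its length on.\<close>

lemma chain_ob_chain_of:
  assumes "v \<in> simplices_in n p q"
  shows "chain_ob C (chain_of ob ar v) i = ob (v ! min i n)"
    and "i \<le> j \<Longrightarrow> chain_ar C (chain_of ob ar v) i j = ar (v ! min i n) (v ! min j n)"
proof -
  have v: "length v = Suc n" "sorted_wrt (\<le>) v" using assms by (auto simp: simplices_in_def)
  have sub: "path_end C (ob (w ! 0)) (arrows ar w) = ob (last w) \<and> path_comp C (ob (w ! 0)) (arrows ar w) = ar (w ! 0) (last w)"
    if "sorted_wrt (\<le>) w" "w \<noteq> []" for w using is_path_arrows[of "hd w" "tl w"] that by (cases w) auto
  have hd: "hd v = v ! 0" "v \<noteq> []" using v by (cases v; auto)+
  show ob: "chain_ob C (chain_of ob ar v) i = ob (v ! min i n)" for i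
    using sub[of "take (Suc i) v"] v
    by (auto simp: chain_ob_def chain_of_def take_arrows sorted_wrt_take last_conv_nth hd min_def)
  show "chain_ar C (chain_of ob ar v) i j = ar (v ! min i n) (v ! min j n)" if "i \<le> j"
  proof (cases "i \<le> n")
    case True
    let ?w = "take (Suc (j - i)) (drop i v)"
    have "j \<le> n \<Longrightarrow> Suc n - i \<le> Suc (j - i) \<Longrightarrow> n = j" using that True by linarith
    then have "?w \<noteq> []" "sorted_wrt (\<le>) ?w" "?w ! 0 = v ! i" "last ?w = v ! min j n"
      using True v that by (auto simp: sorted_wrt_take sorted_wrt_drop last_conv_nth min_def)
    then show ?thesis using sub[of ?w] True
      by (simp add: chain_ar_def ob) (simp add: chain_of_def take_arrows drop_arrows)
  next
    case False
    then show ?thesis using v that diagramD(2)[OF D]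
      by (simp add: chain_ar_def ob) (simp add: chain_of_def)
  qed
qed

lemma cube_of_in: "mono \<theta> \<Longrightarrow> cube_of m ob ar \<theta> \<in> functors (cube_poset m) C"
proof -
  assume \<theta>: "mono \<theta>"
  note m = monoD[OF \<theta> coords_mono]
  have m2: "x \<in> vertices m \<Longrightarrow> (x, x) \<in> Arr (cube_poset m)" for x
    by (auto simp: cube_poset_def list_all2_refl)
  have m3: "(x, y) \<in> Arr (cube_poset m) \<Longrightarrow> (y, z) \<in> Arr (cube_poset m) \<Longrightarrow> (x, z) \<in> Arr (cube_poset m)" for x y z
    by (auto simp: cube_poset_def list_all2_conv_all_nth)
  have "cat_functor (cube_poset m) C (cube_of m ob ar \<theta>)"
  proof (intro cat_functor.intro category_cube_poset category_axioms cat_functor_axioms.intro)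
    fix x y z f g
    { assume "x \<in> Obj (cube_poset m)"
      then show "Fo (cube_of m ob ar \<theta>) x \<in> Obj C" using diagramD[OF D] by (auto simp: cube_of_def cube_poset_def) }
    { assume "f \<in> Hom (cube_poset m) x y"
      then have "(x, y) \<in> Arr (cube_poset m)" "f = (x, y)" "x \<in> vertices m" "y \<in> vertices m"
        by (auto simp: Hom_def cube_poset_def)
      then show "Fa (cube_of m ob ar \<theta>) f \<in> Hom C (Fo (cube_of m ob ar \<theta>) x) (Fo (cube_of m ob ar \<theta>) y)"
        using diagramD(3)[OF D m] by (auto simp: cube_of_def) }
    { assume "x \<in> Obj (cube_poset m)"
      then have "x \<in> vertices m" "Id (cube_poset m) x = (x, x)" by (auto simp: cube_poset_def)
      then show "Fa (cube_of m ob ar \<theta>) (Id (cube_poset m) x) = Id C (Fo (cube_of m ob ar \<theta>) x)"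
        using diagramD(2)[OF D] m2 by (auto simp: cube_of_def) }
    { assume "f \<in> Hom (cube_poset m) x y" "g \<in> Hom (cube_poset m) y z"
      then have "(x, y) \<in> Arr (cube_poset m)" "(y, z) \<in> Arr (cube_poset m)" "f = (x, y)" "g = (y, z)"
        "g \<cdot>\<^bsub>cube_poset m\<^esub> f = (x, z)"
        by (auto simp: Hom_def cube_poset_def)
      then show "Fa (cube_of m ob ar \<theta>) (g \<cdot>\<^bsub>cube_poset m\<^esub> f) = Fa (cube_of m ob ar \<theta>) g \<cdot> Fa (cube_of m ob ar \<theta>) f"
        using diagramD(4)[OF D m[of x y m] m[of y z m]] m3[of x y z] by (simp add: cube_of_def) }
  qed
  then show ?thesis by (auto simp: functors_def cube_of_def cube_poset_def)
qed

end

lemma diagram_cube: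
  assumes "g \<in> functors (cube_poset n) C" shows "diagram C (cube_ob n g) (cube_ar n g)"
proof -
  have "Fo g x \<in> Obj C" if "x \<in> vertices n" for x
    using assms cat_functor.Fo_in[of "cube_poset n" C g x] that by (auto simp: functors_def cube_poset_def)
  then show ?thesis
    using cube_functor_in[OF assms map_in_poset] cube_functor_id[OF assms] cube_functor_comp[OF assms map_in_poset map_in_poset]
    by (auto simp: diagram_def cube_ob_def cube_ar_def vertices_def)
qed

end

section \<open>Evaluation of cochains\<close>

locale coefficients = Cat: category C + A: preadditive_category A + cat_functor "fact_cat C" A G
  for C :: "('o, 'm, 'y) precat_scheme" and A :: "('p, 'q, 'z) addcat_scheme"
    and G :: "('m, 'm \<times> 'm \<times> 'm \<times> 'm, 'p, 'q) ftor" +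
  fixes W :: 'p
  assumes W: "W \<in> Obj A"
begin

abbreviation comp_A (infixl "\<bullet>" 70) where "g \<bullet> f \<equiv> g \<cdot>\<^bsub>A\<^esub> f"
abbreviation add_A (infixl "\<oplus>\<^sub>A" 65) where "f \<oplus>\<^sub>A g \<equiv> f \<^bold>+\<^bsub>A\<^esub> g"
abbreviation "cubes n \<equiv> functors (cube_poset n) C"
abbreviation "chain_comp s \<equiv> path_comp C (fst s) (snd s)"

abbreviation M :: "'m \<Rightarrow> 'q monoid" where
  "M \<alpha> \<equiv> hom_group A W (Fo G \<alpha>)"

text \<open>In a diagram, \<open>push ar lo hi p q\<close> moves coefficients along \<open>p \<le> lo \<le> hi \<le> q\<close>. Evaluating
  cochains in a fixed interval \<open>[p, q]\<close> puts all values into the one group \<open>M (ar p q)\<close>.\<close>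

definition push :: "('v \<Rightarrow> 'v \<Rightarrow> 'm) \<Rightarrow> 'v \<Rightarrow> 'v \<Rightarrow> 'v \<Rightarrow> 'v \<Rightarrow> 'q" where
  "push ar lo hi p q = Fa G (ar lo hi, ar p q, (ar p lo, ar hi q))"

lemma Fo_G: "\<alpha> \<in> Arr C \<Longrightarrow> Fo G \<alpha> \<in> Obj A"
  using Fo_in by (simp add: fact_cat_def)

lemma M_group: "\<alpha> \<in> Arr C \<Longrightarrow> comm_group (M \<alpha>)"
  using A.hom_group[OF W] Fo_G by auto

text \<open>By the universal property of the product such a family is a morphism from
  \<open>W\<close> to the product. The computations are done on families and transferred by
  \<open>rep_simplex\<close> and \<open>rep_cube\<close>; values off the chains are
  arbitrary.\<close>

definition simplex_cochains :: "nat \<Rightarrow> ('o \<times> 'm list \<Rightarrow> 'q) set" where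
  "simplex_cochains n = {\<phi>. \<forall>s \<in> chains C n. \<phi> s \<in> Hom A W (Fo G (chain_comp s))}"

definition cube_cochains :: "nat \<Rightarrow> (('o, 'm) cube_ftor \<Rightarrow> 'q) set" where
  "cube_cochains n = {\<psi>. \<forall>g \<in> cubes n. \<psi> g \<in> Hom A W (Fo G (diag n g))}"

definition eval_simplex ::
    "('v \<Rightarrow> 'o) \<Rightarrow> ('v \<Rightarrow> 'v \<Rightarrow> 'm) \<Rightarrow> 'v \<Rightarrow> 'v \<Rightarrow> ('o \<times> 'm list \<Rightarrow> 'q) \<Rightarrow> 'v list \<Rightarrow> 'q" where
  "eval_simplex ob ar p q \<phi> v = push ar (hd v) (last v) p q \<bullet> \<phi> (chain_of ob ar v)"

definition eval_cube ::
    "('v \<Rightarrow> 'o) \<Rightarrow> ('v \<Rightarrow> 'v \<Rightarrow> 'm) \<Rightarrow> 'v \<Rightarrow> 'v \<Rightarrow> nat \<Rightarrow> (('o, 'm) cube_ftor \<Rightarrow> 'q) \<Rightarrow> 'v cube \<Rightarrow> 'q" where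
  "eval_cube ob ar p q m \<psi> \<theta> = push ar (\<theta> origin) (\<theta> (corner m)) p q \<bullet> \<psi> (cube_of m ob ar \<theta>)"

definition eval_simplices ::
    "('v \<Rightarrow> 'o) \<Rightarrow> ('v \<Rightarrow> 'v \<Rightarrow> 'm) \<Rightarrow> 'v \<Rightarrow> 'v \<Rightarrow> ('o \<times> 'm list \<Rightarrow> 'q) \<Rightarrow> ('v list \<Rightarrow>\<^sub>0 int) \<Rightarrow> 'q" where
  "eval_simplices ob ar p q \<phi> c = lin (M (ar p q)) (eval_simplex ob ar p q \<phi>) c"

definition eval_cubes ::
    "('v \<Rightarrow> 'o) \<Rightarrow> ('v \<Rightarrow> 'v \<Rightarrow> 'm) \<Rightarrow> 'v \<Rightarrow> 'v \<Rightarrow> nat \<Rightarrow> (('o, 'm) cube_ftor \<Rightarrow> 'q) \<Rightarrow> ('v cube \<Rightarrow>\<^sub>0 int) \<Rightarrow> 'q" where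
  "eval_cubes ob ar p q m \<psi> c = lin (M (ar p q)) (eval_cube ob ar p q m \<psi>) c"

context
  fixes ob :: "'v::order \<Rightarrow> 'o" and ar :: "'v \<Rightarrow> 'v \<Rightarrow> 'm"
  assumes D: "diagram C ob ar"
begin

lemma ar_Arr: "p \<le> q \<Longrightarrow> ar p q \<in> Arr C" 
  using diagramD(3)[OF D] by (auto simp: Hom_def)

text \<open>In the diagram \<open>ar p q\<close> is the composite of \<open>ar p lo\<close>,
  \<open>ar lo hi\<close> and \<open>ar hi q\<close>.\<close>

lemma push_arrow:
  assumes "p \<le> lo" "lo \<le> hi" "hi \<le> q"
  shows "(ar lo hi, ar p q, (ar p lo, ar hi q)) \<in> Hom (fact_cat C) (ar lo hi) (ar p q)"
  using diagramD(3)[OF D assms(1)] diagramD(3)[OF D assms(2)] diagramD(3)[OF D assms(3)]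
    diagramD(3)[OF D, of p q] diagramD(4)[OF D, of p lo q] diagramD(4)[OF D, of lo hi q] assms
  by (auto simp: Hom_def fact_cat_def)

lemma push_in:
  "p \<le> lo \<Longrightarrow> lo \<le> hi \<Longrightarrow> hi \<le> q \<Longrightarrow> push ar lo hi p q \<in> Hom A (Fo G (ar lo hi)) (Fo G (ar p q))"
  unfolding push_def using Fa_in push_arrow by blast

lemma push_id: "p \<le> q \<Longrightarrow> push ar p q p q = Id A (Fo G (ar p q))"
  using Fa_Id[of "ar p q"] ar_Arr[of p q] diagramD(2,3)[OF D, of p] diagramD(2)[OF D, of q] diagramD(3)[OF D, of p q]
  by (simp add: push_def fact_cat_def Hom_def)

lemma push_push:
  assumes "p \<le> p'" "p' \<le> lo" "lo \<le> hi" "hi \<le> q'" "q' \<le> q"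
  shows "push ar p' q' p q \<bullet> push ar lo hi p' q' = push ar lo hi p q"
proof -
  have "p' \<le> q'" using assms by auto
  then have "push ar p' q' p q \<bullet> push ar lo hi p' q' = Fa G ((ar p' q', ar p q, (ar p p', ar q' q)) \<cdot>\<^bsub>fact_cat C\<^esub>
     (ar lo hi, ar p' q', (ar p' lo, ar hi q')))"
    unfolding push_def using Fa_Comp[OF push_arrow[of p' lo hi q'] push_arrow[of p p' q' q]] assms by simp
  also have "\<dots> = push ar lo hi p q"
    using diagramD(4)[OF D, of p p' lo] diagramD(4)[OF D, of hi q' q] assms by (simp add: push_def fact_cat_def)
  finally show ?thesis .
qed

lemma simplex_bounds: "v \<in> simplices_in m p q \<Longrightarrow> p \<le> hd v \<and> hd v \<le> last v \<and> last v \<le> q"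
  using last_in_set[of v] by (cases v) (auto simp: simplices_in_def)

lemma cube_bounds:
  "\<theta> \<in> cubes_in m p q \<Longrightarrow> p \<le> \<theta> origin \<and> \<theta> origin \<le> \<theta> (corner m) \<and> \<theta> (corner m) \<le> q"
  by (auto simp: cubes_in_def mono_def le_fun_def)

lemma simplex_value_in: "\<phi> \<in> simplex_cochains m \<Longrightarrow> v \<in> simplices_in m p q \<Longrightarrow>
   \<phi> (chain_of ob ar v) \<in> Hom A W (Fo G (ar (hd v) (last v)))"
  using  Cat.path_comp_chain_of[OF D, of v m p q] Cat.chain_of_in[OF D, of v m p q] unfolding simplex_cochains_def by force

lemma cube_value_in: "\<psi> \<in> cube_cochains m \<Longrightarrow> \<theta> \<in> cubes_in m p q \<Longrightarrow>
   \<psi> (cube_of m ob ar \<theta>) \<in> Hom A W (Fo G (ar (\<theta> origin) (\<theta> (corner m))))"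
  using diag_cube_of[of m ob ar \<theta>] Cat.cube_of_in[OF D, of \<theta> m] unfolding cube_cochains_def cubes_in_def by force

lemma eval_simplex_in: "\<phi> \<in> simplex_cochains m \<Longrightarrow> v \<in> simplices_in m p q \<Longrightarrow>
   eval_simplex ob ar p q \<phi> v \<in> carrier (M (ar p q))"
  using A.Comp_in[OF simplex_value_in push_in, of \<phi> m v p q p q] simplex_bounds[of v m p q]
  by (simp add: A.hom_group_simps eval_simplex_def)

lemma eval_cube_in: "\<psi> \<in> cube_cochains m \<Longrightarrow> \<theta> \<in> cubes_in m p q \<Longrightarrow>
   eval_cube ob ar p q m \<psi> \<theta> \<in> carrier (M (ar p q))"
  using A.Comp_in[OF cube_value_in push_in, of \<psi> m \<theta> p q p q] cube_bounds[of \<theta> m p q]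
  by (simp add: A.hom_group_simps eval_cube_def)

lemma eval_simplices_in: "p \<le> q \<Longrightarrow> eval_simplices ob ar p q \<phi> c \<in> Hom A W (Fo G (ar p q))"
  using comm_group.lin_closed[OF M_group[OF ar_Arr], of p q] by (simp add: eval_simplices_def A.hom_group_simps)

lemma eval_cubes_in: "p \<le> q \<Longrightarrow> eval_cubes ob ar p q m \<psi> c \<in> Hom A W (Fo G (ar p q))"
  using comm_group.lin_closed[OF M_group[OF ar_Arr], of p q] by (simp add: eval_cubes_def A.hom_group_simps)

context
  fixes ob' :: "'w::order \<Rightarrow> 'o" and ar' :: "'w \<Rightarrow> 'w \<Rightarrow> 'm" and f :: "'w \<Rightarrow> 'v" and p q p' q'
  assumes D': "diagram C ob' ar'" and f: "mono f"
    and ob': "\<And>x. ob' x = ob (f x)" and ar': "\<And>x y. x \<le> y \<Longrightarrow> ar' x y = ar (f x) (f y)"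
    and pq: "p' \<le> q'" "p \<le> f p'" "f q' \<le> q"
begin

lemma push_map: "p' \<le> lo \<Longrightarrow> lo \<le> hi \<Longrightarrow> hi \<le> q' \<Longrightarrow> push ar' lo hi p' q' = push ar (f lo) (f hi) (f p') (f q')"
  using ar' order_trans[of p' lo hi] order_trans[of p' hi q'] by (simp add: push_def)

lemma map_simplices_in: "v \<in> simplices_in m p' q' \<Longrightarrow> map f v \<in> simplices_in m p q"
  using pq f order_trans[OF pq(2) monoD[OF f]] order_trans[OF monoD[OF f] pq(3)]
  by (auto simp: simplices_in_def sorted_wrt_map elim!: sorted_wrt_mono_rel[rotated] intro: monoD)

lemma comp_cubes_in: "\<theta> \<in> cubes_in m p' q' \<Longrightarrow> f \<circ> \<theta> \<in> cubes_in m p q"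
  using pq f order_trans[OF pq(2) monoD[OF f]] order_trans[OF monoD[OF f] pq(3)]
  by (auto simp: cubes_in_def mono_def depends_def comp_assoc)

lemma push_left_hom:
  "(\<lambda>t. push ar (f p') (f q') p q \<bullet> t) \<in> hom (M (ar' p' q')) (M (ar p q))"
  using A.left_comp_hom[OF push_in, of p "f p'" "f q'" q] pq monoD[OF f pq(1)] ar'[OF pq(1)] by simp

lemma pq_groups: "comm_group (M (ar' p' q'))" "comm_group (M (ar p q))"
proof -
  have "f p' \<le> f q'" using monoD[OF f pq(1)] .
  then show "comm_group (M (ar' p' q'))" "comm_group (M (ar p q))"
    using M_group[OF ar_Arr, of p q] M_group[OF ar_Arr, of "f p'" "f q'"] pq ar'[OF pq(1)] by auto
qed

lemma chain_of_map: "v \<in> simplices_in m p' q' \<Longrightarrow> chain_of ob' ar' v = chain_of ob ar (map f v)"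
  using arrows_cong[of v ar' ar f] ob' ar' by (cases v) (auto simp: chain_of_def simplices_in_def)

lemma cube_of_comp: "mono \<theta> \<Longrightarrow> cube_of m ob' ar' \<theta> = cube_of m ob ar (f \<circ> \<theta>)"
  using ar'[OF monoD[OF _ coords_mono]] by (auto simp: cube_of_def ob' fun_eq_iff restrict_def)

lemma push_push_map:
  assumes "p' \<le> lo" "lo \<le> hi" "hi \<le> q'" "t \<in> Hom A W (Fo G (ar (f lo) (f hi)))"
  shows "push ar (f p') (f q') p q \<bullet> (push ar' lo hi p' q' \<bullet> t) = push ar (f lo) (f hi) p q \<bullet> t"
proof -
  have le: "p \<le> f p'" "f p' \<le> f lo" "f lo \<le> f hi" "f hi \<le> f q'" "f q' \<le> q" "f p' \<le> f q'"
    using assms pq monoD[OF f] by auto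
  show ?thesis unfolding push_map[OF assms(1-3)]
    using A.Comp_assoc[OF assms(4) push_in[of "f p'" "f lo" "f hi" "f q'"] push_in[of p "f p'" "f q'" q]] le
     push_push[of p "f p'" "f lo" "f hi" "f q'" q] by simp
qed

text \<open>Evaluation in a diagram pulled back along \<open>f\<close>, followed by a push, is
  evaluation of the image chain. Through this an operator defined on the universal simplex becomes
  known on every simplex.\<close>

lemma eval_simplices_map:
  assumes "\<phi> \<in> simplex_cochains m" "supp c \<subseteq> simplices_in m p' q'"
  shows "push ar (f p') (f q') p q \<bullet> eval_simplices ob' ar' p' q' \<phi> c
     = eval_simplices ob ar p q \<phi> (map_simplices f c)"
proof -
  interpret MM: comm_group "M (ar' p' q')" by (rule pq_groups)
  interpret N: comm_group "M (ar p q)" by (rule pq_groups)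
  have v: "push ar (f p') (f q') p q \<bullet> eval_simplex ob' ar' p' q' \<phi> v = eval_simplex ob ar p q \<phi> (map f v)
     \<and> eval_simplex ob' ar' p' q' \<phi> v \<in> carrier (M (ar' p' q')) \<and> eval_simplex ob ar p q \<phi> (map f v) \<in> carrier (M (ar p q))"
    if "v \<in> supp c" for v
  proof -
    have v: "v \<in> simplices_in m p' q'" using that assms by auto
    then have "v \<noteq> []" by (auto simp: simplices_in_def)
    then show ?thesis
      using push_push_map[of "hd v" "last v" "\<phi> (chain_of ob ar (map f v))"] simplex_bounds[OF map_simplices_in[OF v]]
        simplex_value_in[OF assms(1) map_simplices_in[OF v]] eval_simplex_in[OF assms(1) map_simplices_in[OF v]]
        coefficients.eval_simplex_in[OF coefficients_axioms D' assms(1) v]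
        coefficients.simplex_bounds[OF coefficients_axioms D' v]
      by (simp add: eval_simplex_def chain_of_map[OF v] hd_map last_map)
  qed
  have "push ar (f p') (f q') p q \<bullet> eval_simplices ob' ar' p' q' \<phi> c
     = lin (M (ar p q)) (\<lambda>v. push ar (f p') (f q') p q \<bullet> eval_simplex ob' ar' p' q' \<phi> v) c"
    unfolding eval_simplices_def by (rule MM.lin_hom[OF pq_groups(2) push_left_hom]) (use v in blast)
  also have "\<dots> = lin (M (ar p q)) (\<lambda>v. lin (M (ar p q)) (eval_simplex ob ar p q \<phi>) (frag_of (map f v))) c"
    by (rule N.lin_cong) (simp add: v N.lin_of)
  finally show ?thesis by (simp add: eval_simplices_def map_simplices_def N.lin_extend)
qed

lemma eval_cubes_map:
  assumes "\<psi> \<in> cube_cochains m" "supp c \<subseteq> cubes_in m p' q'"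
  shows "push ar (f p') (f q') p q \<bullet> eval_cubes ob' ar' p' q' m \<psi> c
     = eval_cubes ob ar p q m \<psi> (map_cubes f c)"
proof -
  interpret MM: comm_group "M (ar' p' q')" by (rule pq_groups)
  interpret N: comm_group "M (ar p q)" by (rule pq_groups)
  have v: "push ar (f p') (f q') p q \<bullet> eval_cube ob' ar' p' q' m \<psi> \<theta> = eval_cube ob ar p q m \<psi> (f \<circ> \<theta>)
     \<and> eval_cube ob' ar' p' q' m \<psi> \<theta> \<in> carrier (M (ar' p' q')) \<and> eval_cube ob ar p q m \<psi> (f \<circ> \<theta>) \<in> carrier (M (ar p q))"
    if "\<theta> \<in> supp c" for \<theta>
  proof -
    have v: "\<theta> \<in> cubes_in m p' q'" using that assms by auto
    then have "mono \<theta>" by (auto simp: cubes_in_def)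
    then show ?thesis
      using push_push_map[of "\<theta> origin" "\<theta> (corner m)" "\<psi> (cube_of m ob ar (f \<circ> \<theta>))"] cube_bounds[OF comp_cubes_in[OF v]]
        cube_value_in[OF assms(1) comp_cubes_in[OF v]] eval_cube_in[OF assms(1) comp_cubes_in[OF v]]
        coefficients.eval_cube_in[OF coefficients_axioms D' assms(1) v]
        coefficients.cube_bounds[OF coefficients_axioms D' v]
      by (simp add: eval_cube_def cube_of_comp)
  qed
  have "push ar (f p') (f q') p q \<bullet> eval_cubes ob' ar' p' q' m \<psi> c
     = lin (M (ar p q)) (\<lambda>v. push ar (f p') (f q') p q \<bullet> eval_cube ob' ar' p' q' m \<psi> v) c"
    unfolding eval_cubes_def by (rule MM.lin_hom[OF pq_groups(2) push_left_hom]) (use v in blast)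
  also have "\<dots> = lin (M (ar p q)) (\<lambda>v. lin (M (ar p q)) (eval_cube ob ar p q m \<psi>) (frag_of (f \<circ> v))) c"
    by (rule N.lin_cong) (simp add: v N.lin_of)
  finally show ?thesis by (simp add: eval_cubes_def N.lin_extend)
qed

end

end

end

section \<open>Cochain operators induced by natural chains\<close>

context coefficients
begin

text \<open>By naturality, an operation \<open>F\<close> on formal chains acts on cochains through its value on the
  universal simplex \<open>[0..<Suc n]\<close> or the universal cube \<open>truncate n\<close>. The suffixes \<open>s\<close> and \<open>c\<close>
  stand for simplices and cubes.\<close>

definition op_ss :: "(nat list \<Rightarrow> (nat list \<Rightarrow>\<^sub>0 int)) \<Rightarrow> ('o \<times> 'm list \<Rightarrow> 'q) \<Rightarrow> 'o \<times> 'm list \<Rightarrow> 'q" where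
  "op_ss F \<phi> s = eval_simplices (chain_ob C s) (chain_ar C s) 0 (length (snd s)) \<phi> (F [0..<Suc (length (snd s))])"

definition op_sc :: "nat \<Rightarrow> (nat list \<Rightarrow> (nat cube \<Rightarrow>\<^sub>0 int)) \<Rightarrow> (('o, 'm) cube_ftor \<Rightarrow> 'q) \<Rightarrow> 'o \<times> 'm list \<Rightarrow> 'q" where
  "op_sc m F \<psi> s = eval_cubes (chain_ob C s) (chain_ar C s) 0 (length (snd s)) m \<psi> (F [0..<Suc (length (snd s))])"

definition op_cs :: "nat \<Rightarrow> ((nat \<Rightarrow> bool) cube \<Rightarrow> ((nat \<Rightarrow> bool) list \<Rightarrow>\<^sub>0 int)) \<Rightarrow> ('o \<times> 'm list \<Rightarrow> 'q) \<Rightarrow> ('o, 'm) cube_ftor \<Rightarrow> 'q" where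
  "op_cs n F \<phi> g = eval_simplices (cube_ob n g) (cube_ar n g) origin (corner n) \<phi> (F (truncate n))"

definition op_cc :: "nat \<Rightarrow> nat \<Rightarrow> ((nat \<Rightarrow> bool) cube \<Rightarrow> ((nat \<Rightarrow> bool) cube \<Rightarrow>\<^sub>0 int)) \<Rightarrow> (('o, 'm) cube_ftor \<Rightarrow> 'q) \<Rightarrow> ('o, 'm) cube_ftor \<Rightarrow> 'q" where
  "op_cc n m F \<psi> g = eval_cubes (cube_ob n g) (cube_ar n g) origin (corner n) m \<psi> (F (truncate n))"

lemma bot_corner: "origin \<le> corner n"
  by (simp add: le_fun_def)

lemma chains_length: "s \<in> chains C n \<Longrightarrow> length (snd s) = n"
  by (auto simp: chains_def)

lemma chain_ar_snd: "chain_ar C s 0 (length (snd s)) = chain_comp s"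
  by (cases s) (simp add: Cat.chain_ar_full)

text \<open>Values of \<open>lin\<close> lie in the group by construction, so the result is a
  cochain for arbitrary \<open>F\<close> and \<open>\<phi>\<close>.\<close>

lemma op_ss_in: "op_ss F \<phi> \<in> simplex_cochains n"
  using eval_simplices_in[OF Cat.diagram_chain, of _ n 0]
  by (auto simp: simplex_cochains_def op_ss_def simp flip: chain_ar_snd)

lemma op_cs_in: "op_cs n F \<phi> \<in> cube_cochains n"
  using eval_simplices_in[OF Cat.diagram_cube bot_corner]
  by (auto simp: cube_cochains_def op_cs_def diag_eq)

lemma op_cc_in: "op_cc n m F \<psi> \<in> cube_cochains n"
  using eval_cubes_in[OF Cat.diagram_cube bot_corner]
  by (auto simp: cube_cochains_def op_cc_def diag_eq)

text \<open>In components this is the vanishing of all degeneracy operators: a degeneracy does not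
  change the diagonal, its coefficient arrow is an identity, and what remains is the value of
  \<open>\<psi>\<close> on the degenerate cube.\<close>

definition normalized :: "nat \<Rightarrow> (('o, 'm) cube_ftor \<Rightarrow> 'q) \<Rightarrow> bool" where
  "normalized n \<psi> \<longleftrightarrow> (\<forall>i \<in> {1..n}. \<forall>g \<in> cubes (n - 1).
     let g' = ftor_comp (cube_poset n) g (cube_ftor_of (snd (snd (cube_degen n i))))
     in \<psi> g' = Zero A W (Fo G (diag n g')))"

text \<open>A cube independent of coordinate \<open>i\<close> is a degeneracy of its face in
  direction \<open>i\<close>, counted from 0 here and from 1 in \<open>cube_degen\<close>. This
  links formal degeneracy to degeneracy of cubes in \<open>C\<close>.\<close>

lemma cube_of_indep:
  assumes "indep i \<theta>" "i < n" "mono \<theta>"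
  shows "cube_of n ob ar \<theta> = ftor_comp (cube_poset n) (cube_of (n - 1) ob ar (face i False \<theta>))
      (cube_ftor_of (snd (snd (cube_degen n (Suc i)))))"
proof -
  have deg: "take i x @ drop (Suc i) x \<in> vertices (n - 1)" if "x \<in> vertices n" for x :: "bool list"
    using that assms(2) by (auto simp: vertices_def)
  have eq: "face i False \<theta> (coords (take i x @ drop (Suc i) x)) = \<theta> (coords x)" if "x \<in> vertices n" for x
  proof -
    have "insert_coord i False (coords (take i x @ drop (Suc i) x)) = (coords x)(i := False)"
      using that assms(2) by (auto simp: insert_coord_def coords_def vertices_def fun_eq_iff nth_append)
    then show ?thesis using assms(1) by (simp add: face_def indep_def)
  qed
  have ar: "(take i x @ drop (Suc i) x, take i y @ drop (Suc i) y) \<in> Arr (cube_poset (n - 1))"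
    if "(x, y) \<in> Arr (cube_poset n)" for x y
    using that deg[of x] deg[of y]
    by (auto simp: cube_poset_def intro!: list_all2_appendI list_all2_takeI list_all2_dropI)
  have Obj: "Obj (cube_poset n) = vertices n" by (simp add: cube_poset_def)
  have xy: "x \<in> vertices n \<and> y \<in> vertices n" if "(x, y) \<in> Arr (cube_poset n)" for x y
    using that by (auto simp: cube_poset_def)
  show ?thesis
    by (auto simp: cube_of_def ftor_comp_def compose_def cube_ftor_of_def cube_degen_def fun_eq_iff eq
      deg[unfolded One_nat_def] Obj ar[unfolded One_nat_def] restrict_def dest: xy)
qed

section \<open>Evaluation in a fixed interval as a homomorphism\<close>

context
  fixes ob :: "'v::order \<Rightarrow> 'o" and ar :: "'v \<Rightarrow> 'v \<Rightarrow> 'm" and p q :: 'v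
  assumes D: "diagram C ob ar" and pq: "p \<le> q"
begin

lemma group: "comm_group (M (ar p q))"
  using M_group[OF ar_Arr[OF D pq]] .

lemma eval_simplices_add:
  "eval_simplices ob ar p q \<phi> (c + c') = eval_simplices ob ar p q \<phi> c \<oplus>\<^sub>A eval_simplices ob ar p q \<phi> c'"
  using comm_group.lin_add[OF group] by (simp add: eval_simplices_def A.hom_group_simps)

lemma eval_cubes_add:
  "eval_cubes ob ar p q m \<psi> (c + c') = eval_cubes ob ar p q m \<psi> c \<oplus>\<^sub>A eval_cubes ob ar p q m \<psi> c'"
  using comm_group.lin_add[OF group] by (simp add: eval_cubes_def A.hom_group_simps)

lemma eval_simplices_0 [simp]: "eval_simplices ob ar p q \<phi> 0 = Zero A W (Fo G (ar p q))"
  using comm_group.lin_0[OF group] by (simp add: eval_simplices_def A.hom_group_simps)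

lemma eval_cubes_0 [simp]: "eval_cubes ob ar p q m \<psi> 0 = Zero A W (Fo G (ar p q))"
  using comm_group.lin_0[OF group] by (simp add: eval_cubes_def A.hom_group_simps)

lemma push_Zero:
  "p \<le> lo \<Longrightarrow> lo \<le> hi \<Longrightarrow> hi \<le> q \<Longrightarrow> push ar lo hi p q \<bullet> Zero A W (Fo G (ar lo hi)) = Zero A W (Fo G (ar p q))"
  using A.Comp_Zero[OF push_in[OF D] W] by blast

lemma eval_simplices_zero:
  assumes "\<And>s. s \<in> chains C n \<Longrightarrow> \<phi> s = Zero A W (Fo G (chain_comp s))"
    "supp c \<subseteq> simplices_in n p q"
  shows "eval_simplices ob ar p q \<phi> c = Zero A W (Fo G (ar p q))"
proof -
  have "eval_simplex ob ar p q \<phi> v = Zero A W (Fo G (ar p q))" if "v \<in> supp c" for v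
  proof -
    have v: "v \<in> simplices_in n p q" using that assms by auto
    then show ?thesis using assms(1)[OF Cat.chain_of_in[OF D v]] simplex_bounds[OF D v] push_Zero
      by (simp add: eval_simplex_def Cat.path_comp_chain_of[OF D v])
  qed
  then show ?thesis unfolding eval_simplices_def
    by (subst comm_group.lin_one[OF group]) (simp_all add: A.hom_group_simps)
qed

lemma eval_cubes_zero:
  assumes "\<And>g. g \<in> cubes n \<Longrightarrow> \<psi> g = Zero A W (Fo G (diag n g))"
    "supp c \<subseteq> cubes_in n p q"
  shows "eval_cubes ob ar p q n \<psi> c = Zero A W (Fo G (ar p q))"
proof -
  have "eval_cube ob ar p q n \<psi> \<theta> = Zero A W (Fo G (ar p q))" if "\<theta> \<in> supp c" for \<theta>
  proof -
    have v: "\<theta> \<in> cubes_in n p q" using that assms by auto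
    then have "mono \<theta>" by (auto simp: cubes_in_def)
    then show ?thesis using assms(1)[OF Cat.cube_of_in[OF D]] cube_bounds[OF D v] push_Zero
      by (simp add: eval_cube_def diag_cube_of)
  qed
  then show ?thesis unfolding eval_cubes_def
    by (subst comm_group.lin_one[OF group]) (simp_all add: A.hom_group_simps)
qed

text \<open>Through this fact relations modulo degenerate cubes become equations between values: a
  normalized cochain is zero on each degenerate cube, and a push preserves zero.\<close>

lemma eval_cubes_degenerate:
  assumes "normalized n \<psi>" "supp c \<subseteq> cubes_in n p q" "supp c \<subseteq> {\<theta>. degenerate n \<theta>}"
  shows "eval_cubes ob ar p q n \<psi> c = Zero A W (Fo G (ar p q))"
proof -
  have "eval_cube ob ar p q n \<psi> \<theta> = Zero A W (Fo G (ar p q))" if "\<theta> \<in> supp c" for \<theta>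
  proof -
    have v: "\<theta> \<in> cubes_in n p q" "degenerate n \<theta>" using that assms by auto
    then obtain i where i: "i < n" "indep i \<theta>" "mono \<theta>" by (auto simp: degenerate_def cubes_in_def)
    then obtain m where m: "n = Suc m" by (cases n) auto
    have "face i False \<theta> \<in> cubes_in m p q" using cubes_in_face v(1) i(1) unfolding m by blast
    then have "cube_of (n - 1) ob ar (face i False \<theta>) \<in> cubes (n - 1)"
      using Cat.cube_of_in[OF D] by (auto simp: m cubes_in_def)
    then have "\<psi> (cube_of n ob ar \<theta>) = Zero A W (Fo G (diag n (cube_of n ob ar \<theta>)))"
      using assms(1) i(1) unfolding normalized_def cube_of_indep[OF i(2,1,3)] Let_def by auto
    then show ?thesis using cube_bounds[OF D v(1)] push_Zero by (simp add: eval_cube_def diag_cube_of)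
  qed
  then show ?thesis unfolding eval_cubes_def
    by (subst comm_group.lin_one[OF group]) (simp_all add: A.hom_group_simps)
qed

text \<open>The map \<open>f\<close> classifies the simplex \<open>v\<close>: it carries the
  universal simplex to \<open>v\<close>, and is continued to all of \<open>nat\<close> by its last
  value.\<close>

lemma simplex_reindex:
  assumes "v \<in> simplices_in n p q"
  defines "f \<equiv> \<lambda>i. v ! min i n"
  shows "mono f" "f 0 = hd v" "f n = last v" "map f [0..<Suc n] = v"
proof -
  have v: "length v = Suc n" "sorted_wrt (\<le>) v" "v \<noteq> []" using assms by (auto simp: simplices_in_def)
  show "mono f" unfolding f_def mono_def using v(1) sorted_wrt_nth_less[OF v(2)]
    by (metis (no_types, lifting) le_neq_implies_less less_Suc_eq_le min.cobounded2 min.mono order_refl)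
  show "f 0 = hd v" "f n = last v" using v by (auto simp: f_def hd_conv_nth last_conv_nth)
  show "map f [0..<Suc n] = v" using v by (auto intro!: nth_equalityI simp: f_def simp del: upt_Suc)
qed

text \<open>\<open>F\<close> and \<open>F'\<close> stand for two type instances of one polymorphic
  operation, over \<open>nat\<close> and over \<open>'v\<close>; the naturality hypothesis is what
  ties them together.\<close>

lemma eval_simplex_op_ss:
  assumes "\<phi> \<in> simplex_cochains m" "supp (F [0..<Suc n]) \<subseteq> simplices_in m 0 n"
    "\<And>f. map_simplices f (F [0..<Suc n]) = F' (map f [0..<Suc n])" "v \<in> simplices_in n p q"
  shows "eval_simplex ob ar p q (op_ss F \<phi>) v = eval_simplices ob ar p q \<phi> (F' v)"
proof -
  note v = simplex_reindex[OF assms(4)]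
  note s = Cat.chain_of_in[OF D assms(4)]
  note ob = Cat.chain_ob_chain_of[OF D assms(4)]
  have "p \<le> v ! min 0 n" "v ! min n n \<le> q" using simplex_bounds[OF D assms(4)] v(2,3) by auto
  from eval_simplices_map[OF D Cat.diagram_chain[OF s] v(1) ob _ this assms(1,2)]
  show ?thesis using v by (simp add: assms(3) eval_simplex_def op_ss_def chains_length[OF s] del: upt_Suc)
qed

lemma eval_simplex_op_sc:
  assumes "\<psi> \<in> cube_cochains m" "supp (F [0..<Suc n]) \<subseteq> cubes_in m 0 n"
    "\<And>f. map_cubes f (F [0..<Suc n]) = F' (map f [0..<Suc n])" "v \<in> simplices_in n p q"
  shows "eval_simplex ob ar p q (op_sc m F \<psi>) v = eval_cubes ob ar p q m \<psi> (F' v)"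
proof -
  note v = simplex_reindex[OF assms(4)]
  note s = Cat.chain_of_in[OF D assms(4)]
  note ob = Cat.chain_ob_chain_of[OF D assms(4)]
  have "p \<le> v ! min 0 n" "v ! min n n \<le> q" using simplex_bounds[OF D assms(4)] v(2,3) by auto
  from eval_cubes_map[OF D Cat.diagram_chain[OF s] v(1) ob _ this assms(1,2)]
  show ?thesis using v by (simp add: assms(3) eval_simplex_def op_sc_def chains_length[OF s] del: upt_Suc)
qed

lemma eval_cube_op_cs:
  assumes "\<phi> \<in> simplex_cochains m" "supp (F (truncate n)) \<subseteq> simplices_in m origin (corner n)"
    "\<And>f. map_simplices f (F (truncate n)) = F' (f \<circ> truncate n)" "\<theta> \<in> cubes_in n p q"
  shows "eval_cube ob ar p q n (op_cs n F \<phi>) \<theta> = eval_simplices ob ar p q \<phi> (F' \<theta>)"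
proof -
  have \<theta>: "mono \<theta>" "depends n \<theta>" using assms(4) by (auto simp: cubes_in_def)
  then have t: "\<theta> \<circ> truncate n = \<theta>" by (simp add: depends_def)
  have b: "p \<le> \<theta> origin" "\<theta> (corner n) \<le> q" using cube_bounds[OF D assms(4)] by auto
  show ?thesis
    using eval_simplices_map[OF D Cat.diagram_cube[OF Cat.cube_of_in[OF D \<theta>(1)]] \<theta>(1) cube_ob_cube_of[OF \<theta>(2)] bot_corner b assms(1,2)]
    by (simp add: eval_cube_def op_cs_def assms(3) t)
qed

lemma eval_cube_op_cc:
  assumes "\<psi> \<in> cube_cochains m" "supp (F (truncate n)) \<subseteq> cubes_in m origin (corner n)"
    "\<And>f. map_cubes f (F (truncate n)) = F' (f \<circ> truncate n)" "\<theta> \<in> cubes_in n p q"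
  shows "eval_cube ob ar p q n (op_cc n m F \<psi>) \<theta> = eval_cubes ob ar p q m \<psi> (F' \<theta>)"
proof -
  have \<theta>: "mono \<theta>" "depends n \<theta>" using assms(4) by (auto simp: cubes_in_def)
  then have t: "\<theta> \<circ> truncate n = \<theta>" by (simp add: depends_def)
  have b: "p \<le> \<theta> origin" "\<theta> (corner n) \<le> q" using cube_bounds[OF D assms(4)] by auto
  show ?thesis
    using eval_cubes_map[OF D Cat.diagram_cube[OF Cat.cube_of_in[OF D \<theta>(1)]] \<theta>(1) cube_ob_cube_of[OF \<theta>(2)] bot_corner b assms(1,2)]
    by (simp add: eval_cube_def op_cc_def assms(3) t)
qed

lemma eval_simplices_op_ss:
  assumes "\<phi> \<in> simplex_cochains m" "supp (F [0..<Suc n]) \<subseteq> simplices_in m 0 n"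
    "\<And>f. map_simplices f (F [0..<Suc n]) = F' (map f [0..<Suc n])" "supp c \<subseteq> simplices_in n p q"
  shows "eval_simplices ob ar p q (op_ss F \<phi>) c = eval_simplices ob ar p q \<phi> (frag_extend F' c)"
  using eval_simplex_op_ss[of \<phi> m F n F', OF assms(1,2,3)] assms(4) unfolding eval_simplices_def comm_group.lin_extend[OF group]
  by (intro comm_group.lin_cong[OF group]) blast

lemma eval_simplices_op_sc:
  assumes "\<psi> \<in> cube_cochains m" "supp (F [0..<Suc n]) \<subseteq> cubes_in m 0 n"
    "\<And>f. map_cubes f (F [0..<Suc n]) = F' (map f [0..<Suc n])" "supp c \<subseteq> simplices_in n p q"
  shows "eval_simplices ob ar p q (op_sc m F \<psi>) c = eval_cubes ob ar p q m \<psi> (frag_extend F' c)"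
  using eval_simplex_op_sc[of \<psi> m F n F', OF assms(1,2,3)] assms(4)
  unfolding eval_simplices_def eval_cubes_def comm_group.lin_extend[OF group]
  by (intro comm_group.lin_cong[OF group]) blast

lemma eval_cubes_op_cs:
  assumes "\<phi> \<in> simplex_cochains m" "supp (F (truncate n)) \<subseteq> simplices_in m origin (corner n)"
    "\<And>f. map_simplices f (F (truncate n)) = F' (f \<circ> truncate n)" "supp c \<subseteq> cubes_in n p q"
  shows "eval_cubes ob ar p q n (op_cs n F \<phi>) c = eval_simplices ob ar p q \<phi> (frag_extend F' c)"
  using eval_cube_op_cs[of \<phi> m F n F', OF assms(1,2,3)] assms(4)
  unfolding eval_simplices_def eval_cubes_def comm_group.lin_extend[OF group]
  by (intro comm_group.lin_cong[OF group]) blast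

lemma eval_cubes_op_cc:
  assumes "\<psi> \<in> cube_cochains m" "supp (F (truncate n)) \<subseteq> cubes_in m origin (corner n)"
    "\<And>f. map_cubes f (F (truncate n)) = F' (f \<circ> truncate n)" "supp c \<subseteq> cubes_in n p q"
  shows "eval_cubes ob ar p q n (op_cc n m F \<psi>) c = eval_cubes ob ar p q m \<psi> (frag_extend F' c)"
  using eval_cube_op_cc[of \<psi> m F n F', OF assms(1,2,3)] assms(4)
  unfolding eval_cubes_def comm_group.lin_extend[OF group]
  by (intro comm_group.lin_cong[OF group]) blast

section \<open>The six operators moved from cochains to chains\<close>

lemma eval_simplex_coboundary:
  assumes "\<phi> \<in> simplex_cochains n" "supp c \<subseteq> simplices_in (Suc n) p q"
  shows "eval_simplices ob ar p q (op_ss simplex_boundary \<phi>) c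
       = eval_simplices ob ar p q \<phi> (frag_extend simplex_boundary c)"
  by (rule eval_simplices_op_ss[OF assms(1) _ _ assms(2)])
    (simp_all add: simplices_in_boundary[OF upt_in] map_simplex_boundary del: upt_Suc)

lemma eval_cube_coboundary:
  assumes "\<psi> \<in> cube_cochains n" "supp c \<subseteq> cubes_in (Suc n) p q"
  shows "eval_cubes ob ar p q (Suc n) (op_cc (Suc n) n (cube_boundary (Suc n)) \<psi>) c
       = eval_cubes ob ar p q n \<psi> (frag_extend (cube_boundary (Suc n)) c)"
  by (rule eval_cubes_op_cc[OF assms(1) _ _ assms(2)])
    (simp_all add: cubes_in_boundary[OF truncate_in] map_cube_boundary)

lemma eval_simplex_to_cube:
  assumes "\<psi> \<in> cube_cochains n" "supp c \<subseteq> simplices_in n p q"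
  shows "eval_simplices ob ar p q (op_sc n (\<lambda>v. frag_of (simplex_to_cube v)) \<psi>) c
       = eval_cubes ob ar p q n \<psi> (simplices_to_cubes c)"
  by (rule eval_simplices_op_sc[OF assms(1) _ _ assms(2)])
    (simp_all add: simplex_to_cube_in[OF upt_in] simplex_to_cube_map del: upt_Suc)

lemma eval_cube_to_simplices:
  assumes "\<phi> \<in> simplex_cochains n" "supp c \<subseteq> cubes_in n p q"
  shows "eval_cubes ob ar p q n (op_cs n (cube_to_simplices n) \<phi>) c
       = eval_simplices ob ar p q \<phi> (frag_extend (cube_to_simplices n) c)"
  by (rule eval_cubes_op_cs[OF assms(1) _ _ assms(2)])
    (simp_all add: keys_cube_to_simplices[OF truncate_in] map_cube_to_simplices)

lemma eval_simplex_homotopy: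
  assumes "\<phi> \<in> simplex_cochains (Suc n)" "supp c \<subseteq> simplices_in n p q"
  shows "eval_simplices ob ar p q (op_ss (simplex_homotopy n) \<phi>) c
       = eval_simplices ob ar p q \<phi> (frag_extend (simplex_homotopy n) c)"
  by (rule eval_simplices_op_ss[OF assms(1) _ _ assms(2)])
    (simp_all add: keys_simplex_homotopy[OF upt_in] map_simplex_homotopy del: upt_Suc)

lemma eval_cube_homotopy:
  assumes "\<psi> \<in> cube_cochains (Suc n)" "supp c \<subseteq> cubes_in n p q"
  shows "eval_cubes ob ar p q n (op_cc n (Suc n) (cube_homotopy n) \<psi>) c
       = eval_cubes ob ar p q (Suc n) \<psi> (frag_extend (cube_homotopy n) c)"
  by (rule eval_cubes_op_cc[OF assms(1) _ _ assms(2)])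
    (simp_all add: keys_cube_homotopy[OF truncate_in] map_cube_homotopy)

end

text \<open>The universal simplex spans the whole interval, so the push is an identity and
  evaluation returns the cochain.\<close>

lemma eval_simplices_chain:
  assumes "s \<in> chains C n" "\<phi> \<in> simplex_cochains n"
  shows "eval_simplices (chain_ob C s) (chain_ar C s) 0 n \<phi> (frag_of [0..<Suc n]) = \<phi> s"
proof -
  note D = Cat.diagram_chain[OF assms(1)]
  have h: "hd [0..<Suc n] = 0" "last [0..<Suc n] = n" by (simp_all add: hd_append)
  have "eval_simplices (chain_ob C s) (chain_ar C s) 0 n \<phi> (frag_of [0..<Suc n]) =
     push (chain_ar C s) 0 n 0 n \<bullet> \<phi> s"
    unfolding eval_simplices_def
    using eval_simplex_in[OF D assms(2) upt_in]
    by (subst comm_group.lin_of[OF group[OF D]])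
      (simp_all add: eval_simplex_def Cat.chain_of_chain[OF assms(1)] h del: upt_Suc)
  also have "\<dots> = \<phi> s"
    using push_id[OF D, of 0 n] assms A.Id_Comp[of "\<phi> s"] chains_length[OF assms(1)] chain_ar_snd[of s]
    by (auto simp: simplex_cochains_def)
  finally show ?thesis .
qed

lemma eval_cubes_cube:
  assumes "g \<in> cubes n" "\<psi> \<in> cube_cochains n"
  shows "eval_cubes (cube_ob n g) (cube_ar n g) origin (corner n) n \<psi> (frag_of (truncate n)) = \<psi> g"
proof -
  note D = Cat.diagram_cube[OF assms(1)]
  have t: "truncate n origin = origin" "truncate n (corner n) = corner n"
    by (auto simp: truncate_def corner_def)
  have "eval_cubes (cube_ob n g) (cube_ar n g) origin (corner n) n \<psi> (frag_of (truncate n)) =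
     push (cube_ar n g) origin (corner n) origin (corner n) \<bullet> \<psi> g"
    unfolding eval_cubes_def
    using eval_cube_in[OF D assms(2) truncate_in]
    by (subst comm_group.lin_of[OF group[OF D bot_corner]])
      (auto simp add: eval_cube_def cube_of_cube[OF assms(1)] t)
  also have "\<dots> = \<psi> g"
    using push_id[OF D bot_corner, of n] assms A.Id_Comp[of "\<psi> g"]
    by (auto simp: cube_cochains_def diag_eq)
  finally show ?thesis .
qed

end

section \<open>Comparison of the two complexes\<close>

context coefficients
begin

abbreviation "simplex_cobd \<equiv> op_ss simplex_boundary"
abbreviation "cube_cobd n \<equiv> op_cc (Suc n) n (cube_boundary (Suc n))"
abbreviation "to_simplex n \<equiv> op_sc n (\<lambda>v. frag_of (simplex_to_cube v))"
abbreviation "to_cube n \<equiv> op_cs n (cube_to_simplices n)"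

text \<open>A converse of \<open>cube_of_indep\<close>: a degenerate cube of \<open>C\<close> comes
  from a formally degenerate cube in the diagram of the smaller cube, and this formal cube reaches
  both ends of the interval.\<close>

lemma degenerate_cube:
  fixes g :: "('o, 'm) cube_ftor"
  assumes "i \<in> {1..n}" "g \<in> cubes (n - 1)"
  obtains \<theta> where "ftor_comp (cube_poset n) g (cube_ftor_of (snd (snd (cube_degen n i))))
      = cube_of n (cube_ob (n - 1) g) (cube_ar (n - 1) g) \<theta>"
    "degenerate n \<theta>" "\<theta> \<in> cubes_in n origin (corner (n - 1))"
    "\<theta> origin = origin" "\<theta> (corner n) = corner (n - 1)"
proof -
  \<comment> \<open>Coordinate \<open>i - 1\<close> is skipped, and the remaining ones are cut off
    after \<open>n - 1\<close> places.\<close>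
  define \<theta> where "\<theta> x = (\<lambda>j. j < n - 1 \<and> x (if j < i - 1 then j else Suc j))" for x :: "nat \<Rightarrow> bool"
  have f: "face (i - 1) False \<theta> = truncate (n - 1)"
    by (auto simp: face_def \<theta>_def insert_coord_def truncate_def fun_eq_iff)
  have ind: "indep (i - 1) \<theta>" by (auto simp: indep_def \<theta>_def fun_eq_iff)
  have m: "mono \<theta>" by (auto simp: mono_def \<theta>_def le_fun_def)
  have "i - 1 < n" "Suc (i - 1) = i" using assms(1) by auto
  from cube_of_indep[OF ind this(1) m, of "cube_ob (n - 1) g" "cube_ar (n - 1) g", unfolded f this(2) cube_of_cube[OF assms(2)]]
  show ?thesis
  proof (rule that[OF sym])
    show "degenerate n \<theta>" using ind \<open>i - 1 < n\<close> by (auto simp: degenerate_def)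
    show "\<theta> \<in> cubes_in n origin (corner (n - 1))" using m
      by (auto simp: cubes_in_def corner_def depends_def \<theta>_def truncate_def fun_eq_iff le_fun_def)
    show "\<theta> origin = origin" "\<theta> (corner n) = corner (n - 1)"
      by (auto simp: \<theta>_def corner_def)
  qed
qed

text \<open>Reduces normalization to a statement about formal cubes, which can be settled by
  evaluating chains. The push in between is an identity because \<open>\<theta>\<close> reaches both
  ends of the interval.\<close>

lemma normalizedI:
  assumes "\<psi> \<in> cube_cochains n"
    "\<And>g \<theta>. g \<in> cubes (n - 1) \<Longrightarrow> degenerate n \<theta> \<Longrightarrow> \<theta> \<in> cubes_in n origin (corner (n - 1)) \<Longrightarrow>
      eval_cube (cube_ob (n - 1) g) (cube_ar (n - 1) g) origin (corner (n - 1)) n \<psi> \<theta>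
       = Zero A W (Fo G (cube_ar (n - 1) g origin (corner (n - 1))))"
  shows "normalized n \<psi>"
  unfolding normalized_def Let_def
proof (intro ballI)
  fix i g assume i: "i \<in> {1..n}" and g: "g \<in> cubes (n - 1)"
  let ?g' = "ftor_comp (cube_poset n) g (cube_ftor_of (snd (snd (cube_degen n i))))"
  let ?ob = "cube_ob (n - 1) g" and ?ar = "cube_ar (n - 1) g"
  obtain \<theta> where \<theta>: "?g' = cube_of n ?ob ?ar \<theta>"
    "degenerate n \<theta>" "\<theta> \<in> cubes_in n origin (corner (n - 1))"
    "\<theta> origin = origin" "\<theta> (corner n) = corner (n - 1)"
    using degenerate_cube[OF i g] .
  note D = Cat.diagram_cube[OF g]
  have "?g' \<in> cubes n" unfolding \<theta>(1) using Cat.cube_of_in[OF D] \<theta>(3) by (auto simp: cubes_in_def)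
  then have in': "\<psi> ?g' \<in> Hom A W (Fo G (?ar origin (corner (n - 1))))"
    using assms(1) \<theta>(4,5) by (auto simp: cube_cochains_def \<theta>(1) diag_cube_of)
  then have "\<psi> ?g' = eval_cube ?ob ?ar origin (corner (n - 1)) n \<psi> \<theta>"
    using push_id[OF D bot_corner] A.Id_Comp[OF in'] by (simp add: eval_cube_def \<theta>)
  then show "\<psi> ?g' = Zero A W (Fo G (diag n ?g'))"
    using assms(2)[OF g \<theta>(2,3)] \<theta> by (simp add: diag_cube_of)
qed

lemma normalized_to_cube:
  assumes "\<phi> \<in> simplex_cochains n" shows "normalized n (to_cube n \<phi>)"
proof (rule normalizedI[OF op_cs_in])
  fix g :: "('o, 'm) cube_ftor" and \<theta> :: "(nat \<Rightarrow> bool) cube" 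
  assume g: "g \<in> cubes (n - 1)" and \<theta>: "degenerate n \<theta>" "\<theta> \<in> cubes_in n origin (corner (n - 1))"
  note D = Cat.diagram_cube[OF g]
  show "eval_cube (cube_ob (n - 1) g) (cube_ar (n - 1) g) origin (corner (n - 1)) n (to_cube n \<phi>) \<theta>
       = Zero A W (Fo G (cube_ar (n - 1) g origin (corner (n - 1))))"
    using cube_to_simplices_degenerate[OF \<theta>(1)] eval_simplices_0[OF D bot_corner]
    by (subst eval_cube_op_cs[where F = "cube_to_simplices n" and F' = "cube_to_simplices n", OF D bot_corner assms keys_cube_to_simplices[OF truncate_in] map_cube_to_simplices \<theta>(2)]) simp
qed

lemma normalized_cube_homotopy:
  assumes "\<psi> \<in> cube_cochains (Suc n)" "normalized (Suc n) \<psi>"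
  shows "normalized n (op_cc n (Suc n) (cube_homotopy n) \<psi>)"
proof (rule normalizedI[OF op_cc_in])
  fix g :: "('o, 'm) cube_ftor" and \<theta> :: "(nat \<Rightarrow> bool) cube" 
  assume g: "g \<in> cubes (n - 1)" and \<theta>: "degenerate n \<theta>" "\<theta> \<in> cubes_in n origin (corner (n - 1))"
  note D = Cat.diagram_cube[OF g]
  show "eval_cube (cube_ob (n - 1) g) (cube_ar (n - 1) g) origin (corner (n - 1)) n (op_cc n (Suc n) (cube_homotopy n) \<psi>) \<theta>
       = Zero A W (Fo G (cube_ar (n - 1) g origin (corner (n - 1))))"
    using eval_cubes_degenerate[OF D bot_corner assms(2) keys_cube_homotopy[OF \<theta>(2)] cube_homotopy_degenerate[OF \<theta>(1)]]
    by (subst eval_cube_op_cc[where F = "cube_homotopy n" and F' = "cube_homotopy n", OF D bot_corner assms(1) keys_cube_homotopy[OF truncate_in] map_cube_homotopy \<theta>(2)])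
qed

lemma cube_cobd_to_cube:
  assumes "\<phi> \<in> simplex_cochains n" "g \<in> cubes (Suc n)"
  shows "cube_cobd n (to_cube n \<phi>) g = to_cube (Suc n) (simplex_cobd \<phi>) g"
proof -
  note D = Cat.diagram_cube[OF assms(2)]
  have "cube_cobd n (to_cube n \<phi>) g = eval_simplices (cube_ob (Suc n) g) (cube_ar (Suc n) g) origin (corner (Suc n)) \<phi>
       (frag_extend (cube_to_simplices n) (cube_boundary (Suc n) (truncate (Suc n))))"
    unfolding op_cc_def by (rule eval_cube_to_simplices[OF D bot_corner assms(1) cubes_in_boundary[OF truncate_in]])
  also have "\<dots> = to_cube (Suc n) (simplex_cobd \<phi>) g"
    unfolding op_cs_def boundary_cube_to_simplices[symmetric]
    by (rule eval_simplex_coboundary[symmetric, OF D bot_corner assms(1) keys_cube_to_simplices[OF truncate_in]])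
  finally show ?thesis .
qed

lemma cube_cobd_to_cube_cocycle:
  assumes "\<phi> \<in> simplex_cochains n" "g \<in> cubes (Suc n)"
    "\<And>s. s \<in> chains C (Suc n) \<Longrightarrow> simplex_cobd \<phi> s = Zero A W (Fo G (chain_comp s))"
  shows "cube_cobd n (to_cube n \<phi>) g = Zero A W (Fo G (diag (Suc n) g))"
  unfolding cube_cobd_to_cube[OF assms(1,2)] op_cs_def diag_eq
  by (rule eval_simplices_zero[OF Cat.diagram_cube[OF assms(2)] bot_corner assms(3) keys_cube_to_simplices[OF truncate_in]])

text \<open>\<open>simplices_to_cubes\<close> respects boundaries modulo degenerate cubes, so its
  dual commutes with coboundaries on normalized cochains.\<close>

lemma simplex_cobd_to_simplex:
  assumes "\<psi> \<in> cube_cochains n" "normalized n \<psi>" "s \<in> chains C (Suc n)"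
  shows "simplex_cobd (to_simplex n \<psi>) s = to_simplex (Suc n) (cube_cobd n \<psi>) s"
proof -
  note D = Cat.diagram_chain[OF assms(3)]
  note ls = chains_length[OF assms(3)]
  let ?E = "eval_cubes (chain_ob C s) (chain_ar C s) 0 (Suc n) n \<psi>"
  let ?v = "[0..<Suc (Suc n)]"
  let ?x = "simplices_to_cubes (simplex_boundary ?v)" and ?y = "cube_boundary (Suc n) (simplex_to_cube ?v)"
  have "simplex_cobd (to_simplex n \<psi>) s = ?E ?x"
    unfolding op_ss_def ls by (rule eval_simplex_to_cube[OF D _ assms(1) simplices_in_boundary[OF upt_in]]) simp
  moreover have "?E ?y = to_simplex (Suc n) (cube_cobd n \<psi>) s"
    unfolding op_sc_def[of "Suc n"] ls
    by (subst eval_cube_coboundary[OF D _ assms(1)]) (simp_all add: simplex_to_cube_in[OF upt_in] del: upt_Suc)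
  moreover have "?E ?y = ?E ?x"
  proof -
    have kx: "supp ?x \<subseteq> cubes_in n 0 (Suc n)"
      by (rule keys_simplices_to_cubes[OF simplices_in_boundary[OF upt_in]])
    have ky: "supp ?y \<subseteq> cubes_in n 0 (Suc n)"
      by (rule cubes_in_boundary[OF simplex_to_cube_in[OF upt_in]])
    have "?E (?y - ?x) = Zero A W (Fo G (chain_ar C s 0 (Suc n)))"
      by (rule eval_cubes_degenerate[OF D _ assms(2) keys_diff_in[OF ky kx] boundary_simplex_to_cube]) simp_all
    moreover have "?E ?y = ?E ?x \<oplus>\<^sub>A ?E (?y - ?x)"
      using eval_cubes_add[OF D, of 0 "Suc n" n \<psi> ?x "?y - ?x"] by simp
    ultimately show ?thesis using A.Add_Zero[OF eval_cubes_in[OF D]] by simp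
  qed
  ultimately show ?thesis by simp
qed

lemma to_simplex_to_cube_0:
  assumes "\<phi> \<in> simplex_cochains 0" "s \<in> chains C 0"
  shows "to_simplex 0 (to_cube 0 \<phi>) s = \<phi> s"
proof -
  note D = Cat.diagram_chain[OF assms(2)]
  have "to_simplex 0 (to_cube 0 \<phi>) s = eval_simplices (chain_ob C s) (chain_ar C s) 0 0 \<phi>
     (frag_extend (cube_to_simplices 0) (frag_of (simplex_to_cube [0..<Suc 0])))"
    unfolding op_sc_def chains_length[OF assms(2)]
    by (rule eval_cube_to_simplices[OF D _ assms(1)]) (use simplex_to_cube_in[OF upt_in, of 0] in auto)
  then show ?thesis using eval_simplices_chain[OF assms(2,1)] by simp
qed

text \<open>The homotopy formula for the universal simplex, evaluated on \<open>\<phi>\<close>. On a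
  cocycle the boundary of the homotopy evaluates to zero, and the other homotopy term is a
  coboundary.\<close>

lemma to_simplex_to_cube:
  assumes "\<phi> \<in> simplex_cochains (Suc n)" "s \<in> chains C (Suc n)"
    "\<And>s. s \<in> chains C (Suc (Suc n)) \<Longrightarrow> simplex_cobd \<phi> s = Zero A W (Fo G (chain_comp s))"
  shows "to_simplex (Suc n) (to_cube (Suc n) \<phi>) s = \<phi> s \<oplus>\<^sub>A simplex_cobd (op_ss (simplex_homotopy n) \<phi>) s"
proof -
  note D = Cat.diagram_chain[OF assms(2)]
  note ls = chains_length[OF assms(2)]
  let ?v = "[0..<Suc (Suc n)]"
  let ?E = "eval_simplices (chain_ob C s) (chain_ar C s) 0 (Suc n) \<phi>"
  let ?x = "frag_extend (simplex_homotopy n) (simplex_boundary ?v)"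
  let ?y = "frag_extend simplex_boundary (simplex_homotopy (Suc n) ?v)"
  have "to_simplex (Suc n) (to_cube (Suc n) \<phi>) s
      = ?E (frag_extend (cube_to_simplices (Suc n)) (frag_of (simplex_to_cube ?v)))"
    unfolding op_sc_def ls
    by (rule eval_cube_to_simplices[OF D _ assms(1)]) (use simplex_to_cube_in[OF upt_in, of "Suc n"] in auto)
  also have "frag_extend (cube_to_simplices (Suc n)) (frag_of (simplex_to_cube ?v)) = (frag_of ?v + ?x) + ?y"
    using boundary_simplex_homotopy[of ?v "Suc n"]
    by (simp del: upt_Suc cube_to_simplices.simps simplex_homotopy.simps)
  also have "?E \<dots> = (?E (frag_of ?v) \<oplus>\<^sub>A ?E ?x) \<oplus>\<^sub>A ?E ?y"
    using eval_simplices_add[OF D, of 0 "Suc n" \<phi>] by simp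
  also have "?E (frag_of ?v) = \<phi> s" by (rule eval_simplices_chain[OF assms(2,1)])
  also have "?E ?x = simplex_cobd (op_ss (simplex_homotopy n) \<phi>) s"
    unfolding op_ss_def[of simplex_boundary] ls
    by (rule eval_simplex_homotopy[symmetric, OF D _ assms(1) simplices_in_boundary[OF upt_in]]) simp
  also have "?E ?y = eval_simplices (chain_ob C s) (chain_ar C s) 0 (Suc n) (simplex_cobd \<phi>) (simplex_homotopy (Suc n) ?v)"
    by (rule eval_simplex_coboundary[symmetric, OF D _ assms(1) keys_simplex_homotopy[OF upt_in]]) simp
  also have "\<dots> = Zero A W (Fo G (chain_ar C s 0 (Suc n)))"
    by (rule eval_simplices_zero[OF D _ assms(3) keys_simplex_homotopy[OF upt_in]]) simp_all
  also have "(\<phi> s \<oplus>\<^sub>A simplex_cobd (op_ss (simplex_homotopy n) \<phi>) s) \<oplus>\<^sub>A \<dots>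
     = \<phi> s \<oplus>\<^sub>A simplex_cobd (op_ss (simplex_homotopy n) \<phi>) s"
  proof (rule A.Add_Zero[OF A.Add_in])
    have "chain_ar C s 0 (Suc n) = chain_comp s" using chain_ar_snd[of s] ls by simp
    then show "\<phi> s \<in> Hom A W (Fo G (chain_ar C s 0 (Suc n)))"
       "simplex_cobd (op_ss (simplex_homotopy n) \<phi>) s \<in> Hom A W (Fo G (chain_ar C s 0 (Suc n)))"
      using assms(1,2) op_ss_in[of simplex_boundary "op_ss (simplex_homotopy n) \<phi>" "Suc n"] by (auto simp: simplex_cochains_def)
  qed
  finally show ?thesis .
qed

lemma to_cube_to_simplex:
  assumes "\<psi> \<in> cube_cochains n" "normalized n \<psi>" "g \<in> cubes n"
    "\<And>g. g \<in> cubes (Suc n) \<Longrightarrow> cube_cobd n \<psi> g = Zero A W (Fo G (diag (Suc n) g))"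
  shows "to_cube n (to_simplex n \<psi>) g
    = \<psi> g \<oplus>\<^sub>A (if n = 0 then Zero A W (Fo G (diag n g))
                     else cube_cobd (n - 1) (op_cc (n - 1) n (cube_homotopy (n - 1)) \<psi>) g)"
proof -
  note D = Cat.diagram_cube[OF assms(3)]
  let ?E = "eval_cubes (cube_ob n g) (cube_ar n g) origin (corner n) n \<psi>"
  let ?Z = "Zero A W (Fo G (cube_ar n g origin (corner n)))"
  let ?t = "truncate n"
  let ?st = "simplices_to_cubes (cube_to_simplices n ?t)"
  let ?h = "if n = 0 then 0 else frag_extend (cube_homotopy (n - 1)) (cube_boundary n ?t)"
  let ?b = "frag_extend (cube_boundary (Suc n)) (cube_homotopy n ?t)"
  have t: "depends n ?t" using truncate_in[of n] by (auto simp: cubes_in_def)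
  have kb: "supp ?b \<subseteq> cubes_in n origin (corner n)"
    by (intro keys_frag_extend_in cubes_in_boundary) (use keys_cube_homotopy[OF truncate_in] in blast)
  have kst: "supp ?st \<subseteq> cubes_in n origin (corner n)"
    by (intro keys_simplices_to_cubes keys_cube_to_simplices truncate_in)
  have kh: "supp ?h \<subseteq> cubes_in n origin (corner n)"
  proof (cases n)
    case (Suc m)
    have "supp (frag_extend (cube_homotopy m) (cube_boundary (Suc m) (truncate (Suc m))))
        \<subseteq> cubes_in (Suc m) origin (corner (Suc m))"
      by (intro keys_frag_extend_in keys_cube_homotopy) (use cubes_in_boundary[OF truncate_in] in blast)
    then show ?thesis by (simp add: Suc)
  qed simp
  let ?d = "?b - (?st - frag_of ?t - ?h)"
  have kd: "supp ?d \<subseteq> cubes_in n origin (corner n)"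
    using truncate_in[of n] by (intro keys_diff_in kb kst kh) simp
  have "to_cube n (to_simplex n \<psi>) g = ?E ?st"
    unfolding op_cs_def by (rule eval_simplex_to_cube[OF D bot_corner assms(1) keys_cube_to_simplices[OF truncate_in]])
  \<comment> \<open>Adding the degenerate chain \<open>?d\<close> does not change the value of the
    normalized \<open>\<psi>\<close>, and it turns the homotopy formula into an equation of
    chains.\<close>
  also have st: "?E ?st = ?E (?st + ?d)"
    using eval_cubes_add[OF D bot_corner, of n n \<psi> ?st ?d] eval_cubes_in[OF D bot_corner, of n n \<psi> ?st]
      eval_cubes_degenerate[OF D bot_corner assms(2) kd boundary_cube_homotopy[OF t]] A.Add_Zero by simp
  also have "?st + ?d = (frag_of ?t + ?h) + ?b" by simp
  also have "?E \<dots> = (?E (frag_of ?t) \<oplus>\<^sub>A ?E ?h) \<oplus>\<^sub>A ?E ?b"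
    using eval_cubes_add[OF D bot_corner, of n n \<psi>] by (simp only:)
  also have "?E ?b = ?Z"
  proof -
    have "?E ?b = eval_cubes (cube_ob n g) (cube_ar n g) origin (corner n) (Suc n) (cube_cobd n \<psi>) (cube_homotopy n ?t)"
      by (rule eval_cube_coboundary[symmetric, OF D bot_corner assms(1) keys_cube_homotopy[OF truncate_in]])
    also have "\<dots> = ?Z"
      by (rule eval_cubes_zero[OF D bot_corner assms(4) keys_cube_homotopy[OF truncate_in]])
    finally show ?thesis .
  qed
  also have "(?E (frag_of ?t) \<oplus>\<^sub>A ?E ?h) \<oplus>\<^sub>A ?Z = ?E (frag_of ?t) \<oplus>\<^sub>A ?E ?h"
    by (intro A.Add_Zero A.Add_in eval_cubes_in[OF D bot_corner])
  also have "?E (frag_of ?t) = \<psi> g" by (rule eval_cubes_cube[OF assms(3,1)])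
  also have "?E ?h = (if n = 0 then Zero A W (Fo G (diag n g))
                     else cube_cobd (n - 1) (op_cc (n - 1) n (cube_homotopy (n - 1)) \<psi>) g)"
  proof (cases n)
    case 0
    then show ?thesis using eval_cubes_0[OF D bot_corner] by (simp add: diag_eq)
  next
    case (Suc m)
    have "eval_cubes (cube_ob (Suc m) g) (cube_ar (Suc m) g) origin (corner (Suc m)) m (op_cc m (Suc m) (cube_homotopy m) \<psi>) (cube_boundary (Suc m) (truncate (Suc m)))
      = eval_cubes (cube_ob (Suc m) g) (cube_ar (Suc m) g) origin (corner (Suc m)) (Suc m) \<psi> (frag_extend (cube_homotopy m) (cube_boundary (Suc m) (truncate (Suc m))))"
      by (rule eval_cube_homotopy[OF D[unfolded Suc] bot_corner assms(1)[unfolded Suc] cubes_in_boundary[OF truncate_in]])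
    then show ?thesis by (simp add: Suc op_cc_def[of "Suc m"])
  qed
  finally show ?thesis .
qed

lemma op_cs_cong:
  assumes "\<And>s. s \<in> chains C m \<Longrightarrow> \<phi> s = \<phi>' s" "supp (F (truncate n)) \<subseteq> simplices_in m origin (corner n)"
    "g \<in> cubes n"
  shows "op_cs n F \<phi> g = op_cs n F \<phi>' g"
  unfolding op_cs_def eval_simplices_def
  by (rule comm_group.lin_cong[OF group[OF Cat.diagram_cube[OF assms(3)] bot_corner]])
    (use assms(1)[OF Cat.chain_of_in[OF Cat.diagram_cube[OF assms(3)]]] assms(2) in \<open>auto simp: eval_simplex_def\<close>)

text \<open>Injectivity in degree 0, where no homotopy term occurs and the round trip returns
  \<open>\<psi>\<close> itself.\<close>

lemma normalized_cocycle_0: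
  assumes "\<psi> \<in> cube_cochains 0" "normalized 0 \<psi>" "g \<in> functors (cube_poset 0) C"
    "\<And>g. g \<in> cubes (Suc 0) \<Longrightarrow> cube_cobd 0 \<psi> g = Zero A W (Fo G (diag (Suc 0) g))"
    "\<And>s. s \<in> chains C 0 \<Longrightarrow> to_simplex 0 \<psi> s = Zero A W (Fo G (chain_comp s))"
  shows "\<psi> g = Zero A W (Fo G (diag 0 g))"
proof -
  have "to_cube 0 (to_simplex 0 \<psi>) g = Zero A W (Fo G (diag 0 g))"
    unfolding op_cs_def diag_eq
    by (rule eval_simplices_zero[OF Cat.diagram_cube[OF assms(3)] bot_corner assms(5) keys_cube_to_simplices[OF truncate_in]])
  moreover have "\<psi> g \<in> Hom A W (Fo G (diag 0 g))" using assms(1,3) by (auto simp: cube_cochains_def)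
  ultimately show ?thesis using to_cube_to_simplex[OF assms(1-4)] A.Add_Zero by simp
qed

text \<open>Injectivity in positive degree: if the image of the cocycle is the coboundary of
  \<open>\<chi>\<close>, then mapping back exhibits \<open>\<psi>\<close> as the coboundary of
  \<open>to_cube n \<chi>\<close> minus that of the homotopy term.\<close>

lemma normalized_cocycle_Suc:
  assumes "\<psi> \<in> cube_cochains (Suc n)" "normalized (Suc n) \<psi>" "g \<in> cubes (Suc n)"
    "\<And>g. g \<in> cubes (Suc (Suc n)) \<Longrightarrow> cube_cobd (Suc n) \<psi> g = Zero A W (Fo G (diag (Suc (Suc n)) g))"
    "\<chi> \<in> simplex_cochains n"
    "\<And>s. s \<in> chains C (Suc n) \<Longrightarrow> to_simplex (Suc n) \<psi> s = simplex_cobd \<chi> s"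
  shows "cube_cobd n (to_cube n \<chi>) g = \<psi> g \<oplus>\<^sub>A cube_cobd n (op_cc n (Suc n) (cube_homotopy n) \<psi>) g"
proof -
  have "cube_cobd n (to_cube n \<chi>) g = to_cube (Suc n) (to_simplex (Suc n) \<psi>) g"
    unfolding cube_cobd_to_cube[OF assms(5,3)]
    by (rule op_cs_cong[where F = "cube_to_simplices (Suc n)", OF _ keys_cube_to_simplices[OF truncate_in] assms(3)]) (simp add: assms(6))
  then show ?thesis using to_cube_to_simplex[OF assms(1-4)] by simp
qed

end

section \<open>The complexes of the theorem\<close>

lemma Fo_cubical_nerve [simp]: "Fo (cubical_nerve C) n = functors (cube_poset n) C"
  by (simp add: cubical_nerve_def)

lemma act_cubical_nerve:
  "g \<in> functors (cube_poset n) C \<Longrightarrow> act (cubical_nerve C) (m, n, \<theta>) g = ftor_comp (cube_poset m) g (cube_ftor_of \<theta>)"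
  by (simp add: act_def cubical_nerve_def)

text \<open>The alternating sum becomes the linear extension applied to one formal sum of indices,
  the form to which \<open>lin_hom\<close> and \<open>lin_extend\<close> apply.\<close>

lemma (in preadditive_category) alternating_sum_lin:
  assumes "finite I" "x \<in> Obj A" "y \<in> Obj A" "\<And>i. i \<in> I \<Longrightarrow> f i \<in> Hom A x y"
  shows "alternating_sum A x y I f = lin (hom_group A x y) f (\<Sum>i\<in>I. frag_cmul ((-1) ^ i) (frag_of i))"
proof -
  interpret comm_group "hom_group A x y" using hom_group assms by auto
  have "f i \<in> carrier (hom_group A x y)" if "i \<in> I" for i using assms(4)[OF that] by (simp add: hom_group_simps)
  then show ?thesis unfolding alternating_sum_def lin_sum[OF assms(1)] lin_sign
    by (intro finprod_cong') (auto simp: lin_of)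
qed

lemma keys_sum_frag: "supp (\<Sum>i\<in>I. frag_cmul (a i) (frag_of i)) \<subseteq> I"
  by (rule order_trans[OF keys_sum]) auto

lemma simplex_to_cube_ends:
  "length v = Suc n \<Longrightarrow> simplex_to_cube v origin = hd v \<and> simplex_to_cube v (corner n) = last v"
proof (induction n arbitrary: v)
  case 0
  then show ?case by (auto simp: length_Suc_conv)
next
  case (Suc n)
  then obtain p u where v: "v = p # u" "length u = Suc n" "u \<noteq> []" by (auto simp: length_Suc_conv)
  moreover have "(\<lambda>j. corner (Suc n) (Suc j)) = corner n" "corner (Suc n) 0" by (auto simp: corner_def)
  ultimately show ?case using Suc.IH[of u] by (simp add: simplex_to_cube_Cons cone_cube_def)
qed

text \<open>Products are assumed for the index sets that occur, which keeps the type
  \<open>'u\<close> out of the locale. These assumptions do not mention \<open>W\<close>, so the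
  test object can be exchanged, as \<open>comparison_at\<close> does.\<close>

locale comparison = coefficients C A G W + abelian_category A
  for C :: "('o, 'm, 'y) precat_scheme" and A :: "('p, 'q, 'z) addcat_scheme"
    and G :: "('m, 'm \<times> 'm \<times> 'm \<times> 'm, 'p, 'q) ftor" and W +
  assumes prod_chains: "(\<And>s. s \<in> chains C n \<Longrightarrow> X s \<in> Obj A)
      \<Longrightarrow> is_product A (chains C n) X (prod_ob A (chains C n) X) (prod_pr A (chains C n) X)"
    and prod_cubes: "(\<And>g. g \<in> cubes n \<Longrightarrow> X' g \<in> Obj A)
      \<Longrightarrow> is_product A (cubes n) X' (prod_ob A (cubes n) X') (prod_pr A (cubes n) X')"
    and prod_nat: "(\<And>i. i \<in> {1..n} \<Longrightarrow> X'' i \<in> Obj A)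
      \<Longrightarrow> is_product A {1..n::nat} X'' (prod_ob A {1..n} X'') (prod_pr A {1..n} X'')"
begin

section \<open>The Baues-Wirsching complex in components\<close>

abbreviation "BWo \<equiv> BW_ob A C G"
abbreviation "BWp \<equiv> BW_pr A C G"
abbreviation "BWd \<equiv> BW_diff A C G"

lemma path_comp_Obj: "s \<in> chains C n \<Longrightarrow> Fo G (chain_comp s) \<in> Obj A"
  using Cat.path_comp_in[of "fst s" "snd s"] by (intro Fo_G) (auto simp: chains_def Hom_def)

lemma BW_product:
  "is_product A (chains C n) (\<lambda>(c, \<alpha>s). Fo G (path_comp C c \<alpha>s)) (BWo n) (BWp n)"
  unfolding BW_ob_def BW_pr_def by (rule prod_chains) (use path_comp_Obj in \<open>auto simp: split_def\<close>)

lemma BWo_in: "BWo n \<in> Obj A"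
  using BW_product by (simp add: is_product_def)

lemma BWp_in: "s \<in> chains C n \<Longrightarrow> BWp n s \<in> Hom A (BWo n) (Fo G (chain_comp s))"
  using BW_product[of n] by (auto simp: is_product_def split_def)

lemma chain_ar_Suc:
  assumes "s \<in> chains C n" "i < n" shows "chain_ar C s i (Suc i) = snd s ! i"
proof -
  have "arrows (chain_ar C s) [0..<Suc n] ! i = snd s ! i"
    using Cat.chain_of_chain[OF assms(1)] by (metis chain_of_def snd_conv)
  then show ?thesis using assms(2) by (simp add: nth_arrows del: upt_Suc)
qed

text \<open>Deleting an outer vertex shortens the interval, and the push is the action of the
  dropped arrow; deleting an inner vertex composes two neighbouring arrows, and the push is an
  identity. So the three cases of \<open>BW_face\<close> are one formula.\<close>

lemma BW_face_eval:
  assumes s: "s \<in> chains C (Suc n)" and i: "i \<le> Suc n"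
  defines "v \<equiv> [0..<Suc (Suc n)]"
  defines "u \<equiv> take i v @ drop (Suc i) v"
  shows "BW_face A C G n s i = push (chain_ar C s) (hd u) (last u) 0 (Suc n) \<bullet> BWp n (chain_of (chain_ob C s) (chain_ar C s) u)"
proof -
  obtain c \<alpha>s where cs: "s = (c, \<alpha>s)" "length \<alpha>s = Suc n" "is_path C c \<alpha>s" using s by (auto simp: chains_def)
  have ne: "\<alpha>s \<noteq> []" using cs by auto
  note D = Cat.diagram_chain[OF s]
  have full: "chain_ar C s 0 (Suc n) = path_comp C c \<alpha>s" using Cat.chain_ar_full[OF cs(2)] cs(1) by simp
  have cod: "Cod C (path_comp C c \<alpha>s) = chain_ob C s (Suc n)"
    using diagramD(3)[OF D, of 0 "Suc n"] full by (simp add: Hom_def)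
  have un: "u ! j = (if j < i then j else Suc j)" if "j < Suc n" for j
    using that i by (auto simp: u_def v_def nth_append min_def simp del: upt_Suc)
  have lu: "length u = Suc n" using i by (simp add: u_def v_def min_def del: upt_Suc)
  then have une: "u \<noteq> []" by auto
  have hu: "hd u = (if i = 0 then 1 else 0)" using un[of 0] une by (simp add: hd_conv_nth)
  have lastu: "last u = (if i = Suc n then n else Suc n)" using un[of n] une lu i by (auto simp: last_conv_nth)
  have cod0: "chain_ob C s 0 = c" "chain_ob C s 1 = Cod C (hd \<alpha>s)"
    using ne by (auto simp: chain_ob_def cs(1) neq_Nil_conv)
  note arS = chain_ar_Suc[OF s]
  have arr: "arrows (chain_ar C s) u = (if i = 0 then tl \<alpha>s else if i = Suc n then butlast \<alpha>s
      else take (i - 1) \<alpha>s @ [\<alpha>s ! i \<cdot>\<^bsub>C\<^esub> \<alpha>s ! (i - 1)] @ drop (i + 1) \<alpha>s)" (is "_ = ?r")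
  proof (rule nth_equalityI)
    show "length (arrows (chain_ar C s) u) = length ?r" using cs(2) i by (auto simp: lu)
    fix j assume "j < length (arrows (chain_ar C s) u)"
    then have j: "j < n" by (simp add: lu)
    have "arrows (chain_ar C s) u ! j = chain_ar C s (u ! j) (u ! Suc j)" using j by (simp add: nth_arrows lu)
    \<comment> \<open>Only the arrow with \<open>Suc j = i\<close> jumps over the deleted vertex; by
      functoriality of the diagram it is a composite of two neighbours.\<close>
    also have "\<dots> = (if j < i then if Suc j < i then \<alpha>s ! j else chain_ar C s j (Suc (Suc j)) else \<alpha>s ! Suc j)"
      using j un[of j] un[of "Suc j"] arS[of j] arS[of "Suc j"] cs(1) by simp
    also have "chain_ar C s j (Suc (Suc j)) = \<alpha>s ! Suc j \<cdot>\<^bsub>C\<^esub> \<alpha>s ! j"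
      using diagramD(4)[OF D, of j "Suc j" "Suc (Suc j)"] arS[of j] arS[of "Suc j"] j cs(1) by simp
    also have "(if j < i then if Suc j < i then \<alpha>s ! j else \<alpha>s ! Suc j \<cdot>\<^bsub>C\<^esub> \<alpha>s ! j else \<alpha>s ! Suc j) = ?r ! j"
    proof -
      consider "i = 0" | "i = Suc n" | "0 < i" "i \<le> n" using i by linarith
      then show ?thesis
      proof cases
        case 1 then show ?thesis using j cs(2) by (simp add: nth_tl)
      next
        case 2 then show ?thesis using j cs(2) by (simp add: nth_butlast)
      next
        case 3
        then obtain k where k: "i = Suc k" by (cases i) auto
        consider "j < k" | "j = k" | "k < j" by linarith
        then show ?thesis
        proof cases
          case 3
          then obtain l where "j = Suc (k + l)" using less_iff_Suc_add by auto
          then show ?thesis using j cs(2) by (simp add: nth_append k)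
        qed (use j cs(2) 3 in \<open>auto simp: nth_append k\<close>)
      qed
    qed
    finally show "arrows (chain_ar C s) u ! j = ?r ! j" .
  qed
  have "chain_of (chain_ob C s) (chain_ar C s) u = (if i = 0 then (Cod C (hd \<alpha>s), tl \<alpha>s) else if i = Suc n then (c, butlast \<alpha>s)
      else (c, take (i - 1) \<alpha>s @ [\<alpha>s ! i \<cdot>\<^bsub>C\<^esub> \<alpha>s ! (i - 1)] @ drop (i + 1) \<alpha>s))" (is "_ = ?ch")
    using cod0 by (auto simp: chain_of_def arr hu)
  moreover have "push (chain_ar C s) (hd u) (last u) 0 (Suc n) =
     (if i = 0 then Fa G (path_comp C (Cod C (hd \<alpha>s)) (tl \<alpha>s), path_comp C c \<alpha>s,
             (hd \<alpha>s, Id C (Cod C (path_comp C c \<alpha>s))))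
      else if i = Suc n then Fa G (path_comp C c (butlast \<alpha>s), path_comp C c \<alpha>s, (Id C c, last \<alpha>s))
      else Id A (Fo G (path_comp C c \<alpha>s)))"
  proof -
    consider "i = 0" | "i = Suc n" | "i \<noteq> 0" "i \<noteq> Suc n" by blast
    then show ?thesis
    proof cases
      case 1
      have "chain_ar C s 1 (Suc n) = path_comp C (Cod C (hd \<alpha>s)) (tl \<alpha>s)"
        using cs(2) cod0(2) by (simp add: chain_ar_def cs(1) drop_Suc)
      moreover have "chain_ar C s 0 (Suc 0) = hd \<alpha>s" using arS[of 0] ne cs(1) by (simp add: hd_conv_nth)
      ultimately show ?thesis using 1 full cod diagramD(2)[OF D, of "Suc n"] by (simp add: push_def hu lastu)
    next
      case 2
      have "chain_ar C s 0 n = path_comp C c (butlast \<alpha>s)"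
        using cs(2) cod0(1) by (simp add: chain_ar_def cs(1) butlast_conv_take)
      moreover have "chain_ar C s n (Suc n) = last \<alpha>s" using arS[of n] ne cs(1,2) by (simp add: last_conv_nth)
      ultimately show ?thesis using 2 full cod0(1) diagramD(2)[OF D, of 0] by (simp add: push_def hu lastu)
    next
      case 3
      then show ?thesis using push_id[OF D, of 0 "Suc n"] full by (simp add: hu lastu)
    qed
  qed
  moreover have "Id A (Fo G (path_comp C c \<alpha>s)) \<bullet> BWp n ?ch = BWp n ?ch" if "i \<noteq> 0" "i \<noteq> Suc n"
  proof -
    have "u \<in> simplices_in n 0 (Suc n)"
      unfolding simplices_in_def u_def v_def using i
      by (auto simp: sorted_wrt_append sorted_wrt_take sorted_wrt_drop sorted_wrt_upt min_def take_upt drop_upt simp del: upt_Suc)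
    from Cat.chain_of_in[OF D this] Cat.path_comp_chain_of[OF D this]
    show ?thesis using that A.Id_Comp BWp_in[of ?ch n] full calculation by (simp add: hu lastu)
  qed
  ultimately show ?thesis by (auto simp: BW_face_def cs(1))
qed

text \<open>The dictionary between morphisms from \<open>W\<close> into the product and families of
  components; the morphism determines \<open>\<phi>\<close> on chains only.\<close>

definition rep_simplex :: "nat \<Rightarrow> 'q \<Rightarrow> ('o \<times> 'm list \<Rightarrow> 'q) \<Rightarrow> bool" where
  "rep_simplex n y \<phi> \<longleftrightarrow> y \<in> Hom A W (BWo n) \<and> (\<forall>s \<in> chains C n. BWp n s \<bullet> y = \<phi> s)"

lemma rep_simplex_cochain: "rep_simplex n y \<phi> \<Longrightarrow> \<phi> \<in> simplex_cochains n"
  using A.Comp_in[OF _ BWp_in] by (force simp: rep_simplex_def simplex_cochains_def)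

lemma rep_simplex_ex: "\<phi> \<in> simplex_cochains n \<Longrightarrow> \<exists>y. rep_simplex n y \<phi>"
  using BW_product[of n, unfolded is_product_def, THEN conjunct2, THEN conjunct2, rule_format, OF W, of \<phi>]
  by (auto simp: rep_simplex_def simplex_cochains_def split_def)

lemma rep_simplex_self: "y \<in> Hom A W (BWo n) \<Longrightarrow> rep_simplex n y (\<lambda>s. BWp n s \<bullet> y)"
  by (simp add: rep_simplex_def)

lemma rep_simplex_unique:
  "rep_simplex n y \<phi> \<Longrightarrow> rep_simplex n y' \<phi>' \<Longrightarrow> (\<And>s. s \<in> chains C n \<Longrightarrow> \<phi> s = \<phi>' s) \<Longrightarrow> y = y'"
  by (rule is_product_unique[OF BW_product A.category_axioms]) (auto simp: rep_simplex_def)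

lemma rep_simplex_zero: "rep_simplex n (Zero A W (BWo n)) (\<lambda>s. Zero A W (Fo G (chain_comp s)))"
  using A.Zero_in[OF W BWo_in] A.Comp_Zero[OF BWp_in W] by (simp add: rep_simplex_def)

lemma rep_simplex_add:
  "rep_simplex n y \<phi> \<Longrightarrow> rep_simplex n y' \<phi>' \<Longrightarrow> rep_simplex n (y \<oplus>\<^sub>A y') (\<lambda>s. \<phi> s \<oplus>\<^sub>A \<phi>' s)"
  using A.Add_in A.Comp_Add[OF _ _ BWp_in] by (auto simp: rep_simplex_def)

lemma BW_summand_in:
  assumes "s \<in> chains C (Suc n)"
  shows "i \<in> {0..n+1} \<Longrightarrow> BW_face A C G n s i \<in> Hom A (BWo n) (Fo G (chain_comp s))"
    and "alternating_sum A (BWo n) (Fo G (chain_comp s)) {0..n+1} (BW_face A C G n s)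
      \<in> Hom A (BWo n) (Fo G (chain_comp s))"
proof -
  have f: "BW_face A C G n s i \<in> Hom A (BWo n) (Fo G (chain_comp s))" if i: "i \<in> {0..n+1}" for i
  proof -
    note D = Cat.diagram_chain[OF assms]
    let ?v = "[0..<Suc (Suc n)]"
    let ?u = "take i ?v @ drop (Suc i) ?v"
    have u: "?u \<in> simplices_in n 0 (Suc n)"
      unfolding simplices_in_def using i
      by (auto simp: sorted_wrt_append sorted_wrt_take sorted_wrt_drop sorted_wrt_upt min_def take_upt drop_upt simp del: upt_Suc)
    have "i \<le> Suc n" using i by simp
    from BW_face_eval[OF assms this] show ?thesis
      using A.Comp_in[OF BWp_in[OF Cat.chain_of_in[OF D u], unfolded Cat.path_comp_chain_of[OF D u]] push_in[OF D, of 0 _ _ "Suc n"]]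
       simplex_bounds[OF D u] chain_ar_snd[of s] chains_length[OF assms] by (simp del: upt_Suc)
  qed
  then show "i \<in> {0..n+1} \<Longrightarrow> BW_face A C G n s i \<in> Hom A (BWo n) (Fo G (chain_comp s))" .
  interpret comm_group "hom_group A (BWo n) (Fo G (chain_comp s))"
    using A.hom_group[OF BWo_in path_comp_Obj[OF assms]] .
  show "alternating_sum A (BWo n) (Fo G (chain_comp s)) {0..n+1} (BW_face A C G n s)
      \<in> Hom A (BWo n) (Fo G (chain_comp s))"
    by (subst A.alternating_sum_lin[OF _ BWo_in path_comp_Obj[OF assms] f])
      (use lin_closed in \<open>auto simp: A.hom_group_simps\<close>)
qed

lemma BWd_props:
  shows "BWd n \<in> Hom A (BWo n) (BWo (Suc n))"
    and "s \<in> chains C (Suc n) \<Longrightarrow> BWp (Suc n) s \<bullet> BWd n =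
      alternating_sum A (BWo n) (Fo G (chain_comp s)) {0..n+1} (BW_face A C G n s)"
proof -
  let ?h = "\<lambda>(c, \<alpha>s). alternating_sum A (BWo n) (Fo G (path_comp C c \<alpha>s)) {0..n+1} (BW_face A C G n (c, \<alpha>s))"
  have h: "?h s \<in> Hom A (BWo n) (case s of (c, \<alpha>s) \<Rightarrow> Fo G (path_comp C c \<alpha>s))" if "s \<in> chains C (Suc n)" for s
    using BW_summand_in(2)[OF that] by (simp add: split_def)
  note p = prod_lift[OF BW_product[of "Suc n", unfolded BW_ob_def BW_pr_def] BWo_in[of n], of ?h, OF h]
  show "BWd n \<in> Hom A (BWo n) (BWo (Suc n))"
    using p(1) by (simp add: BW_diff_def BW_ob_def[of A C G "Suc n"])
  show "s \<in> chains C (Suc n) \<Longrightarrow> BWp (Suc n) s \<bullet> BWd n =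
      alternating_sum A (BWo n) (Fo G (chain_comp s)) {0..n+1} (BW_face A C G n s)"
    using p(2)[of s] by (simp add: BW_diff_def BW_pr_def split_def)
qed

lemma rep_simplex_cobd:
  assumes "rep_simplex n y \<phi>" shows "rep_simplex (Suc n) (BWd n \<bullet> y) (simplex_cobd \<phi>)"
  unfolding rep_simplex_def
proof (intro conjI ballI)
  have y: "y \<in> Hom A W (BWo n)" "\<And>s. s \<in> chains C n \<Longrightarrow> BWp n s \<bullet> y = \<phi> s"
    using assms by (auto simp: rep_simplex_def)
  then show "BWd n \<bullet> y \<in> Hom A W (BWo (Suc n))" using A.Comp_in BWd_props(1) by blast
  fix s assume s: "s \<in> chains C (Suc n)"
  let ?P = "Fo G (chain_comp s)"
  let ?sg = "\<Sum>i\<in>{0..n+1}. frag_cmul ((-1) ^ i) (frag_of i)"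
  let ?v = "[0..<Suc (Suc n)]"
  let ?u = "\<lambda>i. take i ?v @ drop (Suc i) ?v"
  let ?ob = "chain_ob C s" and ?ar = "chain_ar C s"
  note D = Cat.diagram_chain[OF s]
  interpret H: comm_group "hom_group A (BWo n) ?P" using A.hom_group[OF BWo_in path_comp_Obj[OF s]] .
  have ar: "?ar 0 (Suc n) = chain_comp s" using chain_ar_snd[of s] chains_length[OF s] by simp
  interpret MM: comm_group "hom_group A W ?P" using group[OF D, of 0 "Suc n"] by (simp add: ar)
  have "BWp (Suc n) s \<bullet> (BWd n \<bullet> y) = lin (hom_group A (BWo n) ?P) (BW_face A C G n s) ?sg \<bullet> y"
    by (simp only: A.Comp_assoc[OF y(1) BWd_props(1) BWp_in[OF s]] BWd_props(2)[OF s]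
      A.alternating_sum_lin[OF finite_atLeastAtMost BWo_in path_comp_Obj[OF s] BW_summand_in(1)[OF s]])
  also have "\<dots> = lin (hom_group A W ?P) (\<lambda>i. BW_face A C G n s i \<bullet> y) ?sg"
    by (rule H.lin_hom[OF MM.comm_group_axioms A.right_comp_hom[OF y(1)]])
      (use keys_sum_frag[of "\<lambda>i. (-1) ^ i" "{0..n+1}"] BW_summand_in(1)[OF s] A.hom_group_simps in blast)
  also have "\<dots> = lin (hom_group A W ?P) (\<lambda>i. lin (hom_group A W ?P) (eval_simplex ?ob ?ar 0 (Suc n) \<phi>) (frag_of (?u i))) ?sg"
  proof (rule MM.lin_cong)
    fix i assume "i \<in> supp ?sg"
    then have i: "i \<le> Suc n" using keys_sum_frag[of "\<lambda>i. (-1) ^ i" "{0..n+1}"] by auto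
    have u: "?u i \<in> simplices_in n 0 (Suc n)"
      unfolding simplices_in_def using i
      by (auto simp: sorted_wrt_append sorted_wrt_take sorted_wrt_drop sorted_wrt_upt min_def take_upt drop_upt simp del: upt_Suc)
    have "BW_face A C G n s i \<bullet> y = eval_simplex ?ob ?ar 0 (Suc n) \<phi> (?u i)"
      unfolding BW_face_eval[OF s i] eval_simplex_def
      using A.Comp_assoc[OF y(1) BWp_in[OF Cat.chain_of_in[OF D u], unfolded Cat.path_comp_chain_of[OF D u]] push_in[OF D, of 0 _ _ "Suc n"]]
        simplex_bounds[OF D u] y(2)[OF Cat.chain_of_in[OF D u]] by simp
    then show "BW_face A C G n s i \<bullet> y = lin (hom_group A W ?P) (eval_simplex ?ob ?ar 0 (Suc n) \<phi>) (frag_of (?u i))"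
      using MM.lin_of[of "eval_simplex ?ob ?ar 0 (Suc n) \<phi>" "?u i"]
        eval_simplex_in[OF D rep_simplex_cochain[OF assms] u] ar by simp
  qed
  also have "\<dots> = lin (hom_group A W ?P) (eval_simplex ?ob ?ar 0 (Suc n) \<phi>) (frag_extend (\<lambda>i. frag_of (?u i)) ?sg)"
    by (rule MM.lin_extend[symmetric])
  \<comment> \<open>Collecting the faces over the signed sum of indices gives the closed form
    \<open>simplex_boundary_sum\<close>.\<close>
  also have "frag_extend (\<lambda>i. frag_of (?u i)) ?sg = simplex_boundary ?v"
    by (simp only: simplex_boundary_sum frag_extend_sum[OF finite_atLeastAtMost] o_def frag_extend_cmul frag_extend_of)
      (simp add: atLeast0AtMost lessThan_Suc_atMost del: upt_Suc sum.lessThan_Suc sum.atMost_Suc)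
  finally show "BWp (Suc n) s \<bullet> (BWd n \<bullet> y) = simplex_cobd \<phi> s"
    by (simp add: op_ss_def eval_simplices_def chains_length[OF s] ar del: upt_Suc)
qed

end

lemma cube_face_cases:
  assumes "1 \<le> i" "i \<le> n"
  obtains \<theta> where "cube_face n i e = (n - 1, n, \<theta>)" "(n - 1, n, \<theta>) \<in> cube_maps"
    "\<And>x. x \<in> vertices (n - 1) \<Longrightarrow> \<theta> x = take (i - 1) x @ e # drop (i - 1) x"
  using cube_maps.face[OF assms, of e] by (simp add: cube_face_def)

lemma cube_degen_cases:
  assumes "1 \<le> i" "i \<le> n"
  obtains \<theta> where "cube_degen n i = (n, n - 1, \<theta>)" "(n, n - 1, \<theta>) \<in> cube_maps"
    "\<And>x. x \<in> vertices n \<Longrightarrow> \<theta> x = take (i - 1) x @ drop i x"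
  using cube_maps.degen[OF assms] by (simp add: cube_degen_def)

context comparison
begin

section \<open>The cubical complex in components\<close>

abbreviation "FX \<equiv> ftor_comp (elements (cubical_nerve C)) G diag_ftor"
abbreviation "Ko \<equiv> cub_ob A (cubical_nerve C) FX"
abbreviation "Kp \<equiv> cub_pr A (cubical_nerve C) FX"
abbreviation "Kf \<equiv> cub_d A (cubical_nerve C) FX"
abbreviation "Ks \<equiv> cub_s A (cubical_nerve C) FX"
abbreviation "Kd \<equiv> cub_diff A (cubical_nerve C) FX"

lemma Fo_FX: "g \<in> cubes n \<Longrightarrow> Fo FX (n, g) = Fo G (diag n g)"
  by (simp add: ftor_comp_def compose_def elements_def diag_ftor_def)

lemma Fa_FX:
  assumes "g \<in> cubes n" "(m, n, \<theta>) \<in> cube_maps"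
  shows "Fa FX (elem_arr (cubical_nerve C) (m, n, \<theta>) g)
    = Fa G (Fa g (\<theta> (bot_vertex m), \<theta> (top_vertex m)), diag n g,
            (Fa g (bot_vertex n, \<theta> (bot_vertex m)), Fa g (\<theta> (top_vertex m), top_vertex n)))"
    and "act (cubical_nerve C) (m, n, \<theta>) g \<in> cubes m"
proof -
  have act: "act (cubical_nerve C) (m, n, \<theta>) g = ftor_comp (cube_poset m) g (cube_ftor_of \<theta>)"
    using act_cubical_nerve[OF assms(1)] .
  show in': "act (cubical_nerve C) (m, n, \<theta>) g \<in> cubes m"
    unfolding act using ftor_comp_functors[OF cat_functor_cube_ftor_of[OF assms(2)] assms(1)] .
  then have "elem_arr (cubical_nerve C) (m, n, \<theta>) g \<in> Arr (elements (cubical_nerve C))"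
    using assms by (simp add: elem_arr_def elements_def)
  moreover have "diag m (act (cubical_nerve C) (m, n, \<theta>) g) = Fa g (\<theta> (bot_vertex m), \<theta> (top_vertex m))"
    by (simp add: act diag_def ftor_comp_def compose_def cube_ftor_of_def bot_vertex_le)
  ultimately show "Fa FX (elem_arr (cubical_nerve C) (m, n, \<theta>) g)
    = Fa G (Fa g (\<theta> (bot_vertex m), \<theta> (top_vertex m)), diag n g,
            (Fa g (bot_vertex n, \<theta> (bot_vertex m)), Fa g (\<theta> (top_vertex m), top_vertex n)))"
    by (simp add: ftor_comp_def compose_def) (simp add: elem_arr_def diag_ftor_def)
qed

lemma diag_Obj: "g \<in> cubes n \<Longrightarrow> Fo G (diag n g) \<in> Obj A"
  using ar_Arr[OF Cat.diagram_cube bot_corner] by (intro Fo_G) (simp add: diag_eq)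

lemma K_product: "is_product A (cubes n) (\<lambda>g. Fo FX (n, g)) (Ko n) (Kp n)"
  unfolding cub_ob_def cub_pr_def Fo_cubical_nerve by (rule prod_cubes) (simp add: Fo_FX diag_Obj)

lemma Ko_in: "Ko n \<in> Obj A"
  using K_product by (simp add: is_product_def)

lemma Kp_in: "g \<in> cubes n \<Longrightarrow> Kp n g \<in> Hom A (Ko n) (Fo G (diag n g))"
  using K_product[of n, unfolded is_product_def, THEN conjunct2, THEN conjunct1] Fo_FX[of g n] by metis

definition rep_cube :: "nat \<Rightarrow> 'q \<Rightarrow> (('o, 'm) cube_ftor \<Rightarrow> 'q) \<Rightarrow> bool" where
  "rep_cube n x \<psi> \<longleftrightarrow> x \<in> Hom A W (Ko n) \<and> (\<forall>g \<in> cubes n. Kp n g \<bullet> x = \<psi> g)"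

lemma rep_cube_cochain: "rep_cube n x \<psi> \<Longrightarrow> \<psi> \<in> cube_cochains n"
  using A.Comp_in[OF _ Kp_in] by (force simp: rep_cube_def cube_cochains_def)

lemma rep_cube_ex: "\<psi> \<in> cube_cochains n \<Longrightarrow> \<exists>x. rep_cube n x \<psi>"
  using K_product[of n, unfolded is_product_def, THEN conjunct2, THEN conjunct2, rule_format, OF W, of \<psi>]
  by (auto simp: rep_cube_def cube_cochains_def Fo_FX)

lemma rep_cube_self: "x \<in> Hom A W (Ko n) \<Longrightarrow> rep_cube n x (\<lambda>g. Kp n g \<bullet> x)"
  by (simp add: rep_cube_def)

lemma rep_cube_unique:
  "rep_cube n x \<psi> \<Longrightarrow> rep_cube n x' \<psi>' \<Longrightarrow> (\<And>g. g \<in> cubes n \<Longrightarrow> \<psi> g = \<psi>' g) \<Longrightarrow> x = x'"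
  by (rule is_product_unique[OF K_product A.category_axioms]) (auto simp: rep_cube_def)

lemma rep_cube_zero: "rep_cube n (Zero A W (Ko n)) (\<lambda>g. Zero A W (Fo G (diag n g)))"
  using A.Zero_in[OF W Ko_in] A.Comp_Zero[OF Kp_in W] by (simp add: rep_cube_def)

lemma rep_cube_add:
  "rep_cube n x \<psi> \<Longrightarrow> rep_cube n x' \<psi>' \<Longrightarrow> rep_cube n (x \<oplus>\<^sub>A x') (\<lambda>g. \<psi> g \<oplus>\<^sub>A \<psi>' g)"
  using A.Add_in A.Comp_Add[OF _ _ Kp_in] by (auto simp: rep_cube_def)

text \<open>The face map on lists of booleans is the formal face of the universal cube, at position
  \<open>i - 1\<close> because \<open>insert_coord\<close> counts from 0. Its coefficient arrow is
  the corresponding push.\<close>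

lemma cube_face_eval:
  fixes g :: "('o, 'm) cube_ftor" and e :: bool
  assumes g: "g \<in> cubes (Suc n)" and i: "i \<in> {1..Suc n}"
  defines "\<eta> \<equiv> face (i - 1) e (truncate (Suc n))"
  shows "act (cubical_nerve C) (cube_face (Suc n) i e) g = cube_of n (cube_ob (Suc n) g) (cube_ar (Suc n) g) \<eta>"
    and "Fa FX (elem_arr (cubical_nerve C) (cube_face (Suc n) i e) g)
       = push (cube_ar (Suc n) g) (\<eta> origin) (\<eta> (corner n)) origin (corner (Suc n))"
    and "\<eta> \<in> cubes_in n origin (corner (Suc n))"
proof -
  have i': "1 \<le> i" "i \<le> Suc n" using i by auto
  obtain \<theta> where \<theta>: "cube_face (Suc n) i e = (n, Suc n, \<theta>)" "(n, Suc n, \<theta>) \<in> cube_maps"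
    "\<And>x. x \<in> vertices n \<Longrightarrow> \<theta> x = take (i - 1) x @ e # drop (i - 1) x"
    using cube_face_cases[OF i', of e] by auto
  have eq: "map (\<eta> (coords x)) [0..<Suc n] = \<theta> x" if "x \<in> vertices n" for x
  proof (rule nth_equalityI)
    obtain k where k: "i = Suc k" using i' by (cases i) auto
    have l: "length x = n" using that by (simp add: vertices_def)
    show "length (map (\<eta> (coords x)) [0..<Suc n]) = length (\<theta> x)" using i' l k by (simp add: \<theta>(3)[OF that])
    fix j assume "j < length (map (\<eta> (coords x)) [0..<Suc n])"
    then have j: "j < Suc n" by simp
    consider "j < k" | "j = k" | l where "j = Suc (k + l)" using less_iff_Suc_add linorder_neqE_nat by metis
    then show "map (\<eta> (coords x)) [0..<Suc n] ! j = \<theta> x ! j"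
      using i' j l unfolding \<theta>(3)[OF that] \<eta>_def k
      by cases (auto simp: face_def truncate_def insert_coord_def coords_def nth_append simp del: upt_Suc)
  qed
  have "x \<in> vertices n \<and> y \<in> vertices n" if "(x, y) \<in> Arr (cube_poset n)" for x y
    using that by (auto simp: cube_poset_def)
  then show "act (cubical_nerve C) (cube_face (Suc n) i e) g = cube_of n (cube_ob (Suc n) g) (cube_ar (Suc n) g) \<eta>"
    unfolding \<theta>(1) act_cubical_nerve[OF g]
    by (auto simp: ftor_comp_def cube_of_def cube_ob_def cube_ar_def compose_def restrict_def fun_eq_iff
      cube_ftor_of_def eq simp del: upt_Suc) (auto simp: cube_poset_def)
  have "map origin [0..<Suc n] = bot_vertex (Suc n)" "map (corner (Suc n)) [0..<Suc n] = top_vertex (Suc n)"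
    by (auto simp: bot_vertex_def map_replicate_const top_vertex_def corner_def intro!: nth_equalityI simp del: upt_Suc replicate_Suc)
  then show "Fa FX (elem_arr (cubical_nerve C) (cube_face (Suc n) i e) g)
       = push (cube_ar (Suc n) g) (\<eta> origin) (\<eta> (corner n)) origin (corner (Suc n))"
    unfolding \<theta>(1) using Fa_FX(1)[OF g \<theta>(2)] eq[of "bot_vertex n"] eq[of "top_vertex n"]
    by (simp add: push_def cube_ar_def diag_def del: upt_Suc)
  show "\<eta> \<in> cubes_in n origin (corner (Suc n))"
    unfolding \<eta>_def using i' by (intro cubes_in_face truncate_in) auto
qed

lemma cub_d_props:
  assumes i: "i \<in> {1..Suc n}"
  shows "Kf (Suc n) i e \<in> Hom A (Ko n) (Ko (Suc n))"
    and "g \<in> cubes (Suc n) \<Longrightarrow> Kp (Suc n) g \<bullet> Kf (Suc n) i e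
      = Fa FX (elem_arr (cubical_nerve C) (cube_face (Suc n) i e) g) \<bullet> Kp n (act (cubical_nerve C) (cube_face (Suc n) i e) g)"
    and "rep_cube n x \<psi> \<Longrightarrow> g \<in> cubes (Suc n) \<Longrightarrow>
      Kp (Suc n) g \<bullet> (Kf (Suc n) i e \<bullet> x)
       = eval_cube (cube_ob (Suc n) g) (cube_ar (Suc n) g) origin (corner (Suc n)) n \<psi> (face (i - 1) e (truncate (Suc n)))"
proof -
  let ?h = "\<lambda>g. Fa FX (elem_arr (cubical_nerve C) (cube_face (Suc n) i e) g) \<bullet> Kp n (act (cubical_nerve C) (cube_face (Suc n) i e) g)"
  let ?\<eta> = "face (i - 1) e (truncate (Suc n))"
  { fix g :: "('o, 'm) cube_ftor" assume g: "g \<in> cubes (Suc n)"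
    note D = Cat.diagram_cube[OF g]
    note e = cube_face_eval[OF g i, of e]
    have m: "mono ?\<eta>" using e(3) by (auto simp: cubes_in_def)
    have k: "Kp n (cube_of n (cube_ob (Suc n) g) (cube_ar (Suc n) g) ?\<eta>) \<in>
      Hom A (Ko n) (Fo G (cube_ar (Suc n) g (?\<eta> origin) (?\<eta> (corner n))))"
      using Kp_in[OF Cat.cube_of_in[OF D m]] by (simp add: diag_cube_of)
    have p: "push (cube_ar (Suc n) g) (?\<eta> origin) (?\<eta> (corner n)) origin (corner (Suc n))
      \<in> Hom A (Fo G (cube_ar (Suc n) g (?\<eta> origin) (?\<eta> (corner n)))) (Fo G (diag (Suc n) g))"
      using push_in[OF D] cube_bounds[OF D e(3)] by (simp add: diag_eq)
    have h: "?h g \<in> Hom A (Ko n) (Fo FX (Suc n, g))"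
      using A.Comp_in[OF k p] by (simp add: e Fo_FX[OF g])
    have "?h g \<bullet> x = eval_cube (cube_ob (Suc n) g) (cube_ar (Suc n) g) origin (corner (Suc n)) n \<psi> ?\<eta>"
      if "rep_cube n x \<psi>" for x \<psi>
      using that A.Comp_assoc[OF _ k p, of x W] Cat.cube_of_in[OF D m, of n] by (simp add: e eval_cube_def rep_cube_def)
    note h this }
  note h = this
  note p = prod_lift[OF K_product[of "Suc n", unfolded cub_ob_def[of _ _ _ "Suc n"] cub_pr_def[of _ _ _ "Suc n"] Fo_cubical_nerve] Ko_in[of n], of ?h, OF h(1)]
  show 1: "Kf (Suc n) i e \<in> Hom A (Ko n) (Ko (Suc n))"
    using p(1) by (simp add: cub_d_def cub_ob_def[of _ _ _ "Suc n"])
  show 2: "g \<in> cubes (Suc n) \<Longrightarrow> Kp (Suc n) g \<bullet> Kf (Suc n) i e = ?h g" for g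
    using p(2)[of g] by (simp add: cub_d_def cub_pr_def[of _ _ _ "Suc n"])
  show "rep_cube n x \<psi> \<Longrightarrow> g \<in> cubes (Suc n) \<Longrightarrow>
      Kp (Suc n) g \<bullet> (Kf (Suc n) i e \<bullet> x)
       = eval_cube (cube_ob (Suc n) g) (cube_ar (Suc n) g) origin (corner (Suc n)) n \<psi> ?\<eta>"
    using h(2)[of g x \<psi>] 2[of g] A.Comp_assoc[OF _ 1 Kp_in, of x W g] by (simp add: rep_cube_def)
qed

lemma cub_hom_diff_in:
  assumes "i \<in> {1..Suc n}"
  shows "hom_diff A (Ko n) (Ko (Suc n)) (Kf (Suc n) i False) (Kf (Suc n) i True)
    \<in> Hom A (Ko n) (Ko (Suc n))"
proof -
  interpret comm_group "hom_group A (Ko n) (Ko (Suc n))" using A.hom_group[OF Ko_in Ko_in] .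
  show ?thesis unfolding hom_diff_def
    using A.Add_in[OF cub_d_props(1)[OF assms]] inv_closed cub_d_props(1)[OF assms, of True]
    by (simp add: A.hom_group_simps)
qed

lemma Kd_lin: "Kd n = lin (hom_group A (Ko n) (Ko (Suc n)))
   (\<lambda>i. hom_diff A (Ko n) (Ko (Suc n)) (Kf (Suc n) i False) (Kf (Suc n) i True))
   (\<Sum>i\<in>{1..Suc n}. frag_cmul ((-1) ^ i) (frag_of i))"
  unfolding cub_diff_def Suc_eq_plus1[symmetric]
  by (rule A.alternating_sum_lin[OF finite_atLeastAtMost Ko_in Ko_in cub_hom_diff_in])

lemma Kd_in: "Kd n \<in> Hom A (Ko n) (Ko (Suc n))"
  unfolding Kd_lin using comm_group.lin_closed[OF A.hom_group[OF Ko_in Ko_in]] by (simp add: A.hom_group_simps)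

lemma rep_cube_cobd:
  assumes "rep_cube n x \<psi>" shows "rep_cube (Suc n) (Kd n \<bullet> x) (cube_cobd n \<psi>)"
  unfolding rep_cube_def
proof (intro conjI ballI)
  have x: "x \<in> Hom A W (Ko n)" using assms by (auto simp: rep_cube_def)
  then show "Kd n \<bullet> x \<in> Hom A W (Ko (Suc n))" using A.Comp_in Kd_in by blast
  fix g assume g: "g \<in> cubes (Suc n)"
  let ?P = "Fo G (diag (Suc n) g)"
  let ?sg = "\<Sum>i\<in>{1..Suc n}. frag_cmul ((-1) ^ i) (frag_of i)"
  let ?ob = "cube_ob (Suc n) g" and ?ar = "cube_ar (Suc n) g"
  let ?d = "\<lambda>i e. Kf (Suc n) i e"
  let ?D = "\<lambda>i. hom_diff A (Ko n) (Ko (Suc n)) (?d i False) (?d i True)"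
  let ?E = "eval_cube ?ob ?ar origin (corner (Suc n)) n \<psi>"
  note D = Cat.diagram_cube[OF g]
  interpret H: comm_group "hom_group A (Ko n) (Ko (Suc n))" using A.hom_group[OF Ko_in Ko_in] .
  interpret MM: comm_group "hom_group A W ?P" using group[OF D bot_corner] by (simp add: diag_eq)
  have hom: "(\<lambda>t. Kp (Suc n) g \<bullet> (t \<bullet> x)) \<in> hom (hom_group A (Ko n) (Ko (Suc n))) (hom_group A W ?P)"
    using hom_compose[OF A.right_comp_hom[OF x] A.left_comp_hom[OF Kp_in[OF g]]] by (simp add: o_def)
  interpret h: group_hom "hom_group A (Ko n) (Ko (Suc n))" "hom_group A W ?P" "\<lambda>t. Kp (Suc n) g \<bullet> (t \<bullet> x)"
    using hom by unfold_locales
  have "Kp (Suc n) g \<bullet> (Kd n \<bullet> x) = lin (hom_group A W ?P) (\<lambda>i. Kp (Suc n) g \<bullet> (?D i \<bullet> x)) ?sg"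
    unfolding Kd_lin
    by (rule H.lin_hom[OF MM.comm_group_axioms hom])
      (use keys_sum_frag[of "\<lambda>i. (-1) ^ i" "{1..Suc n}"] cub_hom_diff_in A.hom_group_simps in blast)
  also have "\<dots> = lin (hom_group A W ?P) (\<lambda>i. lin (hom_group A W ?P) ?E (face_diff (i - 1) (truncate (Suc n)))) ?sg"
  proof (rule MM.lin_cong)
    fix i assume "i \<in> supp ?sg"
    then have i: "i \<in> {1..Suc n}" using keys_sum_frag[of "\<lambda>i. (-1) ^ i" "{1..Suc n}"] by blast
    have E: "?E (face (i - 1) e (truncate (Suc n))) \<in> carrier (hom_group A W ?P)" for e
      using eval_cube_in[OF D rep_cube_cochain[OF assms] cube_face_eval(3)[OF g i, of e]] by (simp add: diag_eq)
    have d: "?d i e \<in> carrier (hom_group A (Ko n) (Ko (Suc n)))" for e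
      using cub_d_props(1)[OF i] by (simp add: A.hom_group_simps)
    have "?D i = ?d i False \<otimes>\<^bsub>hom_group A (Ko n) (Ko (Suc n))\<^esub> inv\<^bsub>hom_group A (Ko n) (Ko (Suc n))\<^esub> (?d i True)"
      by (simp add: hom_diff_def A.hom_group_simps)
    then have "Kp (Suc n) g \<bullet> (?D i \<bullet> x) =
      ?E (face (i - 1) False (truncate (Suc n))) \<otimes>\<^bsub>hom_group A W ?P\<^esub> inv\<^bsub>hom_group A W ?P\<^esub> (?E (face (i - 1) True (truncate (Suc n))))"
      using h.hom_mult[OF d[of False] H.inv_closed[OF d[of True]]] h.hom_inv[OF d[of True]] cub_d_props(3)[OF i assms g] by simp
    then show "Kp (Suc n) g \<bullet> (?D i \<bullet> x) = lin (hom_group A W ?P) ?E (face_diff (i - 1) (truncate (Suc n)))"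
      by (simp only: face_diff_def MM.lin_diff MM.lin_of[of ?E, OF E])
  qed
  also have "\<dots> = lin (hom_group A W ?P) ?E (frag_extend (\<lambda>i. face_diff (i - 1) (truncate (Suc n))) ?sg)"
    by (rule MM.lin_extend[symmetric])
  \<comment> \<open>The shift from indices \<open>i \<ge> 1\<close> to directions counted from 0
    turns \<open>(-1) ^ i\<close> into the sign \<open>(-1) ^ Suc i\<close> of
    \<open>cube_boundary\<close>.\<close>
  also have "frag_extend (\<lambda>i. face_diff (i - 1) (truncate (Suc n))) ?sg = cube_boundary (Suc n) (truncate (Suc n))"
    by (simp only: cube_boundary_def frag_extend_sum[OF finite_atLeastAtMost] o_def frag_extend_cmul frag_extend_of
      One_nat_def sum.atLeast1_atMost_eq frag_extend_sum[OF finite_lessThan] diff_Suc_1 diff_Suc_Suc diff_zero)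
  finally show "Kp (Suc n) g \<bullet> (Kd n \<bullet> x) = cube_cobd n \<psi> g"
    by (simp add: op_cc_def eval_cubes_def diag_eq)
qed

text \<open>A degeneracy sends the bottom vertex to the bottom vertex and the top one to the top
  one. So the diagonal is unchanged, the coefficient arrow is an identity, and the operator merely
  evaluates on the degenerate cube.\<close>

lemma cub_s_props:
  assumes i: "i \<in> {1..n}"
  shows "Ks n i \<in> Hom A (Ko n) (Ko (n - 1))"
    and "rep_cube n x \<psi> \<Longrightarrow> g \<in> cubes (n - 1) \<Longrightarrow>
      Kp (n - 1) g \<bullet> (Ks n i \<bullet> x)
       = \<psi> (ftor_comp (cube_poset n) g (cube_ftor_of (snd (snd (cube_degen n i)))))"
    and "g \<in> cubes (n - 1) \<Longrightarrow>
      diag n (ftor_comp (cube_poset n) g (cube_ftor_of (snd (snd (cube_degen n i))))) = diag (n - 1) g"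
    and "g \<in> cubes (n - 1) \<Longrightarrow>
      ftor_comp (cube_poset n) g (cube_ftor_of (snd (snd (cube_degen n i)))) \<in> cubes n"
proof -
  let ?h = "\<lambda>g. Fa FX (elem_arr (cubical_nerve C) (cube_degen n i) g) \<bullet> Kp n (act (cubical_nerve C) (cube_degen n i) g)"
  let ?g' = "\<lambda>g. ftor_comp (cube_poset n) g (cube_ftor_of (snd (snd (cube_degen n i))))"
  have i': "1 \<le> i" "i \<le> n" using i by auto
  obtain \<theta> where \<theta>: "cube_degen n i = (n, n - 1, \<theta>)" "(n, n - 1, \<theta>) \<in> cube_maps"
    "\<And>x. x \<in> vertices n \<Longrightarrow> \<theta> x = take (i - 1) x @ drop i x"
    using cube_degen_cases[OF i'] by auto
  have ends: "\<theta> (bot_vertex n) = bot_vertex (n - 1)" "\<theta> (top_vertex n) = top_vertex (n - 1)"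
    using i' by (simp_all add: \<theta>(3)) (auto simp: bot_vertex_def top_vertex_def simp flip: replicate_add)
  { fix g :: "('o, 'm) cube_ftor" assume g: "g \<in> cubes (n - 1)"
    note D = Cat.diagram_cube[OF g]
    have act: "act (cubical_nerve C) (cube_degen n i) g = ?g' g"
      using act_cubical_nerve[OF g] by (simp add: \<theta>(1))
    have g'in: "?g' g \<in> cubes n" using Fa_FX(2)[OF g \<theta>(2)] act by (simp add: \<theta>(1))
    have dg: "diag n (?g' g) = diag (n - 1) g"
      by (simp add: \<theta>(1) diag_def ftor_comp_def compose_def cube_ftor_of_def bot_vertex_le ends)
    have Did: "Fa g (bot_vertex (n - 1), bot_vertex (n - 1)) = Id C (Dom C (diag (n - 1) g))"
      "Fa g (top_vertex (n - 1), top_vertex (n - 1)) = Id C (Cod C (diag (n - 1) g))"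
      "diag (n - 1) g \<in> Arr C"
      using cube_functor_id[OF g] cube_functor_in[OF g bot_vertex_le[of "top_vertex (n - 1)"]]
      by (auto simp: diag_def Hom_def)
    have "Fa FX (elem_arr (cubical_nerve C) (cube_degen n i) g) = Id A (Fo G (diag (n - 1) g))"
      using Fa_FX(1)[OF g \<theta>(2)] Fa_Id[of "diag (n - 1) g"] Did
      by (simp add: \<theta>(1) ends fact_cat_def) (simp add: diag_def)
    then have h: "?h g = Kp n (?g' g)" using A.Id_Comp[OF Kp_in[OF g'in]] by (simp add: act dg)
    then have "?h g \<in> Hom A (Ko n) (Fo FX (n - 1, g))" using Kp_in[OF g'in] by (simp add: Fo_FX[OF g, unfolded One_nat_def] dg)
    note this h dg g'in }
  note h = this
  show "g \<in> cubes (n - 1) \<Longrightarrow> diag n (?g' g) = diag (n - 1) g"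
    "g \<in> cubes (n - 1) \<Longrightarrow> ?g' g \<in> cubes n" for g using h(3,4) by blast+
  note p = prod_lift[OF K_product[of "n - 1", unfolded cub_ob_def[of _ _ _ "n - 1"] cub_pr_def[of _ _ _ "n - 1"] Fo_cubical_nerve] Ko_in[of n], of ?h, OF h(1)]
  show 1: "Ks n i \<in> Hom A (Ko n) (Ko (n - 1))"
    using p(1) by (simp add: cub_s_def cub_ob_def[of _ _ _ "n - Suc 0"])
  show "Kp (n - 1) g \<bullet> (Ks n i \<bullet> x) = \<psi> (?g' g)"
    if "rep_cube n x \<psi>" "g \<in> cubes (n - 1)"
  proof -
    have x: "x \<in> Hom A W (Ko n)" using that by (simp add: rep_cube_def)
    have "Kp (n - 1) g \<bullet> Ks n i = Kp n (?g' g)"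
      using p(2)[of g] that(2) h(2)[OF that(2)] by (simp add: cub_s_def cub_pr_def[of _ _ _ "n - Suc 0"])
    then show ?thesis using A.Comp_assoc[OF x 1 Kp_in[OF that(2)]] h(4)[OF that(2)] that(1) by (simp add: rep_cube_def)
  qed
qed

end

section \<open>Squares of the differentials, and the comparison on a single chain\<close>

context coefficients
begin

text \<open>This makes the differential restrict to the normalized cochains: the boundary of a
  degenerate cube is a combination of degenerate cubes.\<close>

lemma normalized_cube_cobd:
  assumes "\<psi> \<in> cube_cochains n" "normalized n \<psi>"
  shows "normalized (Suc n) (cube_cobd n \<psi>)"
proof (rule normalizedI[OF op_cc_in])
  fix g :: "('o, 'm) cube_ftor" and \<theta> :: "(nat \<Rightarrow> bool) cube"
  assume g: "g \<in> cubes (Suc n - 1)" and \<theta>: "degenerate (Suc n) \<theta>" "\<theta> \<in> cubes_in (Suc n) origin (corner (Suc n - 1))"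
  note D = Cat.diagram_cube[OF g]
  show "eval_cube (cube_ob (Suc n - 1) g) (cube_ar (Suc n - 1) g) origin (corner (Suc n - 1)) (Suc n) (cube_cobd n \<psi>) \<theta>
       = Zero A W (Fo G (cube_ar (Suc n - 1) g origin (corner (Suc n - 1))))"
    using eval_cubes_degenerate[OF D bot_corner assms(2) cubes_in_boundary[OF \<theta>(2)] degenerate_cube_boundary[OF \<theta>(1)]]
    by (subst eval_cube_op_cc[where F = "cube_boundary (Suc n)" and F' = "cube_boundary (Suc n)",
          OF D bot_corner assms(1) cubes_in_boundary[OF truncate_in] map_cube_boundary \<theta>(2)])
qed

lemma cube_cobd_cobd:
  assumes "\<psi> \<in> cube_cochains n" "g \<in> cubes (Suc (Suc n))"
  shows "cube_cobd (Suc n) (cube_cobd n \<psi>) g = Zero A W (Fo G (diag (Suc (Suc n)) g))"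
proof -
  note D = Cat.diagram_cube[OF assms(2)]
  show ?thesis
    unfolding op_cc_def[of "Suc (Suc n)"]
    by (subst eval_cube_coboundary[OF D bot_corner assms(1) cubes_in_boundary[OF truncate_in]])
      (simp add: cube_boundary_boundary eval_cubes_0[OF D bot_corner] diag_eq)
qed

lemma simplex_cobd_cobd:
  assumes "\<phi> \<in> simplex_cochains n" "s \<in> chains C (Suc (Suc n))"
  shows "simplex_cobd (simplex_cobd \<phi>) s = Zero A W (Fo G (chain_comp s))"
proof -
  note D = Cat.diagram_chain[OF assms(2)]
  have "simplex_cobd (simplex_cobd \<phi>) s = eval_simplices (chain_ob C s) (chain_ar C s) 0 (Suc (Suc n)) \<phi>
     (frag_extend simplex_boundary (simplex_boundary [0..<Suc (Suc (Suc n))]))"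
    unfolding op_ss_def[of _ "simplex_cobd \<phi>"] chains_length[OF assms(2)]
    by (rule eval_simplex_coboundary[OF D _ assms(1) simplices_in_boundary[OF upt_in]]) simp
  then show ?thesis using eval_simplices_0[OF D, of 0 "Suc (Suc n)" \<phi>] chain_ar_snd[of s] chains_length[OF assms(2)]
    by (simp add: simplex_boundary_boundary del: upt_Suc)
qed

text \<open>Only one cube is involved and it spans the whole interval, so no push remains. This
  closed formula lets \<open>comparison_map\<close> be written down without a test object.\<close>

lemma to_simplex_eq:
  assumes "\<psi> \<in> cube_cochains n" "s \<in> chains C n"
  shows "to_simplex n \<psi> s = \<psi> (cube_of n (chain_ob C s) (chain_ar C s) (simplex_to_cube [0..<Suc n]))"
    and "mono (simplex_to_cube [0..<Suc n])"
    and "diag n (cube_of n (chain_ob C s) (chain_ar C s) (simplex_to_cube [0..<Suc n])) = chain_comp s"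
proof -
  note D = Cat.diagram_chain[OF assms(2)]
  let ?\<theta> = "simplex_to_cube [0..<Suc n]"
  have \<theta>: "?\<theta> \<in> cubes_in n 0 n" by (rule simplex_to_cube_in[OF upt_in])
  then show m: "mono ?\<theta>" by (simp add: cubes_in_def del: upt_Suc)
  have "hd [0..<Suc n] = 0" "last [0..<Suc n] = n" by (simp_all add: hd_append)
  then have e: "?\<theta> origin = 0" "?\<theta> (corner n) = n" using simplex_to_cube_ends[of "[0..<Suc n]" n] by simp_all
  have ar: "chain_ar C s 0 n = chain_comp s" using chain_ar_snd[of s] chains_length[OF assms(2)] by simp
  show dg: "diag n (cube_of n (chain_ob C s) (chain_ar C s) ?\<theta>) = chain_comp s"
    by (simp add: diag_cube_of e ar del: upt_Suc)
  have "\<psi> (cube_of n (chain_ob C s) (chain_ar C s) ?\<theta>) \<in> Hom A W (Fo G (chain_ar C s 0 n))"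
    using cube_value_in[OF D assms(1) \<theta>] e by simp
  moreover have "to_simplex n \<psi> s = eval_cube (chain_ob C s) (chain_ar C s) 0 n n \<psi> ?\<theta>"
    unfolding op_sc_def eval_cubes_def chains_length[OF assms(2)]
    using eval_cube_in[OF D assms(1) \<theta>] by (intro comm_group.lin_of[OF group[OF D]]) auto
  ultimately show "to_simplex n \<psi> s = \<psi> (cube_of n (chain_ob C s) (chain_ar C s) ?\<theta>)"
    using push_id[OF D, of 0 n] A.Id_Comp by (simp add: eval_cube_def e del: upt_Suc)
qed

end

context comparison
begin

text \<open>The complexes and the comparison map do not involve \<open>W\<close>. Taking for
  \<open>V\<close> an object of a complex, and its identity as the element, turns statements on
  generalized elements into equations of morphisms.\<close>

lemma comparison_at: "V \<in> Obj A \<Longrightarrow> comparison C A G V"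
  by (intro comparison.intro comparison_axioms.intro coefficients.intro coefficients_axioms.intro
      Cat.category_axioms A.preadditive_category_axioms cat_functor_axioms abelian_category_axioms
      prod_chains prod_cubes prod_nat) auto

section \<open>Normalized cochains as a kernel, and the differential on them\<close>

abbreviation "Ni \<equiv> cub_incl A (cubical_nerve C) FX"
abbreviation "No n \<equiv> Dom A (Ni n)"
abbreviation "Nd \<equiv> cub_norm_diff A (cubical_nerve C) FX"

definition degeneracies :: "nat \<Rightarrow> 'q" where
  "degeneracies n = prod_lift A {1..n} (\<lambda>_. Ko (n - 1)) (Ko n) (Ks n)"

lemma degeneracies_props:
  "degeneracies n \<in> Hom A (Ko n) (prod_ob A {1..n} (\<lambda>_. Ko (n - 1)))"
  "i \<in> {1..n} \<Longrightarrow> prod_pr A {1..n} (\<lambda>_. Ko (n - 1)) i \<bullet> degeneracies n = Ks n i"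
  unfolding degeneracies_def using prod_lift[OF prod_nat Ko_in[of n], of n "\<lambda>_. Ko (n - 1)" "Ks n"]
    Ko_in cub_s_props(1) by blast+

text \<open>Connects the kernel that defines normalized cochains with the condition on families, by
  testing on the components of the finite product and then on those indexed by cubes.\<close>

lemma degeneracies_zero:
  assumes "rep_cube n x \<psi>"
  shows "degeneracies n \<bullet> x = Zero A W (prod_ob A {1..n} (\<lambda>_. Ko (n - 1))) \<longleftrightarrow> normalized n \<psi>"
proof -
  have x: "x \<in> Hom A W (Ko n)" using assms by (simp add: rep_cube_def)
  let ?Q = "prod_ob A {1..n} (\<lambda>_. Ko (n - 1))" and ?p = "prod_pr A {1..n} (\<lambda>_. Ko (n - 1))"
  have P: "is_product A {1..n} (\<lambda>_. Ko (n - 1)) ?Q ?p" by (rule prod_nat) (rule Ko_in)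
  then have p: "?p i \<in> Hom A ?Q (Ko (n - 1))" if "i \<in> {1..n}" for i using that unfolding is_product_def by blast
  have Q: "?Q \<in> Obj A" using P by (simp add: is_product_def)
  have 1: "?p i \<bullet> (degeneracies n \<bullet> x) = Ks n i \<bullet> x" if "i \<in> {1..n}" for i
    using A.Comp_assoc[OF x degeneracies_props(1) p[OF that]] degeneracies_props(2)[OF that] by simp
  have "degeneracies n \<bullet> x = Zero A W ?Q \<longleftrightarrow> (\<forall>i \<in> {1..n}. Ks n i \<bullet> x = Zero A W (Ko (n - 1)))"
    (is "?l \<longleftrightarrow> ?r")
  proof
    assume l: ?l
    show ?r
    proof
      fix i assume i: "i \<in> {1..n}"
      show "Ks n i \<bullet> x = Zero A W (Ko (n - 1))"
        using 1[OF i] l A.Comp_Zero[OF p[OF i] W] by simp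
    qed
  next
    assume ?r
    then show ?l
      using 1 A.Comp_Zero[OF p W]
      by (intro is_product_unique[OF P A.category_axioms A.Comp_in[OF x degeneracies_props(1)] A.Zero_in[OF W Q]]) auto
  qed
  also have "\<dots> \<longleftrightarrow> normalized n \<psi>"
  proof -
    have "Ks n i \<bullet> x = Zero A W (Ko (n - 1)) \<longleftrightarrow>
      (\<forall>g \<in> cubes (n - 1). \<psi> (ftor_comp (cube_poset n) g (cube_ftor_of (snd (snd (cube_degen n i)))))
         = Zero A W (Fo G (diag (n - 1) g)))" if i: "i \<in> {1..n}" for i
    proof -
      have "rep_cube (n - 1) (Ks n i \<bullet> x)
          (\<lambda>g. \<psi> (ftor_comp (cube_poset n) g (cube_ftor_of (snd (snd (cube_degen n i))))))"
        using cub_s_props(2)[OF i assms] A.Comp_in[OF x cub_s_props(1)[OF i]] unfolding rep_cube_def by blast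
      from rep_cube_unique[OF this rep_cube_zero] this show ?thesis
        using rep_cube_zero[of "n - 1"] unfolding rep_cube_def by metis
    qed
    then show ?thesis unfolding normalized_def Let_def using cub_s_props(3) by simp
  qed
  finally show ?thesis .
qed

lemma Ni_kernel: "is_kernel A (degeneracies n) (Ni n)"
  using has_kernels[of "degeneracies n"] degeneracies_props(1)[of n] someI_ex[of "is_kernel A (degeneracies n)"]
  unfolding cub_incl_def degeneracies_def[symmetric] Defs.kernel_def by (auto simp: Hom_def)

lemma degeneracies_Dom:
  "Dom A (degeneracies n) = Ko n" "Cod A (degeneracies n) = prod_ob A {1..n} (\<lambda>_. Ko (n - 1))"
  using degeneracies_props(1)[of n] by (auto simp: Hom_def)

lemma Ni_in: "Ni n \<in> Hom A (No n) (Ko n)"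
  using Ni_kernel[of n] degeneracies_Dom[of n] by (auto simp: is_kernel_def Hom_def)

lemma No_in: "No n \<in> Obj A"
  using A.Hom_Obj[OF Ni_in] by blast

lemma Ni_mono: "t \<in> Hom A W (No n) \<Longrightarrow> t' \<in> Hom A W (No n) \<Longrightarrow> Ni n \<bullet> t = Ni n \<bullet> t' \<Longrightarrow> t = t'"
  by (rule A.is_kernel_mono[OF Ni_kernel])

lemma Ni_lift:
  assumes "rep_cube n x \<psi>" "normalized n \<psi>"
  obtains t where "t \<in> Hom A W (No n)" "Ni n \<bullet> t = x"
  using A.is_kernel_lift[OF Ni_kernel, of x W n] degeneracies_zero[OF assms(1)] assms degeneracies_Dom[of n]
  by (auto simp: rep_cube_def)

lemma Ni_normalized:
  assumes "t \<in> Hom A W (No n)" "rep_cube n (Ni n \<bullet> t) \<psi>" shows "normalized n \<psi>"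
proof -
  have "degeneracies n \<bullet> (Ni n \<bullet> t) = Zero A W (prod_ob A {1..n} (\<lambda>_. Ko (n - 1)))"
    using A.Comp_assoc[OF assms(1) Ni_in degeneracies_props(1)] Ni_kernel[of n] degeneracies_Dom[of n]
      A.Zero_Comp[OF assms(1)] A.Hom_Obj(2)[OF degeneracies_props(1)[of n]]
    by (simp add: is_kernel_def)
  then show ?thesis using degeneracies_zero[OF assms(2)] by simp
qed

lemma Ni_rep:
  assumes "t \<in> Hom A W (No n)"
  obtains \<psi> where "rep_cube n (Ni n \<bullet> t) \<psi>" "\<psi> \<in> cube_cochains n" "normalized n \<psi>"
  using rep_cube_self[OF A.Comp_in[OF assms Ni_in]] rep_cube_cochain Ni_normalized[OF assms] by blast

lemma Kd_Ni_lift: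
  assumes "t \<in> Hom A W (No n)"
  obtains t' where "t' \<in> Hom A W (No (Suc n))" "Ni (Suc n) \<bullet> t' = Kd n \<bullet> (Ni n \<bullet> t)"
  using Ni_rep[OF assms] Ni_lift[OF rep_cube_cobd normalized_cube_cobd] by metis

lemma Nd_props:
  "Nd n \<in> Hom A (No n) (No (Suc n))" "Ni (Suc n) \<bullet> Nd n = Kd n \<bullet> Ni n"
proof -
  \<comment> \<open>The identity of \<open>No n\<close> is the generic normalized cochain; lifting
    its coboundary gives the differential itself.\<close>
  obtain t where t: "t \<in> Hom A (No n) (No (Suc n))" "Ni (Suc n) \<bullet> t = Kd n \<bullet> Ni n"
    using comparison.Kd_Ni_lift[OF comparison_at[OF No_in[of n]] A.Id_in[OF No_in[of n]]] A.Comp_Id[OF Ni_in] by metis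
  have dom: "Dom A (Kd n \<bullet> Ni n) = No n" using A.Comp_in[OF Ni_in Kd_in] by (simp add: Hom_def)
  have "\<exists>!u. u \<in> Hom A (No n) (No (Suc n)) \<and> Ni (Suc n) \<bullet> u = Kd n \<bullet> Ni n"
    using t A.is_kernel_mono[OF Ni_kernel[of "Suc n"]] by metis
  from theI'[OF this] show "Nd n \<in> Hom A (No n) (No (Suc n))" "Ni (Suc n) \<bullet> Nd n = Kd n \<bullet> Ni n"
    unfolding cub_norm_diff_def factor_through_def by (simp_all add: dom)
qed

lemma Ni_Nd:
  "t \<in> Hom A W (No n) \<Longrightarrow> Ni (Suc n) \<bullet> (Nd n \<bullet> t) = Kd n \<bullet> (Ni n \<bullet> t)"
  using A.Comp_assoc[OF _ Nd_props(1) Ni_in] A.Comp_assoc[OF _ Ni_in Kd_in] Nd_props(2) by metis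

lemma Nd_zero:
  assumes "t \<in> Hom A W (No n)" "rep_cube n (Ni n \<bullet> t) \<psi>"
  shows "Nd n \<bullet> t = Zero A W (No (Suc n))
    \<longleftrightarrow> (\<forall>g \<in> cubes (Suc n). cube_cobd n \<psi> g = Zero A W (Fo G (diag (Suc n) g)))"
proof -
  note r = rep_cube_cobd[OF assms(2), folded Ni_Nd[OF assms(1)]]
  have "Nd n \<bullet> t = Zero A W (No (Suc n)) \<longleftrightarrow> Ni (Suc n) \<bullet> (Nd n \<bullet> t) = Zero A W (Ko (Suc n))"
    using A.Comp_Zero[OF Ni_in W] Ni_mono[OF A.Comp_in[OF assms(1) Nd_props(1)] A.Zero_in[OF W No_in]] by auto
  also have "\<dots> \<longleftrightarrow> (\<forall>g \<in> cubes (Suc n). cube_cobd n \<psi> g = Zero A W (Fo G (diag (Suc n) g)))"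
    using rep_cube_unique[OF r rep_cube_zero] r rep_cube_zero[of "Suc n"] unfolding rep_cube_def by metis
  finally show ?thesis .
qed

lemma Nd_Nd:
  assumes "t \<in> Hom A W (No n)" shows "Nd (Suc n) \<bullet> (Nd n \<bullet> t) = Zero A W (No (Suc (Suc n)))"
proof -
  obtain \<psi> where \<psi>: "rep_cube n (Ni n \<bullet> t) \<psi>" "\<psi> \<in> cube_cochains n" using Ni_rep[OF assms] by metis
  show ?thesis
    using Nd_zero[OF A.Comp_in[OF assms Nd_props(1)] rep_cube_cobd[OF \<psi>(1), folded Ni_Nd[OF assms]]]
      cube_cobd_cobd[OF \<psi>(2)] by blast
qed

lemma BWd_zero:
  assumes "rep_simplex n y \<phi>"
  shows "BWd n \<bullet> y = Zero A W (BWo (Suc n))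
    \<longleftrightarrow> (\<forall>s \<in> chains C (Suc n). simplex_cobd \<phi> s = Zero A W (Fo G (chain_comp s)))"
  using rep_simplex_unique[OF rep_simplex_cobd[OF assms] rep_simplex_zero] rep_simplex_cobd[OF assms]
    rep_simplex_zero[of "Suc n"] unfolding rep_simplex_def by metis

lemma BWd_BWd:
  assumes "y \<in> Hom A W (BWo n)" shows "BWd (Suc n) \<bullet> (BWd n \<bullet> y) = Zero A W (BWo (Suc (Suc n)))"
  using BWd_zero[OF rep_simplex_cobd[OF rep_simplex_self[OF assms]]]
    simplex_cobd_cobd[OF rep_simplex_cochain[OF rep_simplex_self[OF assms]]] by blast

lemma cochain_complexes: "cochain_complex A No Nd" "cochain_complex A BWo BWd"
proof -
  show "cochain_complex A No Nd"
  proof (intro cochain_complex.intro cochain_complex_axioms.intro A.preadditive_category_axioms No_in Nd_props(1))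
    show "Nd (Suc n) \<bullet> Nd n = Zero A (No n) (No (Suc (Suc n)))" for n
      using comparison.Nd_Nd[OF comparison_at[OF No_in[of n]] A.Id_in[OF No_in[of n]]] A.Comp_Id[OF Nd_props(1)] by simp
  qed
  show "cochain_complex A BWo BWd"
  proof (intro cochain_complex.intro cochain_complex_axioms.intro A.preadditive_category_axioms BWo_in BWd_props(1))
    show "BWd (Suc n) \<bullet> BWd n = Zero A (BWo n) (BWo (Suc (Suc n)))" for n
      using comparison.BWd_BWd[OF comparison_at[OF BWo_in[of n]] A.Id_in[OF BWo_in[of n]]] A.Comp_Id[OF BWd_props(1)] by simp
  qed
qed

text \<open>The pullback along \<open>simplex_to_cube\<close>, restricted to normalized cochains:
  the component at a chain is the projection to a single cube.\<close>

definition comparison_map :: "nat \<Rightarrow> 'q" where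
  "comparison_map n = prod_lift A (chains C n) (\<lambda>(c, \<alpha>s). Fo G (path_comp C c \<alpha>s)) (No n)
     (\<lambda>s. Kp n (cube_of n (chain_ob C s) (chain_ar C s) (simplex_to_cube [0..<Suc n])) \<bullet> Ni n)"

lemma comparison_map_props:
  "comparison_map n \<in> Hom A (No n) (BWo n)"
  "s \<in> chains C n \<Longrightarrow> BWp n s \<bullet> comparison_map n
    = Kp n (cube_of n (chain_ob C s) (chain_ar C s) (simplex_to_cube [0..<Suc n])) \<bullet> Ni n"
proof -
  let ?h = "\<lambda>s. Kp n (cube_of n (chain_ob C s) (chain_ar C s) (simplex_to_cube [0..<Suc n])) \<bullet> Ni n"
  have "?h s \<in> Hom A (No n) (case s of (c, \<alpha>s) \<Rightarrow> Fo G (path_comp C c \<alpha>s))" if "s \<in> chains C n" for s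
  proof -
    \<comment> \<open>The two facts concern the cube alone; \<open>op_cc_in\<close> supplies some
      cochain for the premise.\<close>
    note e = to_simplex_eq(2,3)[OF op_cc_in that]
    show ?thesis
      using A.Comp_in[OF Ni_in Kp_in[OF Cat.cube_of_in[OF Cat.diagram_chain[OF that] e(1), where m = n]]] e(2)
      by (simp add: split_def del: upt_Suc)
  qed
  note p = prod_lift[OF BW_product[of n, unfolded BW_ob_def BW_pr_def] No_in[of n], of ?h, OF this]
  show "comparison_map n \<in> Hom A (No n) (BWo n)"
    using p(1) unfolding comparison_map_def BW_ob_def .
  show "s \<in> chains C n \<Longrightarrow> BWp n s \<bullet> comparison_map n = ?h s"
    using p(2)[of s] unfolding comparison_map_def BW_pr_def by blast
qed

lemma rep_comparison_map:
  assumes "t \<in> Hom A W (No n)" "rep_cube n (Ni n \<bullet> t) \<psi>"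
  shows "rep_simplex n (comparison_map n \<bullet> t) (to_simplex n \<psi>)"
  unfolding rep_simplex_def
proof (intro conjI ballI)
  show "comparison_map n \<bullet> t \<in> Hom A W (BWo n)" using A.Comp_in[OF assms(1) comparison_map_props(1)] .
  fix s assume s: "s \<in> chains C n"
  let ?c = "cube_of n (chain_ob C s) (chain_ar C s) (simplex_to_cube [0..<Suc n])"
  note e = to_simplex_eq[OF rep_cube_cochain[OF assms(2)] s]
  have c: "?c \<in> cubes n" using Cat.cube_of_in[OF Cat.diagram_chain[OF s] e(2)] .
  have "BWp n s \<bullet> (comparison_map n \<bullet> t) = (Kp n ?c \<bullet> Ni n) \<bullet> t"
    using A.Comp_assoc[OF assms(1) comparison_map_props(1) BWp_in[OF s]] comparison_map_props(2)[OF s] by simp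
  also have "\<dots> = Kp n ?c \<bullet> (Ni n \<bullet> t)" using A.Comp_assoc[OF assms(1) Ni_in Kp_in[OF c]] by simp
  also have "\<dots> = \<psi> ?c" using assms(2) c unfolding rep_cube_def by blast
  finally show "BWp n s \<bullet> (comparison_map n \<bullet> t) = to_simplex n \<psi> s" using e(1) by simp
qed

section \<open>The comparison map as a quasi-isomorphism on generalized elements\<close>

lemma comparison_map_Nd:
  assumes "t \<in> Hom A W (No n)"
  shows "comparison_map (Suc n) \<bullet> (Nd n \<bullet> t) = BWd n \<bullet> (comparison_map n \<bullet> t)"
proof -
  obtain \<psi> where \<psi>: "rep_cube n (Ni n \<bullet> t) \<psi>" "\<psi> \<in> cube_cochains n" "normalized n \<psi>" using Ni_rep[OF assms] by metis
  show ?thesis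
    using rep_simplex_unique[OF
        rep_comparison_map[OF A.Comp_in[OF assms Nd_props(1)] rep_cube_cobd[OF \<psi>(1), folded Ni_Nd[OF assms]]]
        rep_simplex_cobd[OF rep_comparison_map[OF assms \<psi>(1)]]] simplex_cobd_to_simplex[OF \<psi>(2,3)] by simp
qed

text \<open>The preimage is the pullback of the cocycle along \<open>cube_to_simplices\<close>,
  which is normalized because that map kills degenerate cubes. The correction \<open>b\<close> is
  zero in degree 0 and the coboundary of the simplicial homotopy term otherwise.\<close>

lemma comparison_map_surj:
  assumes y: "y \<in> Hom A W (BWo n)" "BWd n \<bullet> y = Zero A W (BWo (Suc n))"
  shows "\<exists>t \<in> Hom A W (No n). Nd n \<bullet> t = Zero A W (No (Suc n)) \<and>
    (\<exists>b. A.cobound BWo BWd n W b \<and> comparison_map n \<bullet> t = y \<oplus>\<^sub>A b)"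
proof -
  obtain \<phi> where r: "rep_simplex n y \<phi>" using rep_simplex_self[OF y(1)] by blast
  note \<phi> = rep_simplex_cochain[OF r]
  have z: "\<And>s. s \<in> chains C (Suc n) \<Longrightarrow> simplex_cobd \<phi> s = Zero A W (Fo G (chain_comp s))"
    using BWd_zero[OF r] y(2) by blast
  obtain x where x: "rep_cube n x (to_cube n \<phi>)" using rep_cube_ex[OF op_cs_in] by blast
  obtain t where t: "t \<in> Hom A W (No n)" "Ni n \<bullet> t = x" using Ni_lift[OF x normalized_to_cube[OF \<phi>]] .
  note rt = x[folded t(2)]
  have "Nd n \<bullet> t = Zero A W (No (Suc n))"
    using Nd_zero[OF t(1) rt] cube_cobd_to_cube_cocycle[OF \<phi> _ z] by blast
  moreover note f = rep_comparison_map[OF t(1) rt]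
  have "\<exists>b. A.cobound BWo BWd n W b \<and> comparison_map n \<bullet> t = y \<oplus>\<^sub>A b"
  proof (cases n)
    case 0
    have "comparison_map n \<bullet> t = y"
      using rep_simplex_unique[OF f r] to_simplex_to_cube_0[OF \<phi>[unfolded 0]] unfolding 0 by blast
    then show ?thesis using A.Add_Zero[OF y(1)] by (auto simp: A.cobound_def 0)
  next
    case (Suc m)
    obtain u where u: "rep_simplex m u (op_ss (simplex_homotopy m) \<phi>)" using rep_simplex_ex[OF op_ss_in] by blast
    have "comparison_map n \<bullet> t = y \<oplus>\<^sub>A BWd m \<bullet> u"
      using rep_simplex_unique[OF f[unfolded Suc] rep_simplex_add[OF r[unfolded Suc] rep_simplex_cobd[OF u]]]
        to_simplex_to_cube[OF \<phi>[unfolded Suc] _ z[unfolded Suc]] unfolding Suc by blast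
    then show ?thesis using u by (auto simp: A.cobound_def Suc rep_simplex_def)
  qed
  ultimately show ?thesis using t(1) by blast
qed

lemma comparison_map_inj:
  assumes t: "t \<in> Hom A W (No n)" "Nd n \<bullet> t = Zero A W (No (Suc n))"
    and b: "A.cobound BWo BWd n W (comparison_map n \<bullet> t)"
  shows "A.cobound No Nd n W t"
proof -
  obtain \<psi> where \<psi>: "rep_cube n (Ni n \<bullet> t) \<psi>" "\<psi> \<in> cube_cochains n" "normalized n \<psi>" using Ni_rep[OF t(1)] by metis
  note f = rep_comparison_map[OF t(1) \<psi>(1)]
  have z: "\<And>g. g \<in> cubes (Suc n) \<Longrightarrow> cube_cobd n \<psi> g = Zero A W (Fo G (diag (Suc n) g))"
    using Nd_zero[OF t(1) \<psi>(1)] t(2) by blast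
  show ?thesis
  proof (cases n)
    case 0
    have "comparison_map 0 \<bullet> t = Zero A W (BWo 0)" using b by (simp add: A.cobound_def 0)
    then have "to_simplex 0 \<psi> s = Zero A W (Fo G (chain_comp s))" if "s \<in> chains C 0" for s
      using f rep_simplex_zero[of 0] that unfolding 0 rep_simplex_def by metis
    then have "\<psi> g = Zero A W (Fo G (diag 0 g))" if "g \<in> functors (cube_poset 0) C" for g
      using normalized_cocycle_0[OF \<psi>(2,3)[unfolded 0] that z[unfolded 0]] by blast
    then have "Ni 0 \<bullet> t = Ni 0 \<bullet> Zero A W (No 0)"
      using rep_cube_unique[OF \<psi>(1)[unfolded 0] rep_cube_zero] A.Comp_Zero[OF Ni_in W] by simp
    then show ?thesis using Ni_mono[OF t(1)[unfolded 0] A.Zero_in[OF W No_in]] by (simp add: A.cobound_def 0)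
  next
    case (Suc m)
    obtain u where u: "u \<in> Hom A W (BWo m)" "comparison_map (Suc m) \<bullet> t = BWd m \<bullet> u"
      using b by (auto simp: A.cobound_def Suc)
    obtain \<chi> where r: "rep_simplex m u \<chi>" using rep_simplex_self[OF u(1)] by blast
    note \<chi> = rep_simplex_cochain[OF r]
    have eq: "to_simplex (Suc m) \<psi> s = simplex_cobd \<chi> s" if "s \<in> chains C (Suc m)" for s
      using f rep_simplex_cobd[OF r] u(2) that unfolding Suc rep_simplex_def by metis
    obtain x1 where x1: "rep_cube m x1 (to_cube m \<chi>)" using rep_cube_ex[OF op_cs_in] by blast
    obtain t1 where t1: "t1 \<in> Hom A W (No m)" "Ni m \<bullet> t1 = x1" using Ni_lift[OF x1 normalized_to_cube[OF \<chi>]] .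
    let ?h = "op_cc m (Suc m) (cube_homotopy m) \<psi>"
    obtain x2 where x2: "rep_cube m x2 ?h" using rep_cube_ex[OF op_cc_in] by blast
    obtain t2 where t2: "t2 \<in> Hom A W (No m)" "Ni m \<bullet> t2 = x2"
      using Ni_lift[OF x2 normalized_cube_homotopy[OF \<psi>(2,3)[unfolded Suc]]] .
    have d1: "rep_cube (Suc m) (Ni (Suc m) \<bullet> (Nd m \<bullet> t1)) (cube_cobd m (to_cube m \<chi>))"
      unfolding Ni_Nd[OF t1(1)] t1(2) by (rule rep_cube_cobd[OF x1])
    have d2: "rep_cube (Suc m) (Ni (Suc m) \<bullet> (Nd m \<bullet> t2)) (cube_cobd m ?h)"
      unfolding Ni_Nd[OF t2(1)] t2(2) by (rule rep_cube_cobd[OF x2])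
    note t' = t(1)[unfolded Suc]
    have n1: "Nd m \<bullet> t1 \<in> Hom A W (No (Suc m))" and n2: "Nd m \<bullet> t2 \<in> Hom A W (No (Suc m))"
      using A.Comp_in[OF t1(1) Nd_props(1)] A.Comp_in[OF t2(1) Nd_props(1)] .
    \<comment> \<open>The dual homotopy formula, read in the product. It says that \<open>t\<close>
      is the coboundary of \<open>t1\<close> minus the coboundary of \<open>t2\<close>, so the
      difference of \<open>t1\<close> and \<open>t2\<close> is the cochain sought.\<close>
    have "Ni (Suc m) \<bullet> (Nd m \<bullet> t1) = Ni (Suc m) \<bullet> t \<oplus>\<^sub>A Ni (Suc m) \<bullet> (Nd m \<bullet> t2)"
      by (rule rep_cube_unique[OF d1 rep_cube_add[OF \<psi>(1)[unfolded Suc] d2]])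
        (rule normalized_cocycle_Suc[OF \<psi>(2,3)[unfolded Suc] _ z[unfolded Suc] \<chi> eq])
    then have "Nd m \<bullet> t1 = t \<oplus>\<^sub>A Nd m \<bullet> t2"
      using Ni_mono[OF n1 A.Add_in[OF t' n2]] A.Comp_Add[OF t' n2 Ni_in] by simp
    moreover
    interpret N: comm_group "hom_group A W (No m)" using A.hom_group[OF W No_in] .
    interpret N': comm_group "hom_group A W (No (Suc m))" using A.hom_group[OF W No_in] .
    interpret d: group_hom "hom_group A W (No m)" "hom_group A W (No (Suc m))" "\<lambda>t. Nd m \<bullet> t"
      using A.left_comp_hom[OF Nd_props(1)] by unfold_locales
    let ?i = "inv\<^bsub>hom_group A W (No m)\<^esub> t2"
    have i: "?i \<in> Hom A W (No m)" using N.inv_closed[of t2] t2(1) by (simp add: A.hom_group_simps)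
    have "Nd m \<bullet> (t1 \<oplus>\<^sub>A ?i) = Nd m \<bullet> t1 \<oplus>\<^sub>A inv\<^bsub>hom_group A W (No (Suc m))\<^esub> (Nd m \<bullet> t2)"
      using A.Comp_Add[OF t1(1) i Nd_props(1)] d.hom_inv[of t2] t2(1) by (simp add: A.hom_group_simps)
    ultimately have "t = Nd m \<bullet> (t1 \<oplus>\<^sub>A ?i)"
      using N'.inv_solve_right[of t "Nd m \<bullet> t1" "Nd m \<bullet> t2"] t' n1 n2 by (simp add: A.hom_group_simps)
    then show ?thesis using A.Add_in[OF t1(1) i] by (auto simp: A.cobound_def Suc)
  qed
qed

lemma isomorphic_cohomology:
  "isomorphic A (BW_cohomology A C G n) (cub_cohomology A (cubical_nerve C) FX n)"
  unfolding BW_cohomology_def cub_cohomology_def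
proof (rule cohomology_isomorphic[OF cochain_complexes comparison_map_props(1)])
  show "comparison_map (Suc n) \<bullet> Nd n = BWd n \<bullet> comparison_map n" for n
    using comparison.comparison_map_Nd[OF comparison_at[OF No_in[of n]] A.Id_in[OF No_in[of n]]]
      A.Comp_Id[OF Nd_props(1)] A.Comp_Id[OF comparison_map_props(1)] 
    by (simp add: comparison.comparison_map_def[OF comparison_at[OF No_in]] comparison_map_def)
next
  fix V y assume y: "y \<in> Hom A V (BWo n)" "BWd n \<bullet> y = Zero A V (BWo (Suc n))"
  then have V: "V \<in> Obj A" using A.Hom_Obj by blast
  show "\<exists>x\<in>Hom A V (No n). Nd n \<bullet> x = Zero A V (No (Suc n)) \<and>
      (\<exists>b. A.cobound BWo BWd n V b \<and> comparison_map n \<bullet> x = y \<oplus>\<^sub>A b)"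
    using comparison.comparison_map_surj[OF comparison_at[OF V] y]
    by (simp add: comparison.comparison_map_def[OF comparison_at[OF V]] comparison_map_def)
next
  fix V x assume "x \<in> Hom A V (No n)" "Nd n \<bullet> x = Zero A V (No (Suc n))"
     "A.cobound BWo BWd n V (comparison_map n \<bullet> x)"
  moreover then have V: "V \<in> Obj A" using A.Hom_Obj by blast
  ultimately show "A.cobound No Nd n V x"
    using comparison.comparison_map_inj[OF comparison_at[OF V], of x n]
    by (simp add: comparison.comparison_map_def[OF comparison_at[OF V]] comparison_map_def)
qed

end

section \<open>Smallness of the index sets\<close>

lemma small_chains:
  assumes "infinite (UNIV :: 'u set)" "small_category TYPE('u) C"
  shows "small TYPE('u) (chains C n)"
proof (rule small_subset[OF small_Times[OF assms(1) _ small_lists[OF assms(1)]]])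
  show "small TYPE('u) (Obj C)" "small TYPE('u) (Arr C)" using assms(2) by (auto simp: small_category_def)
  interpret category C using assms(2) by (simp add: small_category_def)
  have "is_path C c \<alpha>s \<Longrightarrow> set \<alpha>s \<subseteq> Arr C \<and> c \<in> Obj C" for c \<alpha>s
    by (induction \<alpha>s arbitrary: c) (auto simp: Dom_in)
  then show "chains C n \<subseteq> Obj C \<times> {xs. length xs = n \<and> set xs \<subseteq> Arr C}" by (auto simp: chains_def)
qed

text \<open>A functor on a finite poset is determined by the finite lists of its values on objects
  and on arrows; extensionality makes this encoding injective.\<close>

lemma small_cubes:
  assumes "infinite (UNIV :: 'u set)" "small_category TYPE('u) C"
  shows "small TYPE('u) (functors (cube_poset n) C)"
proof -
  have fv: "finite (vertices n)" using finite_lists_length_eq[of "UNIV :: bool set" n] by (simp add: vertices_def)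
  then obtain vs where vs: "set vs = vertices n" using finite_list by blast
  have "Arr (cube_poset n) \<subseteq> vertices n \<times> vertices n" by (auto simp: cube_poset_def)
  then have "finite (Arr (cube_poset n))" by (rule finite_subset) (simp add: fv)
  then obtain es where es: "set es = Arr (cube_poset n)" using finite_list by blast
  let ?f = "\<lambda>F. (map (Fo F) vs, map (Fa F) es)"
  have s: "small TYPE('u) (Obj C)" "small TYPE('u) (Arr C)" using assms(2) by (auto simp: small_category_def)
  show ?thesis
  proof (rule small_inj[OF small_Times[OF assms(1) small_lists[OF assms(1) s(1)] small_lists[OF assms(1) s(2)]]])
    have v: "Obj (cube_poset n) = vertices n" by (simp add: cube_poset_def)
    show "inj_on ?f (functors (cube_poset n) C)"
    proof (rule inj_onI)
      fix F F' assume F: "F \<in> functors (cube_poset n) C" "F' \<in> functors (cube_poset n) C" "?f F = ?f F'"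
      then have "Fo F = Fo F'" "Fa F = Fa F'"
        using vs es v by (auto simp: functors_def intro!: extensionalityI)
      then show "F = F'" by (cases F; cases F') simp
    qed
    show "?f ` functors (cube_poset n) C \<subseteq> {xs. length xs = length vs \<and> set xs \<subseteq> Obj C} \<times> {xs. length xs = length es \<and> set xs \<subseteq> Arr C}"
    proof (intro image_subsetI)
      fix F assume F: "F \<in> functors (cube_poset n) C"
      then interpret F: cat_functor "cube_poset n" C F by (simp add: functors_def)
      have "Fa F e \<in> Arr C" if "e \<in> Arr (cube_poset n)" for e
        using F.Fa_in that by (auto simp: Hom_def)
      then show "?f F \<in> {xs. length xs = length vs \<and> set xs \<subseteq> Obj C} \<times> {xs. length xs = length es \<and> set xs \<subseteq> Arr C}"
        using F.Fo_in vs es v by auto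
    qed
  qed
qed

theorem corollary5p7:
  fixes A :: "('p, 'q, 'z) addcat_scheme"
    and C :: "('o, 'm, 'y) precat_scheme"
    and G :: "('m, 'm \<times> 'm \<times> 'm \<times> 'm, 'p, 'q) ftor"
    and n :: nat
  assumes "infinite (UNIV :: 'u set)"
    and "AB4_star_category TYPE('u) A"
    and "small_category TYPE('u) C"
    and "natural_system C A G"
  shows "isomorphic A (BW_cohomology A C G n)
           (cub_cohomology A (cubical_nerve C)
              (ftor_comp (elements (cubical_nerve C)) G diag_ftor) n)"
proof -
  interpret A: abelian_category A using assms(2) by (simp add: AB4_star_category_def)
  interpret G: cat_functor "fact_cat C" A G by fact
  have C: "category C" using assms(3) by (simp add: small_category_def)
  have AB3: "AB3_star TYPE('u) A" using assms(2) by (simp add: AB4_star_category_def)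
  \<comment> \<open>The locale needs some test object to start from; a zero object is one that is
    known to exist.\<close>
  obtain W where W: "W \<in> Obj A" using A.has_zero_object by (auto simp: zero_object_def)
  have "comparison C A G W"
    by (intro comparison.intro comparison_axioms.intro coefficients.intro coefficients_axioms.intro
      C A.preadditive_category_axioms G.cat_functor_axioms A.abelian_category_axioms W
      is_product_prod_ob[OF AB3] small_chains[OF assms(1,3)] small_cubes[OF assms(1,3)] small_finite[OF assms(1)]) auto
  then show ?thesis by (rule comparison.isomorphic_cohomology)
qed

end
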